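(* Every uniformly rational real algebraic variety is malleable.
   Context: A real algebraic variety is a ringed space with structure sheaf of $\mathbb{R}$-algebras of $\mathbb{R}$-valued functions which is isomorphic to a Zariski locally closed subset of some real projective space $\mathbb{P}^n(\mathbb{R})$, with the Zariski topology and the sheaf of regular functions; each such variety is affine, i.e. isomorphic to an algebraic subset of some $\mathbb{R}^n$. Morphisms are called regular maps: for algebraic sets $X\subset\mathbb{R}^n$, $Y\subset\mathbb{R}^p$ and $U\subset X$ Zariski open, a function $U\to\mathbb{R}$ is regular iff it equals $P/Q$ on $U$ for polynomials $P,Q$ with $Q$ nowhere zero on $U$, and a map $U\to Y$ is regular iff its components are. Isomorphisms are called biregular isomorphisms. An $n$-dimensional real algebraic variety $Y$ is uniformly rational if every point of $Y$ has a Zariski open neighborhood that is biregularly isomorphic to a Zariski open subset of $\mathbb{R}^n$ (in particular $Y$ is then nonsingular). Vector bundles are real; algebraic vector bundles over $Y$ are those algebraically isomorphic to algebraic subbundles of product bundles $Y\times\mathbb{R}^n$ (Bochnak–Coste–Roy). For a vector bundle $p:E\to Y$, $E_y=p^{-1}(y)$ and $0_y$ is the zero vector of $E_y$. Let $Y$ be a nonsingular real algebraic variety. A spray $(E,p,s)$ for $Y$ consists of an algebraic vector bundle $p:E\to Y$ and a regular map $s:E\to Y$ such that $s(0_y)=y$ for all $y\in Y$. It is dominating if for every $y\in Y$ the map $E_y\to Y$, $v\mapsto s(v)$ is a submersion at $0_y$. $Y$ is malleable if it admits a dominating spray. *)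

theory Defs
  imports "HOL-Analysis.Analysis" "HOL-Library.Extended_Nat"
begin

section \<open>Ringed spaces of real-valued functions\<close>

text \<open>
  The structure sheaf assigns to an open set \<open>U\<close> a set of functions \<^typ>\<open>'a \<Rightarrow> real\<close>.
  Only the values on \<open>U\<close> are meaningful: membership in \<open>sections X U\<close> says that the
  restriction to \<open>U\<close> is a section.  Values of \<open>sections X\<close> at non-open sets are never used.
\<close>

record 'a rspace =
  ztop :: "'a topology"
  sections :: "'a set \<Rightarrow> ('a \<Rightarrow> real) set"

abbreviation points :: "'a rspace \<Rightarrow> 'a set" where
  "points X \<equiv> topspace (ztop X)"

definition ringed_space :: "'a rspace \<Rightarrow> bool" where
  "ringed_space X \<longleftrightarrow>
     (\<forall>U f g. openin (ztop X) U \<and> f \<in> sections X U \<and> (\<forall>x\<in>U. g x = f x)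
        \<longrightarrow> g \<in> sections X U) \<and>
     (\<forall>U c. openin (ztop X) U \<longrightarrow> (\<lambda>x. c) \<in> sections X U) \<and>
     (\<forall>U f g. openin (ztop X) U \<and> f \<in> sections X U \<and> g \<in> sections X U
        \<longrightarrow> (\<lambda>x. f x + g x) \<in> sections X U \<and> (\<lambda>x. f x * g x) \<in> sections X U) \<and>
     (\<forall>U V f. openin (ztop X) U \<and> openin (ztop X) V \<and> V \<subseteq> U \<and> f \<in> sections X U
        \<longrightarrow> f \<in> sections X V) \<and>
     (\<forall>\<U> f. (\<forall>U\<in>\<U>. openin (ztop X) U \<and> f \<in> sections X U)
        \<longrightarrow> f \<in> sections X (\<Union>\<U>))"

definition regular_map :: "'a rspace \<Rightarrow> 'b rspace \<Rightarrow> ('a \<Rightarrow> 'b) \<Rightarrow> bool" where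
  "regular_map X Y f \<longleftrightarrow>
     continuous_map (ztop X) (ztop Y) f \<and>
     (\<forall>V g. openin (ztop Y) V \<and> g \<in> sections Y V
        \<longrightarrow> g \<circ> f \<in> sections X {x \<in> points X. f x \<in> V})"

definition biregular :: "'a rspace \<Rightarrow> 'b rspace \<Rightarrow> ('a \<Rightarrow> 'b) \<Rightarrow> bool" where
  "biregular X Y f \<longleftrightarrow>
     regular_map X Y f \<and>
     (\<exists>g. regular_map Y X g \<and> (\<forall>x\<in>points X. g (f x) = x) \<and> (\<forall>y\<in>points Y. f (g y) = y))"

definition isomorphic :: "'a rspace \<Rightarrow> 'b rspace \<Rightarrow> bool" where
  "isomorphic X Y \<longleftrightarrow> (\<exists>f. biregular X Y f)"

text \<open>
  The structure induced on an arbitrary subset: functions that are locally restrictions of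
  sections of the ambient space.  For open subsets this is the restricted sheaf, for closed
  subsets of varieties it is the usual closed subvariety structure.
\<close>

definition induced :: "'a rspace \<Rightarrow> 'a set \<Rightarrow> 'a rspace" where
  "induced X S =
     \<lparr> ztop = subtopology (ztop X) S,
       sections = (\<lambda>U. {f. \<forall>x\<in>U. \<exists>W g. openin (ztop X) W \<and> x \<in> W \<and> g \<in> sections X W \<and>
                                  (\<forall>z\<in>U \<inter> W. f z = g z)}) \<rparr>"

text \<open>
  Products of varieties.  \<open>tensors X Z U V\<close> is the image of the tensor product of the
  sections over \<open>U\<close> and over \<open>V\<close> in the functions on \<open>U \<times> V\<close>; the Zariski topology of the
  product (finer than the product topology) is generated by the nonvanishing loci of such
  functions, and the sections are locally quotients of them.
\<close>

definition tensors ::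
    "'a rspace \<Rightarrow> 'b rspace \<Rightarrow> 'a set \<Rightarrow> 'b set \<Rightarrow> ('a \<times> 'b \<Rightarrow> real) set" where
  "tensors X Z U V =
     {(\<lambda>(x, z). \<Sum>i<m. a i x * b i z) | (m::nat) a b.
        \<forall>i<m. a i \<in> sections X U \<and> b i \<in> sections Z V}"

definition product :: "'a rspace \<Rightarrow> 'b rspace \<Rightarrow> ('a \<times> 'b) rspace" where
  "product X Z =
     \<lparr> ztop = topology_generated_by
         {{q \<in> U \<times> V. h q \<noteq> 0} | U V h.
            openin (ztop X) U \<and> openin (ztop Z) V \<and> h \<in> tensors X Z U V},
       sections = (\<lambda>N. {f. \<forall>q\<in>N. \<exists>U V g h.
            openin (ztop X) U \<and> openin (ztop Z) V \<and> q \<in> U \<times> V \<and>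
            g \<in> tensors X Z U V \<and> h \<in> tensors X Z U V \<and> h q \<noteq> 0 \<and>
            (\<forall>q'\<in>N \<inter> (U \<times> V). h q' \<noteq> 0 \<longrightarrow> f q' = g q' / h q')}) \<rparr>"


section \<open>Affine and projective space, real algebraic varieties\<close>

text \<open>Points of \<open>\<real>\<^sup>n\<close> are sequences vanishing from index \<open>n\<close> on, so that \<open>n\<close> can be quantified.\<close>

definition Rn :: "nat \<Rightarrow> (nat \<Rightarrow> real) set" where
  "Rn n = {x. \<forall>i\<ge>n. x i = 0}"

definition lincomb :: "real \<Rightarrow> (nat \<Rightarrow> real) \<Rightarrow> real \<Rightarrow> (nat \<Rightarrow> real) \<Rightarrow> nat \<Rightarrow> real" where
  "lincomb a v b w = (\<lambda>i. a * v i + b * w i)"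

text \<open>Polynomial functions in the coordinates with index below \<open>n\<close>.\<close>

inductive_set polys :: "nat \<Rightarrow> ((nat \<Rightarrow> real) \<Rightarrow> real) set" for n where
  const: "(\<lambda>x. c) \<in> polys n"
| coord: "i < n \<Longrightarrow> (\<lambda>x. x i) \<in> polys n"
| add: "p \<in> polys n \<Longrightarrow> q \<in> polys n \<Longrightarrow> (\<lambda>x. p x + q x) \<in> polys n"
| mult: "p \<in> polys n \<Longrightarrow> q \<in> polys n \<Longrightarrow> (\<lambda>x. p x * q x) \<in> polys n"

definition affine_space :: "nat \<Rightarrow> (nat \<Rightarrow> real) rspace" where
  "affine_space n =
     \<lparr> ztop = topology_generated_by {{x \<in> Rn n. p x \<noteq> 0} | p. p \<in> polys n},
       sections = (\<lambda>U. {f. \<exists>p\<in>polys n. \<exists>q\<in>polys n. \<forall>x\<in>U. q x \<noteq> 0 \<and> f x = p x / q x}) \<rparr>"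

text \<open>Since \<open>\<real>\<close> is infinite, the scaling identity characterizes homogeneous polynomials.\<close>

definition homogeneous :: "nat \<Rightarrow> nat \<Rightarrow> ((nat \<Rightarrow> real) \<Rightarrow> real) set" where
  "homogeneous n d = {p \<in> polys n. \<forall>c x. p (\<lambda>i. c * x i) = c ^ d * p x}"

text \<open>
  A point of \<open>\<P>\<^sup>n(\<real>)\<close> is the set of all its homogeneous coordinate vectors, i.e. a line through
  the origin of \<open>\<real>\<^sup>n\<^sup>+\<^sup>1\<close> with the origin removed.
\<close>

definition proj_points :: "nat \<Rightarrow> (nat \<Rightarrow> real) set set" where
  "proj_points n =
     {{(\<lambda>i. c * x i) | c. c \<noteq> 0} | x. x \<in> Rn (Suc n) \<and> x \<noteq> (\<lambda>i. 0)}"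

definition projective_space :: "nat \<Rightarrow> (nat \<Rightarrow> real) set rspace" where
  "projective_space n =
     \<lparr> ztop = topology_generated_by
         {{L \<in> proj_points n. \<forall>x\<in>L. p x \<noteq> 0} | p d. p \<in> homogeneous (Suc n) d},
       sections = (\<lambda>U. {f. \<forall>L\<in>U. \<exists>d. \<exists>p\<in>homogeneous (Suc n) d. \<exists>q\<in>homogeneous (Suc n) d.
            (\<forall>x\<in>L. q x \<noteq> 0) \<and> (\<forall>M\<in>U. \<forall>x\<in>M. q x \<noteq> 0 \<longrightarrow> f M = p x / q x)}) \<rparr>"

definition real_algebraic_variety :: "'a rspace \<Rightarrow> bool" where
  "real_algebraic_variety X \<longleftrightarrow>
     ringed_space X \<and>
     (\<exists>n U C. openin (ztop (projective_space n)) U \<and> closedin (ztop (projective_space n)) C \<and>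
        isomorphic X (induced (projective_space n) (U \<inter> C)))"


section \<open>Dimension, tangent spaces, uniform rationality\<close>

definition irreducible_set :: "'a topology \<Rightarrow> 'a set \<Rightarrow> bool" where
  "irreducible_set T S \<longleftrightarrow> S \<subseteq> topspace T \<and> S \<noteq> {} \<and>
     (\<forall>A B. closedin T A \<and> closedin T B \<and> S \<subseteq> A \<union> B \<longrightarrow> S \<subseteq> A \<or> S \<subseteq> B)"

text \<open>Krull dimension of a topological space; by this convention the empty space has dimension 0.\<close>

definition krull_dim :: "'a topology \<Rightarrow> enat" where
  "krull_dim T = Sup {enat k | k. \<exists>C. (\<forall>i\<le>k. closedin T (C i) \<and> irreducible_set T (C i)) \<and>
                                     (\<forall>i<k. C i \<subset> C (Suc i))}"

definition local_dim :: "'a topology \<Rightarrow> 'a \<Rightarrow> enat" where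
  "local_dim T x = Inf {krull_dim (subtopology T U) | U. openin T U \<and> x \<in> U}"

definition uniformly_rational :: "'a rspace \<Rightarrow> bool" where
  "uniformly_rational Y \<longleftrightarrow>
     (\<exists>n. krull_dim (ztop Y) = enat n \<and>
        (\<forall>y\<in>points Y. \<exists>U W. openin (ztop Y) U \<and> y \<in> U \<and> openin (ztop (affine_space n)) W \<and>
           isomorphic (induced Y U) (induced (affine_space n) W)))"

text \<open>
  Zariski tangent space: the derivations of the stalk at \<open>x\<close>.  A derivation is presented on
  representatives \<open>(U, f)\<close> of germs and normalized to be 0 on pairs that represent no germ.
\<close>

definition tangent_space :: "'a rspace \<Rightarrow> 'a \<Rightarrow> ('a set \<Rightarrow> ('a \<Rightarrow> real) \<Rightarrow> real) set" where
  "tangent_space X x = {D.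
     (\<forall>U f. \<not> (openin (ztop X) U \<and> x \<in> U \<and> f \<in> sections X U) \<longrightarrow> D U f = 0) \<and>
     (\<forall>U V W f g. openin (ztop X) U \<and> openin (ztop X) V \<and> openin (ztop X) W \<and>
        x \<in> W \<and> W \<subseteq> U \<inter> V \<and> f \<in> sections X U \<and> g \<in> sections X V \<and> (\<forall>z\<in>W. f z = g z)
        \<longrightarrow> D U f = D V g) \<and>
     (\<forall>U f g c. openin (ztop X) U \<and> x \<in> U \<and> f \<in> sections X U \<and> g \<in> sections X U
        \<longrightarrow> D U (\<lambda>z. f z + g z) = D U f + D U g \<and>
            D U (\<lambda>z. c * f z) = c * D U f \<and>
            D U (\<lambda>z. f z * g z) = f x * D U g + g x * D U f)}"

definition tangent_dim_eq :: "'a rspace \<Rightarrow> 'a \<Rightarrow> nat \<Rightarrow> bool" where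
  "tangent_dim_eq X x d \<longleftrightarrow>
     (\<exists>B. (\<forall>i<d. B i \<in> tangent_space X x) \<and>
          (\<forall>D\<in>tangent_space X x. \<exists>!c. c \<in> Rn d \<and> D = (\<lambda>U f. \<Sum>i<d. c i * B i U f)))"

text \<open>
  The Krull dimension of the local ring of a real algebraic variety at \<open>y\<close> is the local
  dimension at \<open>y\<close>, so this says that all local rings are regular.
\<close>

definition nonsingular :: "'a rspace \<Rightarrow> bool" where
  "nonsingular Y \<longleftrightarrow> (\<forall>y\<in>points Y. \<exists>d. tangent_dim_eq Y y d \<and> local_dim (ztop Y) y = enat d)"

text \<open>Surjectivity of the differential of \<open>f\<close> on Zariski tangent spaces at \<open>x\<close>.\<close>

definition submersion_at :: "'a rspace \<Rightarrow> 'b rspace \<Rightarrow> ('a \<Rightarrow> 'b) \<Rightarrow> 'a \<Rightarrow> bool" where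
  "submersion_at X Y f x \<longleftrightarrow>
     (\<forall>D\<in>tangent_space Y (f x). \<exists>D'\<in>tangent_space X x.
        \<forall>V g. openin (ztop Y) V \<and> f x \<in> V \<and> g \<in> sections Y V
          \<longrightarrow> D V g = D' {z \<in> points X. f z \<in> V} (g \<circ> f))"


section \<open>Algebraic vector bundles, sprays, malleability\<close>

definition algebraic_subbundle ::
    "'a rspace \<Rightarrow> nat \<Rightarrow> ('a \<times> (nat \<Rightarrow> real)) set \<Rightarrow> bool" where
  "algebraic_subbundle Y k F \<longleftrightarrow>
     F \<subseteq> points Y \<times> Rn k \<and>
     (\<forall>y\<in>points Y. (y, \<lambda>i. 0) \<in> F \<and>
        (\<forall>v w a b. (y, v) \<in> F \<and> (y, w) \<in> F \<longrightarrow> (y, lincomb a v b w) \<in> F)) \<and>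
     (\<forall>y\<in>points Y. \<exists>U r h. openin (ztop Y) U \<and> y \<in> U \<and>
        biregular (product (induced Y U) (affine_space r))
          (induced (product Y (affine_space k)) (F \<inter> (U \<times> UNIV))) h \<and>
        (\<forall>x\<in>U. \<forall>v\<in>Rn r. fst (h (x, v)) = x) \<and>
        (\<forall>x\<in>U. \<forall>v\<in>Rn r. \<forall>w\<in>Rn r. \<forall>a b.
           snd (h (x, lincomb a v b w)) = lincomb a (snd (h (x, v))) b (snd (h (x, w)))))"

record ('e, 'a) vbundle =
  total :: "'e rspace"
  proj :: "'e \<Rightarrow> 'a"
  fzero :: "'a \<Rightarrow> 'e"
  fadd :: "'e \<Rightarrow> 'e \<Rightarrow> 'e"
  fscale :: "real \<Rightarrow> 'e \<Rightarrow> 'e"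

definition fiber :: "('e, 'a) vbundle \<Rightarrow> 'a \<Rightarrow> 'e set" where
  "fiber E y = {e \<in> points (total E). proj E e = y}"

definition algebraic_vector_bundle :: "'a rspace \<Rightarrow> ('e, 'a) vbundle \<Rightarrow> bool" where
  "algebraic_vector_bundle Y E \<longleftrightarrow>
     ringed_space (total E) \<and>
     regular_map (total E) Y (proj E) \<and>
     (\<forall>y\<in>points Y. fzero E y \<in> fiber E y \<and>
        (\<forall>e\<in>fiber E y. \<forall>e'\<in>fiber E y. fadd E e e' \<in> fiber E y) \<and>
        (\<forall>c. \<forall>e\<in>fiber E y. fscale E c e \<in> fiber E y)) \<and>
     (\<exists>k F \<phi>. algebraic_subbundle Y k F \<and>
        biregular (total E) (induced (product Y (affine_space k)) F) \<phi> \<and>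
        (\<forall>y\<in>points Y.
           (\<forall>e\<in>fiber E y. fst (\<phi> e) = y) \<and>
           snd (\<phi> (fzero E y)) = (\<lambda>i. 0) \<and>
           (\<forall>e\<in>fiber E y. \<forall>e'\<in>fiber E y.
              snd (\<phi> (fadd E e e')) = lincomb 1 (snd (\<phi> e)) 1 (snd (\<phi> e'))) \<and>
           (\<forall>c. \<forall>e\<in>fiber E y.
              snd (\<phi> (fscale E c e)) = lincomb c (snd (\<phi> e)) 0 (snd (\<phi> e)))))"

definition spray :: "'a rspace \<Rightarrow> ('e, 'a) vbundle \<Rightarrow> ('e \<Rightarrow> 'a) \<Rightarrow> bool" where
  "spray Y E s \<longleftrightarrow>
     algebraic_vector_bundle Y E \<and> regular_map (total E) Y s \<and>
     (\<forall>y\<in>points Y. s (fzero E y) = y)"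

definition dominating :: "'a rspace \<Rightarrow> ('e, 'a) vbundle \<Rightarrow> ('e \<Rightarrow> 'a) \<Rightarrow> bool" where
  "dominating Y E s \<longleftrightarrow>
     (\<forall>y\<in>points Y. submersion_at (induced (total E) (fiber E y)) Y s (fzero E y))"

text \<open>
  Every algebraic vector bundle over \<open>Y\<close> is isomorphic to one whose total space is a subset
  of \<open>Y \<times> \<real>\<^sup>k\<close>, so fixing the type of the points of \<open>E\<close> loses no generality.
\<close>

definition malleable :: "'a rspace \<Rightarrow> bool" where
  "malleable Y \<longleftrightarrow>
     nonsingular Y \<and>
     (\<exists>(E :: ('a \<times> (nat \<Rightarrow> real), 'a) vbundle) s. spray Y E s \<and> dominating Y E s)"

end

theory Submission
  imports Defs
begin

text \<open>
  The idea is Gromov's localization of sprays, made completely explicit.  An open subset \<open>W\<close> of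
  \<open>\<real>\<^sup>n\<close> carries the obvious partial spray \<open>(x, v) \<mapsto> x + v\<close>, and so does an open \<open>U\<close> of \<open>Y\<close> that
  is isomorphic to \<open>W\<close> by \<open>\<phi> : U \<rightarrow> W\<close> with inverse \<open>\<psi>\<close>.  It becomes a spray of all of \<open>Y\<close>, equal
  to the identity off the chart, once the vector is multiplied by a suitable regular function:
  \<open>s(y, v) = \<psi>(\<phi>(y) + \<lambda>(y, v) v)\<close>.  In coordinates \<open>\<phi> = A / b\<close> and \<open>\<psi> = p / c\<close> with
  polynomials, and clearing denominators gives
  \<open>b\<^sup>d c(A/b + h v) = Q\<^sub>0 + h T\<close> and \<open>b\<^sup>d p\<^sub>j(A/b + h v) = Q\<^sub>j + h T\<^sub>j\<close> with \<open>Q\<^sub>j = y\<^sub>j Q\<^sub>0\<close> on the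
  chart.
  For \<open>\<lambda> = h = Q\<^sub>0\<^sup>2 b \<mu>\<close> a factor \<open>Q\<^sub>0\<close> cancels, and the \<open>j\<close>-th coordinate of \<open>s\<close> becomes
  \<open>(y\<^sub>j + b Q\<^sub>0 \<mu> T\<^sub>j) / (1 + b Q\<^sub>0 \<mu> T)\<close>.  This is \<open>y\<^sub>j\<close> where \<open>b Q\<^sub>0\<close> vanishes, that is, off the
  chart, and it is regular everywhere if the denominator has no zero.  Here the real numbers
  help: \<open>\<mu> = 1 / (1 + H)\<close>, for a polynomial \<open>H\<close> that bounds \<open>|b Q\<^sub>0 T|\<close>, makes the denominator
  positive (\<open>chart_spray\<close>).  At zero the differential of \<open>v \<mapsto> s(y, v)\<close> is that of \<open>\<psi>\<close> times
  \<open>\<lambda>(y, 0)\<close>, hence \<open>s\<close> is submersive over the chart.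

  Composing such sprays, \<open>(y, v, w) \<mapsto> s\<^sub>2(s\<^sub>1(y, v), w)\<close>, gives one on a trivial bundle that is
  submersive over both charts (\<open>trivial_spray_compose\<close>), and finitely many charts cover \<open>Y\<close>
  because polynomial rings are Noetherian (\<open>polys_noetherian\<close>).

  All of this takes place in global coordinates.  A subset of \<open>\<P>\<^sup>n(\<real>)\<close> is mapped to a real vector
  space by \<open>x \<mapsto> x x\<^sup>T / |x|\<^sup>2\<close>, and both its topology and its sections are induced by the
  polynomials in these coordinates (\<open>real_algebraic_variety_coords\<close>).

  Malleability includes nonsingularity.  A derivation at a point is differentiation along any
  curve with the right velocity (\<open>derivation_along_curve\<close>), so in a chart the tangent space has
  a basis given by the coordinate lines.  The local dimension is at most \<open>n\<close> since \<open>Y\<close> has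
  dimension \<open>n\<close>, and at least \<open>n\<close> because the images of a flag of affine subspaces have
  irreducible closures (\<open>krull_dim_ge\<close>).
\<close>

section \<open>Polynomial functions\<close>

lemma polys_cong:
  assumes "p \<in> polys n" "\<And>i. i < n \<Longrightarrow> x i = y i"
  shows "p x = p y"
  using assms by (induction rule: polys.induct) auto

lemma polys_mono:
  assumes "p \<in> polys n" "n \<le> m"
  shows "p \<in> polys m"
  using assms by (induction rule: polys.induct) (auto intro: polys.intros)

lemma polys_cmult: "p \<in> polys n \<Longrightarrow> (\<lambda>x. c * p x) \<in> polys n"
  by (rule polys.mult[OF polys.const])

lemma polys_diff: "p \<in> polys n \<Longrightarrow> q \<in> polys n \<Longrightarrow> (\<lambda>x. p x - q x) \<in> polys n"
  using polys.add[of p n "\<lambda>x. (-1) * q x"] polys_cmult[of q n "-1"] by simp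

lemma polys_power: "p \<in> polys n \<Longrightarrow> (\<lambda>x. p x ^ k) \<in> polys n"
  by (induction k) (auto intro: polys.intros)

lemma polys_sum: "(\<And>i. i \<in> I \<Longrightarrow> f i \<in> polys n) \<Longrightarrow> (\<lambda>x. \<Sum>i\<in>I. f i x) \<in> polys n"
  by (induction I rule: infinite_finite_induct) (auto intro: polys.intros)

text \<open>
  Polynomials are only given as functions, so facts about them are proved along their
  inductive generation.
\<close>
lemma polys_subst:
  assumes "p \<in> polys n" "\<And>i. i < n \<Longrightarrow> (\<lambda>x. u x i) \<in> polys m"
  shows "(\<lambda>x. p (u x)) \<in> polys m"
  using assms by (induction rule: polys.induct) (auto intro: polys.intros)

text \<open>
  Concatenation of a vector of length \<open>N\<close> with a second one, so that polynomials on a product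
  with \<open>N\<close> coordinates in the first factor are again \<open>polys\<close>.
\<close>
definition catv :: "nat \<Rightarrow> (nat \<Rightarrow> real) \<Rightarrow> (nat \<Rightarrow> real) \<Rightarrow> nat \<Rightarrow> real" where
  "catv N a v = (\<lambda>i. if i < N then a i else v (i - N))"

lemma catv_left [simp]: "i < N \<Longrightarrow> catv N a v i = a i"
  and catv_right [simp]: "catv N a v (N + i) = v i"
  by (auto simp: catv_def)

lemma polys_catv_left:
  assumes "p \<in> polys N" shows "p (catv N a v) = p a"
  by (rule polys_cong[OF assms]) simp

lemma polys_shift:
  assumes "p \<in> polys M" shows "(\<lambda>x. p (\<lambda>i. x (N + i))) \<in> polys (N + M)"
  by (rule polys_subst[OF assms]) (auto intro: polys.intros)

text \<open>
  A polynomial in two groups of variables is a finite sum of products of polynomials in each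
  group; this is what makes a polynomial function on a product a tensor.
\<close>

lemma polys_catv_separate:
  assumes "p \<in> polys (N + M)"
  shows "\<exists>(m::nat) A B. (\<forall>i<m. A i \<in> polys N \<and> B i \<in> polys M) \<and>
           (\<forall>a v. p (catv N a v) = (\<Sum>i<m. A i a * B i v))"
proof -
  \<comment> \<open>The sums are indexed by sets of lists, a type that is closed under the disjoint unions
      and the products of index sets needed for sums and products of polynomials.\<close>
  define Sp where "Sp = {p. \<exists>(I::nat list set) A B. finite I \<and> (\<forall>i\<in>I. A i \<in> polys N \<and> B i \<in> polys M) \<and>
           (\<forall>a v. p (catv N a v) = (\<Sum>i\<in>I. A i a * B i v))}"
  have one: "p \<in> Sp" if "A \<in> polys N" "B \<in> polys M" "\<And>a v. p (catv N a v) = A a * B v" for p A B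
    unfolding Sp_def using that
    by (intro CollectI exI[of _ "{[]}"] exI[of _ "\<lambda>_. A"] exI[of _ "\<lambda>_. B"]) auto
  have "p \<in> Sp" using assms
  proof (induction rule: polys.induct)
    case (const c)
    show ?case by (rule one[OF polys.const[of c] polys.const[of 1]]) simp
  next
    case (coord i)
    show ?case
    proof (cases "i < N")
      case True
      then show ?thesis by (intro one[OF polys.coord[of i] polys.const[of 1]]) auto
    next
      case False
      with coord show ?thesis
        by (intro one[OF polys.const[of 1] polys.coord[of "i - N"]]) (auto simp: catv_def)
    qed
  next
    case (add p q)
    from add.IH(1) obtain I A B where 1: "finite (I::nat list set)" "\<forall>i\<in>I. A i \<in> polys N \<and> B i \<in> polys M"
      "\<forall>a v. p (catv N a v) = (\<Sum>i\<in>I. A i a * B i v)" unfolding Sp_def by blast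
    from add.IH(2) obtain J A' B' where 2: "finite (J::nat list set)" "\<forall>i\<in>J. A' i \<in> polys N \<and> B' i \<in> polys M"
      "\<forall>a v. q (catv N a v) = (\<Sum>i\<in>J. A' i a * B' i v)" unfolding Sp_def by blast
    define K where "K = Cons 0 ` I \<union> Cons 1 ` J"
    define A2 where "A2 l = (if hd l = 0 then A (tl l) else A' (tl l))" for l :: "nat list"
    define B2 where "B2 l = (if hd l = 0 then B (tl l) else B' (tl l))" for l :: "nat list"
    have "(\<Sum>i\<in>K. A2 i a * B2 i v) = p (catv N a v) + q (catv N a v)" for a v
    proof -
      have "(\<Sum>i\<in>K. A2 i a * B2 i v) = (\<Sum>i\<in>Cons 0 ` I. A2 i a * B2 i v) + (\<Sum>i\<in>Cons 1 ` J. A2 i a * B2 i v)"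
        unfolding K_def by (rule sum.union_disjoint) (use 1 2 in auto)
      also have "\<dots> = p (catv N a v) + q (catv N a v)"
        by (subst (1 2) sum.reindex) (auto simp: A2_def B2_def 1 2)
      finally show ?thesis .
    qed
    moreover have "finite K" "\<forall>i\<in>K. A2 i \<in> polys N \<and> B2 i \<in> polys M"
      using 1 2 by (auto simp: K_def A2_def B2_def)
    ultimately show ?case unfolding Sp_def
      by (intro CollectI exI[of _ K] exI[of _ A2] exI[of _ B2]) auto
  next
    case (mult p q)
    from mult.IH(1) obtain I A B where 1: "finite (I::nat list set)" "\<forall>i\<in>I. A i \<in> polys N \<and> B i \<in> polys M"
      "\<forall>a v. p (catv N a v) = (\<Sum>i\<in>I. A i a * B i v)" unfolding Sp_def by blast
    from mult.IH(2) obtain J A' B' where 2: "finite (J::nat list set)" "\<forall>i\<in>J. A' i \<in> polys N \<and> B' i \<in> polys M"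
      "\<forall>a v. q (catv N a v) = (\<Sum>i\<in>J. A' i a * B' i v)" unfolding Sp_def by blast
    obtain f :: "nat list \<times> nat list \<Rightarrow> nat list" where f: "inj f"
      by (rule that[of "\<lambda>(x,y). length x # x @ y"]) (auto simp: inj_on_def)
    define A2 where "A2 l = (\<lambda>a. A (fst (inv f l)) a * A' (snd (inv f l)) a)" for l
    define B2 where "B2 l = (\<lambda>a. B (fst (inv f l)) a * B' (snd (inv f l)) a)" for l
    have "(\<Sum>i\<in>f ` (I \<times> J). A2 i a * B2 i v) = p (catv N a v) * q (catv N a v)" for a v
      by (subst sum.reindex[OF inj_on_subset[OF f]])
         (auto simp: A2_def B2_def inv_f_f[OF f] 1 2 sum_product sum.cartesian_product intro!: sum.cong)
    moreover have "finite (f ` (I \<times> J))" "\<forall>i\<in>f ` (I \<times> J). A2 i \<in> polys N \<and> B2 i \<in> polys M"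
      using 1 2 by (auto simp: A2_def B2_def inv_f_f[OF f] intro!: polys.mult)
    ultimately show ?case unfolding Sp_def
      by (intro CollectI exI[of _ "f ` (I \<times> J)"] exI[of _ A2] exI[of _ B2]) auto
  qed
  then obtain I A B where 1: "finite (I::nat list set)" "\<forall>i\<in>I. A i \<in> polys N \<and> B i \<in> polys M"
      "\<forall>a v. p (catv N a v) = (\<Sum>i\<in>I. A i a * B i v)" unfolding Sp_def by blast
  obtain h where h: "bij_betw h {..<card I} I"
    using ex_bij_betw_nat_finite[OF 1(1)] by (auto simp: atLeast0LessThan)
  have "p (catv N a v) = (\<Sum>i<card I. A (h i) a * B (h i) v)" for a v
    using 1(3) sum.reindex_bij_betw[OF h, of "\<lambda>i. A i a * B i v"] by simp
  moreover have "\<forall>i<card I. A (h i) \<in> polys N \<and> B (h i) \<in> polys M"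
    using 1(2) bij_betwE[OF h] by auto
  ultimately show ?thesis
    by (intro exI[of _ "card I"] exI[of _ "\<lambda>i. A (h i)"] exI[of _ "\<lambda>i. B (h i)"]) auto
qed

section \<open>Functions that are locally quotients of polynomials in given coordinates\<close>

text \<open>
  The sets that are open for the Zariski topology pulled back along \<open>e\<close>, and the functions that
  are locally quotients of polynomials in the coordinates \<open>e\<close>.  As for the sections of a ringed
  space, only the values on \<open>U\<close> matter.  A condition \<open>q (e x) \<noteq> 0\<close> takes the place of an open
  neighborhood of \<open>x\<close>: the quotient is valid where \<open>q\<close> does not vanish.
\<close>
definition zopen :: "'a set \<Rightarrow> nat \<Rightarrow> ('a \<Rightarrow> nat \<Rightarrow> real) \<Rightarrow> 'a set \<Rightarrow> bool" where
  "zopen P N e U \<longleftrightarrow> U \<subseteq> P \<and> (\<forall>x\<in>U. \<exists>p\<in>polys N. p (e x) \<noteq> 0 \<and> (\<forall>z\<in>P. p (e z) \<noteq> 0 \<longrightarrow> z \<in> U))"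

definition locrat :: "nat \<Rightarrow> ('a \<Rightarrow> nat \<Rightarrow> real) \<Rightarrow> 'a set \<Rightarrow> ('a \<Rightarrow> real) set" where
  "locrat N e U = {f. \<forall>x\<in>U. \<exists>p\<in>polys N. \<exists>q\<in>polys N. q (e x) \<noteq> 0 \<and>
      (\<forall>z\<in>U. q (e z) \<noteq> 0 \<longrightarrow> f z = p (e z) / q (e z))}"

lemma locratI:
  assumes "\<And>x. x \<in> U \<Longrightarrow> \<exists>p\<in>polys N. \<exists>q\<in>polys N. q (e x) \<noteq> 0 \<and>
      (\<forall>z\<in>U. q (e z) \<noteq> 0 \<longrightarrow> f z = p (e z) / q (e z))"
  shows "f \<in> locrat N e U"
  using assms unfolding locrat_def by blast

lemma locratE:
  assumes "f \<in> locrat N e U" "x \<in> U"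
  obtains p q where "p \<in> polys N" "q \<in> polys N" "q (e x) \<noteq> 0"
    "\<And>z. z \<in> U \<Longrightarrow> q (e z) \<noteq> 0 \<Longrightarrow> f z = p (e z) / q (e z)"
  using assms unfolding locrat_def by blast

lemma locrat_subset: "f \<in> locrat N e U \<Longrightarrow> V \<subseteq> U \<Longrightarrow> f \<in> locrat N e V"
  unfolding locrat_def by blast

lemma locrat_cong: "f \<in> locrat N e U \<Longrightarrow> (\<And>x. x \<in> U \<Longrightarrow> g x = f x) \<Longrightarrow> g \<in> locrat N e U"
  unfolding locrat_def by auto

lemma locrat_poly:
  assumes "p \<in> polys N" shows "(\<lambda>z. p (e z)) \<in> locrat N e U"
  by (rule locratI, rule bexI[OF _ assms], rule bexI[OF _ polys.const[of 1]]) auto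

lemma locrat_const: "(\<lambda>z. c) \<in> locrat N e U"
  using locrat_poly[OF polys.const[of c]] .

lemma locrat_coord: "i < N \<Longrightarrow> (\<lambda>z. e z i) \<in> locrat N e U"
  by (rule locrat_poly[OF polys.coord])

lemma locrat_add:
  assumes "f \<in> locrat N e U" "g \<in> locrat N e U"
  shows "(\<lambda>z. f z + g z) \<in> locrat N e U"
proof (rule locratI)
  fix x assume "x \<in> U"
  from locratE[OF assms(1) this] obtain p q where 1: "p \<in> polys N" "q \<in> polys N" "q (e x) \<noteq> 0"
    "\<And>z. z \<in> U \<Longrightarrow> q (e z) \<noteq> 0 \<Longrightarrow> f z = p (e z) / q (e z)" by metis
  from locratE[OF assms(2) \<open>x \<in> U\<close>] obtain p' q' where 2: "p' \<in> polys N" "q' \<in> polys N" "q' (e x) \<noteq> 0"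
    "\<And>z. z \<in> U \<Longrightarrow> q' (e z) \<noteq> 0 \<Longrightarrow> g z = p' (e z) / q' (e z)" by metis
  show "\<exists>p\<in>polys N. \<exists>q\<in>polys N. q (e x) \<noteq> 0 \<and> (\<forall>z\<in>U. q (e z) \<noteq> 0 \<longrightarrow> f z + g z = p (e z) / q (e z))"
  proof (rule bexI[of _ "\<lambda>x. p x * q' x + p' x * q x"], rule bexI[of _ "\<lambda>x. q x * q' x"])
  qed (use 1 2 in \<open>auto intro!: polys.intros simp: field_simps\<close>)
qed

lemma locrat_mult:
  assumes "f \<in> locrat N e U" "g \<in> locrat N e U"
  shows "(\<lambda>z. f z * g z) \<in> locrat N e U"
proof (rule locratI)
  fix x assume "x \<in> U"
  from locratE[OF assms(1) this] obtain p q where 1: "p \<in> polys N" "q \<in> polys N" "q (e x) \<noteq> 0"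
    "\<And>z. z \<in> U \<Longrightarrow> q (e z) \<noteq> 0 \<Longrightarrow> f z = p (e z) / q (e z)" by metis
  from locratE[OF assms(2) \<open>x \<in> U\<close>] obtain p' q' where 2: "p' \<in> polys N" "q' \<in> polys N" "q' (e x) \<noteq> 0"
    "\<And>z. z \<in> U \<Longrightarrow> q' (e z) \<noteq> 0 \<Longrightarrow> g z = p' (e z) / q' (e z)" by metis
  show "\<exists>p\<in>polys N. \<exists>q\<in>polys N. q (e x) \<noteq> 0 \<and> (\<forall>z\<in>U. q (e z) \<noteq> 0 \<longrightarrow> f z * g z = p (e z) / q (e z))"
  proof (rule bexI[of _ "\<lambda>x. p x * p' x"], rule bexI[of _ "\<lambda>x. q x * q' x"])
  qed (use 1(1-3) 2(1-3) in \<open>auto intro!: polys.intros simp: 1(4) 2(4)\<close>)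
qed

lemma locrat_divide:
  assumes "f \<in> locrat N e U" "g \<in> locrat N e U" "\<And>z. z \<in> U \<Longrightarrow> g z \<noteq> 0"
  shows "(\<lambda>z. f z / g z) \<in> locrat N e U"
proof (rule locratI)
  fix x assume x: "x \<in> U"
  from locratE[OF assms(1) this] obtain p q where 1: "p \<in> polys N" "q \<in> polys N" "q (e x) \<noteq> 0"
    "\<And>z. z \<in> U \<Longrightarrow> q (e z) \<noteq> 0 \<Longrightarrow> f z = p (e z) / q (e z)" by metis
  from locratE[OF assms(2) x] obtain p' q' where 2: "p' \<in> polys N" "q' \<in> polys N" "q' (e x) \<noteq> 0"
    "\<And>z. z \<in> U \<Longrightarrow> q' (e z) \<noteq> 0 \<Longrightarrow> g z = p' (e z) / q' (e z)" by metis
  have "p' (e x) \<noteq> 0" using 2(4)[OF x 2(3)] assms(3)[OF x] by auto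
  show "\<exists>p\<in>polys N. \<exists>q\<in>polys N. q (e x) \<noteq> 0 \<and> (\<forall>z\<in>U. q (e z) \<noteq> 0 \<longrightarrow> f z / g z = p (e z) / q (e z))"
  proof (rule bexI[of _ "\<lambda>x. p x * q' x * q' x"], rule bexI[of _ "\<lambda>x. q x * (p' x * q' x)"])
  qed (use 1(1-3) 2(1-3) \<open>p' (e x) \<noteq> 0\<close> in \<open>auto intro!: polys.intros simp: 1(4) 2(4)\<close>)
qed

lemma locrat_sum:
  "(\<And>i. i \<in> I \<Longrightarrow> f i \<in> locrat N e U) \<Longrightarrow> (\<lambda>z. \<Sum>i\<in>I. f i z) \<in> locrat N e U"
  by (induction I rule: infinite_finite_induct) (auto intro: locrat_const locrat_add)

lemma locrat_poly_subst:
  assumes "p \<in> polys n" "\<And>i. i < n \<Longrightarrow> (\<lambda>x. u x i) \<in> locrat N e U"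
  shows "(\<lambda>x. p (u x)) \<in> locrat N e U"
  using assms by (induction rule: polys.induct) (auto intro: locrat_const locrat_add locrat_mult)

text \<open>
  Both the numerator and the denominator of \<open>g\<close> become quotients after composition with \<open>f\<close>;
  this is why a map with regular coordinates pulls back regular functions.
\<close>
lemma locrat_comp:
  assumes g: "g \<in> locrat M e' V" and f: "\<And>i. i < M \<Longrightarrow> (\<lambda>x. e' (f x) i) \<in> locrat N e U"
    and UV: "f ` U \<subseteq> V"
  shows "(\<lambda>x. g (f x)) \<in> locrat N e U"
proof (rule locratI)
  fix x assume x: "x \<in> U"
  with UV have "f x \<in> V" by auto
  from locratE[OF g this] obtain p q where 1: "p \<in> polys M" "q \<in> polys M" "q (e' (f x)) \<noteq> 0"
    "\<And>z. z \<in> V \<Longrightarrow> q (e' z) \<noteq> 0 \<Longrightarrow> g z = p (e' z) / q (e' z)" by metis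
  have "(\<lambda>x. p (e' (f x))) \<in> locrat N e U" by (rule locrat_poly_subst[OF 1(1) f])
  from locratE[OF this x] obtain P Q where 2: "P \<in> polys N" "Q \<in> polys N" "Q (e x) \<noteq> 0"
    "\<And>z. z \<in> U \<Longrightarrow> Q (e z) \<noteq> 0 \<Longrightarrow> p (e' (f z)) = P (e z) / Q (e z)" by metis
  have "(\<lambda>x. q (e' (f x))) \<in> locrat N e U" by (rule locrat_poly_subst[OF 1(2) f])
  from locratE[OF this x] obtain P' Q' where 3: "P' \<in> polys N" "Q' \<in> polys N" "Q' (e x) \<noteq> 0"
    "\<And>z. z \<in> U \<Longrightarrow> Q' (e z) \<noteq> 0 \<Longrightarrow> q (e' (f z)) = P' (e z) / Q' (e z)" by metis
  have P': "P' (e x) \<noteq> 0" using 3(4)[OF x 3(3)] 1(3) by auto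
  show "\<exists>p\<in>polys N. \<exists>q\<in>polys N. q (e x) \<noteq> 0 \<and> (\<forall>z\<in>U. q (e z) \<noteq> 0 \<longrightarrow> g (f z) = p (e z) / q (e z))"
  proof (rule bexI[of _ "\<lambda>x. P x * Q' x * Q' x"], rule bexI[of _ "\<lambda>x. Q x * (P' x * Q' x)"], safe)
    fix z assume "z \<in> U" and nz: "Q (e z) * (P' (e z) * Q' (e z)) \<noteq> 0"
    with UV have "g (f z) = p (e' (f z)) / q (e' (f z))"
      using 3(4)[of z] by (intro 1(4)) auto
    then show "g (f z) = P (e z) * Q' (e z) * Q' (e z) / (Q (e z) * (P' (e z) * Q' (e z)))"
      using \<open>z \<in> U\<close> nz by (simp add: 2(4) 3(4))
  qed (use 1 2 3 P' in \<open>auto intro!: polys.intros\<close>)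
qed

lemma locrat_nonzero_near:
  assumes "f \<in> locrat N e U" "x \<in> U" "f x \<noteq> 0"
  obtains p where "p \<in> polys N" "p (e x) \<noteq> 0" "\<And>z. z \<in> U \<Longrightarrow> p (e z) \<noteq> 0 \<Longrightarrow> f z \<noteq> 0"
proof -
  from locratE[OF assms(1,2)] obtain p q where 1: "p \<in> polys N" "q \<in> polys N" "q (e x) \<noteq> 0"
    "\<And>z. z \<in> U \<Longrightarrow> q (e z) \<noteq> 0 \<Longrightarrow> f z = p (e z) / q (e z)" by metis
  show thesis
    by (rule that[of "\<lambda>x. p x * q x"]) (use 1 assms 1(4)[OF assms(2)] in \<open>auto intro: polys.intros\<close>)
qed

text \<open>
  Near a point a map with finitely many regular coordinates has the form \<open>A / b\<close>.
\<close>
lemma locrat_common_denominator: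
  assumes "\<And>i. i < (n::nat) \<Longrightarrow> f i \<in> locrat N e U" "x \<in> U"
  shows "\<exists>A b. (\<forall>i<n. A i \<in> polys N) \<and> b \<in> polys N \<and> b (e x) \<noteq> 0 \<and>
           (\<forall>i<n. \<forall>z\<in>U. b (e z) \<noteq> 0 \<longrightarrow> f i z = A i (e z) / b (e z))"
  using assms(1)
proof (induction n)
  case 0
  show ?case by (rule exI, rule exI[of _ "\<lambda>_. 1"]) (auto intro: polys.intros)
next
  case (Suc n)
  then obtain A b where 1: "\<forall>i<n. A i \<in> polys N" "b \<in> polys N" "b (e x) \<noteq> 0"
    "\<forall>i<n. \<forall>z\<in>U. b (e z) \<noteq> 0 \<longrightarrow> f i z = A i (e z) / b (e z)" by (auto simp: less_Suc_eq)
  from locratE[OF Suc.prems[of n] assms(2)] obtain p q where 2: "p \<in> polys N" "q \<in> polys N" "q (e x) \<noteq> 0"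
    "\<And>z. z \<in> U \<Longrightarrow> q (e z) \<noteq> 0 \<Longrightarrow> f n z = p (e z) / q (e z)" by blast
  show ?case
    by (rule exI[of _ "\<lambda>i. if i = n then (\<lambda>x. p x * b x) else (\<lambda>x. A i x * q x)"],
        rule exI[of _ "\<lambda>x. b x * q x"])
       (use 1 2 in \<open>auto simp: less_Suc_eq intro!: polys.intros\<close>)
qed

lemma zopenE:
  assumes "zopen P N e U" "x \<in> U"
  obtains p where "p \<in> polys N" "p (e x) \<noteq> 0" "\<And>z. z \<in> P \<Longrightarrow> p (e z) \<noteq> 0 \<Longrightarrow> z \<in> U"
  using assms unfolding zopen_def by blast

lemma zopen_Int: assumes "zopen P N e U" "zopen P N e V" shows "zopen P N e (U \<inter> V)"
  unfolding zopen_def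
proof safe
  fix x assume x: "x \<in> U" "x \<in> V"
  obtain p where p: "p \<in> polys N" "p (e x) \<noteq> 0" "\<forall>z\<in>P. p (e z) \<noteq> 0 \<longrightarrow> z \<in> U"
    using assms(1) x unfolding zopen_def by blast
  obtain q where q: "q \<in> polys N" "q (e x) \<noteq> 0" "\<forall>z\<in>P. q (e z) \<noteq> 0 \<longrightarrow> z \<in> V"
    using assms(2) x unfolding zopen_def by blast
  show "\<exists>p\<in>polys N. p (e x) \<noteq> 0 \<and> (\<forall>z\<in>P. p (e z) \<noteq> 0 \<longrightarrow> z \<in> U \<inter> V)"
    by (rule bexI[of _ "\<lambda>x. p x * q x"]) (use p q in \<open>auto intro: polys.intros\<close>)
qed (use assms in \<open>auto simp: zopen_def\<close>)

lemma zopen_Union: assumes "\<And>U. U \<in> K \<Longrightarrow> zopen P N e U" shows "zopen P N e (\<Union>K)"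
  unfolding zopen_def
proof (intro conjI ballI)
  fix x assume "x \<in> \<Union>K"
  then obtain U where U: "U \<in> K" "x \<in> U" by auto
  then obtain p where "p \<in> polys N" "p (e x) \<noteq> 0" "\<forall>z\<in>P. p (e z) \<noteq> 0 \<longrightarrow> z \<in> U"
    using assms[OF U(1)] unfolding zopen_def by auto
  then show "\<exists>p\<in>polys N. p (e x) \<noteq> 0 \<and> (\<forall>z\<in>P. p (e z) \<noteq> 0 \<longrightarrow> z \<in> \<Union> K)"
    using U(1) by (intro bexI[of _ p]) auto
qed (use assms in \<open>auto simp: zopen_def\<close>)

lemma zopen_basic: "p \<in> polys N \<Longrightarrow> zopen P N e {z\<in>P. p (e z) \<noteq> 0}"
  unfolding zopen_def by auto

text \<open>
  Affine space, projective space and products all have topologies generated by nonvanishing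
  sets; the three are identified with pulled-back Zariski topologies by this criterion.
\<close>
lemma openin_generated_iff_zopen:
  assumes top: "\<Union>B = P" and BZ: "\<And>U. U \<in> B \<Longrightarrow> zopen P N e U"
    and ZB: "\<And>p. p \<in> polys N \<Longrightarrow> openin (topology_generated_by B) {z\<in>P. p (e z) \<noteq> 0}"
  shows "openin (topology_generated_by B) U \<longleftrightarrow> zopen P N e U"
proof
  assume "openin (topology_generated_by B) U"
  then have "generate_topology_on B U" by (simp add: openin_topology_generated_by)
  then show "zopen P N e U"
    by (induction) (auto intro: zopen_Int zopen_Union BZ, simp add: zopen_def)
next
  assume U: "zopen P N e U"
  show "openin (topology_generated_by B) U"
  proof (subst openin_subopen, safe)
    fix x assume x: "x \<in> U"
    then obtain p where p: "p \<in> polys N" "p (e x) \<noteq> 0" "\<forall>z\<in>P. p (e z) \<noteq> 0 \<longrightarrow> z \<in> U" "x \<in> P"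
      using U unfolding zopen_def by blast
    then show "\<exists>T. openin (topology_generated_by B) T \<and> x \<in> T \<and> T \<subseteq> U"
      by (intro exI[of _ "{z\<in>P. p (e z) \<noteq> 0}"]) (auto intro: ZB)
  qed
qed

section \<open>Varieties with global coordinates\<close>

text \<open>
  \<open>coords X N e\<close> says that the topology and the sections of \<open>X\<close> are those of a subset of \<open>\<real>\<^sup>N\<close>
  with coordinate map \<open>e\<close>.
  For affine space the sections are global quotients of polynomials.  \<open>precoords\<close> asks for no
  gluing of local quotients, and so it applies to affine space at once; passing to an induced
  structure turns it into \<open>coords\<close>.
\<close>
definition precoords :: "'a rspace \<Rightarrow> nat \<Rightarrow> ('a \<Rightarrow> nat \<Rightarrow> real) \<Rightarrow> bool" where
  "precoords X N e \<longleftrightarrow> (\<forall>U. openin (ztop X) U \<longleftrightarrow> zopen (points X) N e U) \<and>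
     (\<forall>U f. openin (ztop X) U \<and> f \<in> sections X U \<longrightarrow> f \<in> locrat N e U) \<and>
     (\<forall>p\<in>polys N. \<forall>q\<in>polys N. (\<lambda>z. p (e z) / q (e z)) \<in> sections X {z \<in> points X. q (e z) \<noteq> 0})"

definition coords :: "'a rspace \<Rightarrow> nat \<Rightarrow> ('a \<Rightarrow> nat \<Rightarrow> real) \<Rightarrow> bool" where
  "coords X N e \<longleftrightarrow> (\<forall>U. openin (ztop X) U \<longleftrightarrow> zopen (points X) N e U) \<and>
     (\<forall>U f. openin (ztop X) U \<longrightarrow> (f \<in> sections X U \<longleftrightarrow> f \<in> locrat N e U))"

lemma precoordsD:
  assumes "precoords X N e"
  shows "openin (ztop X) U \<longleftrightarrow> zopen (points X) N e U"
    "openin (ztop X) U \<Longrightarrow> f \<in> sections X U \<Longrightarrow> f \<in> locrat N e U"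
    "p \<in> polys N \<Longrightarrow> q \<in> polys N \<Longrightarrow> (\<lambda>z. p (e z) / q (e z)) \<in> sections X {z \<in> points X. q (e z) \<noteq> 0}"
  using assms unfolding precoords_def by auto

lemma coordsD:
  assumes "coords X N e"
  shows "openin (ztop X) U \<longleftrightarrow> zopen (points X) N e U"
    "openin (ztop X) U \<Longrightarrow> f \<in> sections X U \<longleftrightarrow> f \<in> locrat N e U"
  using assms unfolding coords_def by auto

lemma coords_imp_precoords:
  assumes "coords X N e" shows "precoords X N e"
  unfolding precoords_def
proof (intro conjI allI ballI impI)
  fix p q assume pq: "p \<in> polys N" "q \<in> polys N"
  have "openin (ztop X) {z \<in> points X. q (e z) \<noteq> 0}"
    using coordsD(1)[OF assms] zopen_basic[OF pq(2)] by blast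
  moreover have "(\<lambda>z. p (e z) / q (e z)) \<in> locrat N e {z \<in> points X. q (e z) \<noteq> 0}"
    by (rule locrat_divide) (use pq in \<open>auto intro: locrat_poly\<close>)
  ultimately show "(\<lambda>z. p (e z) / q (e z)) \<in> sections X {z \<in> points X. q (e z) \<noteq> 0}"
    using coordsD(2)[OF assms] by blast
qed (use assms in \<open>auto simp: coords_def\<close>)

lemma precoords_poly_section:
  assumes "precoords X N e" "p \<in> polys N"
  shows "(\<lambda>z. p (e z)) \<in> sections X (points X)"
  using precoordsD(3)[OF assms(1,2) polys.const[of 1]] by simp

lemma coords_ringed_space:
  assumes X: "coords X N e" shows "ringed_space X"
  unfolding ringed_space_def
proof (intro conjI allI impI)
  fix K f assume K: "\<forall>U\<in>K. openin (ztop X) U \<and> f \<in> sections X U"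
  have op: "openin (ztop X) (\<Union>K)" using K by auto
  have "f \<in> locrat N e (\<Union>K)"
  proof (rule locratI)
    fix x assume "x \<in> \<Union>K"
    then obtain U where U: "U \<in> K" "x \<in> U" by auto
    then have "zopen (points X) N e U" "f \<in> locrat N e U" using K coordsD[OF X] by auto
    then obtain r where r: "r \<in> polys N" "r (e x) \<noteq> 0" "\<And>z. z \<in> points X \<Longrightarrow> r (e z) \<noteq> 0 \<Longrightarrow> z \<in> U"
      using U unfolding zopen_def by blast
    from locratE[OF \<open>f \<in> locrat N e U\<close> U(2)] obtain p q where pq: "p \<in> polys N" "q \<in> polys N" "q (e x) \<noteq> 0"
      "\<And>z. z \<in> U \<Longrightarrow> q (e z) \<noteq> 0 \<Longrightarrow> f z = p (e z) / q (e z)" by blast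
    have "z \<in> points X" if "z \<in> U'" "U' \<in> K" for z U'
      using that K openin_subset by blast
    then show "\<exists>p\<in>polys N. \<exists>q\<in>polys N. q (e x) \<noteq> 0 \<and> (\<forall>z\<in>\<Union>K. q (e z) \<noteq> 0 \<longrightarrow> f z = p (e z) / q (e z))"
      by (intro bexI[of _ "\<lambda>x. p x * r x"] bexI[of _ "\<lambda>x. q x * r x"])
         (use pq r in \<open>auto intro!: polys.mult simp del: Union_iff dest!: UnionE\<close>)
  qed
  then show "f \<in> sections X (\<Union>K)" using coordsD(2)[OF X op] by simp
qed (use coordsD(2)[OF X] in \<open>auto intro: locrat_const locrat_add locrat_mult locrat_subset locrat_cong\<close>)

text \<open>
  Continuity and regularity both reduce to the coordinates of the target, because the topology
  and the sections there are expressed by polynomials in these coordinates.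
\<close>
lemma regular_map_by_coords:
  assumes X: "coords X N e" and Z: "precoords Z M e'"
    and fP: "\<And>x. x \<in> points X \<Longrightarrow> f x \<in> points Z"
    and f: "\<And>i. i < M \<Longrightarrow> (\<lambda>x. e' (f x) i) \<in> locrat N e (points X)"
  shows "regular_map X Z f"
proof -
  have op: "openin (ztop X) {x \<in> points X. f x \<in> V}" if V: "openin (ztop Z) V" for V
    unfolding coordsD(1)[OF X] zopen_def
  proof (intro conjI ballI)
    fix x assume x: "x \<in> {x \<in> points X. f x \<in> V}"
    have "zopen (points Z) M e' V" using V precoordsD(1)[OF Z] by blast
    then obtain p where p: "p \<in> polys M" "p (e' (f x)) \<noteq> 0"
      "\<And>z. z \<in> points Z \<Longrightarrow> p (e' z) \<noteq> 0 \<Longrightarrow> z \<in> V"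
      using x unfolding zopen_def by blast
    have "(\<lambda>x. p (e' (f x))) \<in> locrat N e (points X)" by (rule locrat_poly_subst[OF p(1) f])
    then obtain q where "q \<in> polys N" "q (e x) \<noteq> 0"
      "\<And>z. z \<in> points X \<Longrightarrow> q (e z) \<noteq> 0 \<Longrightarrow> p (e' (f z)) \<noteq> 0"
      by (rule locrat_nonzero_near[of _ N e "points X" x]) (use x p in auto)
    then show "\<exists>p\<in>polys N. p (e x) \<noteq> 0 \<and> (\<forall>z\<in>points X. p (e z) \<noteq> 0 \<longrightarrow> z \<in> {x \<in> points X. f x \<in> V})"
      by (intro bexI[of _ q]) (use p fP in auto)
  qed auto
  have "g \<circ> f \<in> sections X {x \<in> points X. f x \<in> V}" if V: "openin (ztop Z) V" "g \<in> sections Z V" for V g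
  proof -
    have "(\<lambda>x. g (f x)) \<in> locrat N e {x \<in> points X. f x \<in> V}"
      by (rule locrat_comp[OF precoordsD(2)[OF Z V]]) (auto intro: locrat_subset[OF f])
    then show ?thesis using coordsD(2)[OF X op[OF V(1)]] by (simp add: o_def)
  qed
  then show ?thesis
    unfolding regular_map_def continuous_map_def using op fP by auto
qed

lemma biregular_same_coords:
  assumes "coords X N e" "coords X' N e" "points X = points X'"
  shows "biregular X X' (\<lambda>x. x)"
proof -
  have "regular_map X X' (\<lambda>x. x)" "regular_map X' X (\<lambda>x. x)"
    using assms by (auto intro!: regular_map_by_coords[where e'=e] coords_imp_precoords
        locrat_poly[OF polys.coord])
  then show ?thesis unfolding biregular_def by (intro conjI exI[of _ "\<lambda>x. x"]) auto
qed

lemma points_induced [simp]: "points (induced X S) = points X \<inter> S"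
  by (simp add: induced_def)

text \<open>
  An induced section is locally the restriction of an ambient one, hence of a quotient of
  polynomials, and so the local quotients are exactly the induced sections.
\<close>
lemma coords_induced:
  assumes X: "precoords X N e" shows "coords (induced X S) N e"
proof -
  have op: "openin (ztop (induced X S)) U \<longleftrightarrow> zopen (points (induced X S)) N e U" for U
  proof
    assume "openin (ztop (induced X S)) U"
    then obtain T where T: "openin (ztop X) T" "U = T \<inter> S" by (auto simp: induced_def openin_subtopology)
    then have "zopen (points X) N e T" using precoordsD(1)[OF X] by blast
    then show "zopen (points (induced X S)) N e U" using T(2) unfolding zopen_def points_induced by blast
  next
    assume U: "zopen (points (induced X S)) N e U"
    define T where "T = \<Union>{{z \<in> points X. p (e z) \<noteq> 0} | p. p \<in> polys N \<and>
          (\<forall>z\<in>points X \<inter> S. p (e z) \<noteq> 0 \<longrightarrow> z \<in> U)}"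
    have "openin (ztop X) T" unfolding T_def
      using zopen_basic precoordsD(1)[OF X] by (intro openin_Union) blast
    moreover have "U = T \<inter> S"
    proof
      show "U \<subseteq> T \<inter> S"
      proof
        fix x assume x: "x \<in> U"
        then have xP: "x \<in> points X" "x \<in> S" using U unfolding zopen_def by auto
        obtain p where "p \<in> polys N" "p (e x) \<noteq> 0" "\<forall>z\<in>points X \<inter> S. p (e z) \<noteq> 0 \<longrightarrow> z \<in> U"
          using U x unfolding zopen_def points_induced by blast
        then show "x \<in> T \<inter> S" using xP unfolding T_def by blast
      qed
      show "T \<inter> S \<subseteq> U" unfolding T_def by blast
    qed
    ultimately show "openin (ztop (induced X S)) U" by (auto simp: induced_def openin_subtopology)
  qed
  have "f \<in> sections (induced X S) U \<longleftrightarrow> f \<in> locrat N e U" if U: "openin (ztop (induced X S)) U" for U f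
  proof
    assume f: "f \<in> sections (induced X S) U"
    show "f \<in> locrat N e U"
    proof (rule locratI)
      fix x assume x: "x \<in> U"
      with f obtain W g where W: "openin (ztop X) W" "x \<in> W" "g \<in> sections X W" "\<forall>z\<in>U \<inter> W. f z = g z"
        unfolding induced_def by auto
      obtain p q where pq: "p \<in> polys N" "q \<in> polys N" "q (e x) \<noteq> 0"
        "\<And>z. z \<in> W \<Longrightarrow> q (e z) \<noteq> 0 \<Longrightarrow> g z = p (e z) / q (e z)"
        by (rule locratE[OF precoordsD(2)[OF X W(1,3)] W(2)], rule that)
      have "zopen (points X) N e W" using W precoordsD(1)[OF X] by auto
      then obtain r where r: "r \<in> polys N" "r (e x) \<noteq> 0" "\<And>z. z \<in> points X \<Longrightarrow> r (e z) \<noteq> 0 \<Longrightarrow> z \<in> W"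
        using W unfolding zopen_def by blast
      have UX: "U \<subseteq> points X" using openin_subset[OF U] by auto
      show "\<exists>p\<in>polys N. \<exists>q\<in>polys N. q (e x) \<noteq> 0 \<and> (\<forall>z\<in>U. q (e z) \<noteq> 0 \<longrightarrow> f z = p (e z) / q (e z))"
      proof (rule bexI[of _ "\<lambda>x. p x * r x"], rule bexI[of _ "\<lambda>x. q x * r x"], intro conjI ballI impI)
        fix z assume z: "z \<in> U" "q (e z) * r (e z) \<noteq> 0"
        then have "z \<in> W" using r(3) UX by auto
        then show "f z = p (e z) * r (e z) / (q (e z) * r (e z))" using z W(4) pq(4) by auto
      qed (use pq r in \<open>auto intro: polys.mult\<close>)
    qed
  next
    assume f: "f \<in> locrat N e U"
    have "\<exists>W g. openin (ztop X) W \<and> x \<in> W \<and> g \<in> sections X W \<and> (\<forall>z\<in>U \<inter> W. f z = g z)" if x: "x \<in> U" for x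
    proof -
      from locratE[OF f x] obtain p q where pq: "p \<in> polys N" "q \<in> polys N" "q (e x) \<noteq> 0"
      "\<And>z. z \<in> U \<Longrightarrow> q (e z) \<noteq> 0 \<Longrightarrow> f z = p (e z) / q (e z)" by blast
      have "x \<in> points X" using openin_subset[OF U] x by auto
      then show ?thesis
        using pq precoordsD(3)[OF X pq(1,2)] precoordsD(1)[OF X] zopen_basic[OF pq(2)]
        by (intro exI[of _ "{z \<in> points X. q (e z) \<noteq> 0}"] exI[of _ "\<lambda>z. p (e z) / q (e z)"]) auto
    qed
    then show "f \<in> sections (induced X S) U" unfolding induced_def by simp
  qed
  with op show ?thesis unfolding coords_def by blast
qed

lemma Union_affine_basis: "\<Union>{{x \<in> Rn n. p x \<noteq> 0} |p. p \<in> polys n} = Rn n"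
proof -
  have "Rn n \<in> {{x \<in> Rn n. p x \<noteq> 0} |p. p \<in> polys n}"
    by (intro CollectI exI[of _ "\<lambda>_. 1"]) (auto intro: polys.const)
  then show ?thesis by blast
qed

lemma points_affine [simp]: "points (affine_space n) = Rn n"
  by (simp add: affine_space_def topology_generated_by_topspace Union_affine_basis)

lemma precoords_affine: "precoords (affine_space n) n (\<lambda>x. x)"
proof -
  have "openin (ztop (affine_space n)) U \<longleftrightarrow> zopen (Rn n) n (\<lambda>x. x) U" for U
    unfolding affine_space_def rspace.select_convs
  proof (rule openin_generated_iff_zopen[OF Union_affine_basis])
  qed (auto intro: zopen_basic topology_generated_by_Basis)
  moreover have "f \<in> locrat n (\<lambda>x. x) U" if "f \<in> sections (affine_space n) U" for U f
    using that unfolding affine_space_def locrat_def by auto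
  moreover have "(\<lambda>z. p z / q z) \<in> sections (affine_space n) {z \<in> Rn n. q z \<noteq> 0}"
    if "p \<in> polys n" "q \<in> polys n" for p q
    using that unfolding affine_space_def by auto
  ultimately show ?thesis unfolding precoords_def by auto
qed

section \<open>Products\<close>

definition prodc :: "nat \<Rightarrow> ('a \<Rightarrow> nat \<Rightarrow> real) \<Rightarrow> ('b \<Rightarrow> nat \<Rightarrow> real) \<Rightarrow> 'a \<times> 'b \<Rightarrow> nat \<Rightarrow> real" where
  "prodc N e e' = (\<lambda>q. catv N (e (fst q)) (e' (snd q)))"

lemma locrat_prodc_fst:
  assumes "f \<in> locrat N e U" "fst ` W \<subseteq> U"
  shows "(\<lambda>q. f (fst q)) \<in> locrat (N + M) (prodc N e e') W"
proof (rule locrat_comp[OF assms(1) _ assms(2)])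
  fix i assume "i < N"
  then show "(\<lambda>x. e (fst x) i) \<in> locrat (N + M) (prodc N e e') W"
    using locrat_poly[OF polys.coord[of i "N + M"], of "prodc N e e'" W] by (simp add: prodc_def)
qed

lemma locrat_prodc_snd:
  assumes "f \<in> locrat M e' U" "snd ` W \<subseteq> U"
  shows "(\<lambda>q. f (snd q)) \<in> locrat (N + M) (prodc N e e') W"
proof (rule locrat_comp[OF assms(1) _ assms(2)])
  fix i assume "i < M"
  then show "(\<lambda>x. e' (snd x) i) \<in> locrat (N + M) (prodc N e e') W"
    using locrat_poly[OF polys.coord[of "N + i" "N + M"], of "prodc N e e'" W] by (simp add: prodc_def)
qed

lemma zopen_Times:
  assumes "zopen P N e U" "zopen P' M e' V"
  shows "zopen (P \<times> P') (N + M) (prodc N e e') (U \<times> V)"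
  unfolding zopen_def
proof (intro conjI ballI)
  fix x assume "x \<in> U \<times> V"
  then have x: "fst x \<in> U" "snd x \<in> V" by auto
  obtain p where p: "p \<in> polys N" "p (e (fst x)) \<noteq> 0" "\<forall>z\<in>P. p (e z) \<noteq> 0 \<longrightarrow> z \<in> U"
    using assms(1) x unfolding zopen_def by blast
  obtain q where q: "q \<in> polys M" "q (e' (snd x)) \<noteq> 0" "\<forall>z\<in>P'. q (e' z) \<noteq> 0 \<longrightarrow> z \<in> V"
    using assms(2) x unfolding zopen_def by blast
  show "\<exists>p\<in>polys (N + M). p (prodc N e e' x) \<noteq> 0 \<and> (\<forall>z\<in>P \<times> P'. p (prodc N e e' z) \<noteq> 0 \<longrightarrow> z \<in> U \<times> V)"
    by (rule bexI[of _ "\<lambda>x. p x * q (\<lambda>i. x (N + i))"])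
       (use p q in \<open>auto simp: prodc_def polys_catv_left intro!: polys.mult polys_shift intro: polys_mono\<close>)
qed (use assms in \<open>auto simp: zopen_def\<close>)

lemma tensors_locrat:
  assumes X: "precoords X N e" and Z: "precoords Z M e'"
    and "h \<in> tensors X Z U V" "openin (ztop X) U" "openin (ztop Z) V"
  shows "h \<in> locrat (N + M) (prodc N e e') (U \<times> V)"
proof -
  from assms(3) obtain m a b where h: "h = (\<lambda>(x, z). \<Sum>i<m. a i x * b i z)"
    and ab: "\<And>i. i < (m::nat) \<Longrightarrow> a i \<in> sections X U" "\<And>i. i < m \<Longrightarrow> b i \<in> sections Z V"
    unfolding tensors_def by blast
  have "(\<lambda>q. \<Sum>i<m. a i (fst q) * b i (snd q)) \<in> locrat (N + M) (prodc N e e') (U \<times> V)"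
    by (intro locrat_sum locrat_mult locrat_prodc_fst[where U=U] locrat_prodc_snd[where U=V]
        precoordsD(2)[OF X] precoordsD(2)[OF Z]) (use assms ab in auto)
  then show ?thesis by (simp add: h case_prod_unfold)
qed

lemma poly_tensor:
  assumes X: "precoords X N e" and Z: "precoords Z M e'" and "p \<in> polys (N + M)"
  shows "(\<lambda>q. p (prodc N e e' q)) \<in> tensors X Z (points X) (points Z)"
proof -
  obtain m A B where AB: "\<forall>i<(m::nat). A i \<in> polys N \<and> B i \<in> polys M"
      "\<forall>a v. p (catv N a v) = (\<Sum>i<m. A i a * B i v)"
    using polys_catv_separate[OF assms(3)] by blast
  have "(\<lambda>q. p (prodc N e e' q)) = (\<lambda>(x, z). \<Sum>i<m. A i (e x) * B i (e' z))"
    by (auto simp: prodc_def AB(2))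
  moreover have "\<forall>i<m. (\<lambda>x. A i (e x)) \<in> sections X (points X) \<and> (\<lambda>z. B i (e' z)) \<in> sections Z (points Z)"
    using AB(1) precoords_poly_section[OF X] precoords_poly_section[OF Z] by blast
  ultimately show ?thesis unfolding tensors_def
    by (intro CollectI exI[of _ m] exI[of _ "\<lambda>i x. A i (e x)"] exI[of _ "\<lambda>i z. B i (e' z)"]) auto
qed

text \<open>
  A tensor is locally a quotient of polynomials in both groups of coordinates, and conversely a
  polynomial in both groups is a tensor by \<open>polys_catv_separate\<close>.
\<close>
lemma coords_product:
  assumes X: "precoords X N e" and Z: "precoords Z M e'"
  shows "points (product X Z) = points X \<times> points Z"
    and "coords (product X Z) (N + M) (prodc N e e')"
proof -
  let ?E = "prodc N e e'" and ?P = "points X \<times> points Z"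
  let ?B = "{{q \<in> U \<times> V. h q \<noteq> 0} | U V h.
            openin (ztop X) U \<and> openin (ztop Z) V \<and> h \<in> tensors X Z U V}"
  have Bp: "{q \<in> ?P. p (?E q) \<noteq> 0} \<in> ?B" if "p \<in> polys (N + M)" for p
    using poly_tensor[OF X Z that]
    by (intro CollectI exI[of _ "points X"] exI[of _ "points Z"] exI[of _ "\<lambda>q. p (?E q)"]) simp
  have top: "\<Union>?B = ?P"
  proof
    show "\<Union>?B \<subseteq> ?P" by (auto dest!: openin_subset)
    have "?P \<in> ?B" using Bp[OF polys.const[of 1]] by simp
    then show "?P \<subseteq> \<Union>?B" by (rule Union_upper)
  qed
  have zt: "ztop (product X Z) = topology_generated_by ?B" by (simp add: product_def)
  show pts: "points (product X Z) = ?P" unfolding zt topology_generated_by_topspace by (rule top)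
  have zUV: "zopen ?P (N + M) ?E (U \<times> V)" if "openin (ztop X) U" "openin (ztop Z) V" for U V
    using zopen_Times that precoordsD(1)[OF X] precoordsD(1)[OF Z] by blast
  have op: "openin (ztop (product X Z)) U \<longleftrightarrow> zopen ?P (N + M) ?E U" for U
    unfolding zt
  proof (rule openin_generated_iff_zopen[OF top])
    fix W assume "W \<in> ?B"
    then obtain U V h where W: "W = {q \<in> U \<times> V. h q \<noteq> 0}" "openin (ztop X) U" "openin (ztop Z) V"
      "h \<in> tensors X Z U V" by auto
    have h: "h \<in> locrat (N + M) ?E (U \<times> V)" by (rule tensors_locrat[OF X Z W(4,2,3)])
    show "zopen ?P (N + M) ?E W"
      unfolding zopen_def
    proof (intro conjI ballI)
      fix x assume "x \<in> W"
      then have x: "x \<in> U \<times> V" "h x \<noteq> 0" using W(1) by auto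
      obtain p where p: "p \<in> polys (N + M)" "p (?E x) \<noteq> 0"
        "\<And>z. z \<in> U \<times> V \<Longrightarrow> p (?E z) \<noteq> 0 \<Longrightarrow> h z \<noteq> 0"
        by (rule locrat_nonzero_near[OF h x], rule that)
      obtain q where q: "q \<in> polys (N + M)" "q (?E x) \<noteq> 0" "\<And>z. z \<in> ?P \<Longrightarrow> q (?E z) \<noteq> 0 \<Longrightarrow> z \<in> U \<times> V"
        by (rule zopenE[OF zUV[OF W(2,3)] x(1)], rule that)
      show "\<exists>p\<in>polys (N + M). p (?E x) \<noteq> 0 \<and> (\<forall>z\<in>?P. p (?E z) \<noteq> 0 \<longrightarrow> z \<in> W)"
        by (rule bexI[of _ "\<lambda>x. p x * q x"]) (use p q W(1) in \<open>auto intro: polys.mult\<close>)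
    qed (use W openin_subset[OF W(2)] openin_subset[OF W(3)] in auto)
  next
    fix p assume "p \<in> polys (N + M)"
    then show "openin (topology_generated_by ?B) {z \<in> ?P. p (?E z) \<noteq> 0}"
      using Bp by (intro topology_generated_by_Basis) blast
  qed
  have sec: "f \<in> sections (product X Z) G \<longleftrightarrow> f \<in> locrat (N + M) ?E G" if G: "openin (ztop (product X Z)) G" for G f
  proof
    assume f: "f \<in> sections (product X Z) G"
    show "f \<in> locrat (N + M) ?E G"
    proof (rule locratI)
      fix x assume x: "x \<in> G"
      have "\<forall>q\<in>G. \<exists>U V g h. openin (ztop X) U \<and> openin (ztop Z) V \<and> q \<in> U \<times> V \<and>
            g \<in> tensors X Z U V \<and> h \<in> tensors X Z U V \<and> h q \<noteq> 0 \<and>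
            (\<forall>q'\<in>G \<inter> (U \<times> V). h q' \<noteq> 0 \<longrightarrow> f q' = g q' / h q')"
        using f unfolding product_def by simp
      from this[rule_format, OF x] obtain U V g h where W: "openin (ztop X) U" "openin (ztop Z) V" "x \<in> U \<times> V"
          "g \<in> tensors X Z U V" "h \<in> tensors X Z U V" "h x \<noteq> 0"
          "\<And>q'. q' \<in> G \<inter> (U \<times> V) \<Longrightarrow> h q' \<noteq> 0 \<Longrightarrow> f q' = g q' / h q'"
        by (elim exE conjE) (rule that, assumption+, drule (1) bspec, erule (1) mp)
      define W where "W = {z \<in> U \<times> V. h z \<noteq> 0}"
      have gh: "(\<lambda>z. g z / h z) \<in> locrat (N + M) ?E W"
        by (rule locrat_divide) (auto simp: W_def intro: locrat_subset[OF tensors_locrat[OF X Z W(4,1,2)]]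
            locrat_subset[OF tensors_locrat[OF X Z W(5,1,2)]])
      have xW: "x \<in> W" using W by (simp add: W_def)
      obtain p q where pq: "p \<in> polys (N + M)" "q \<in> polys (N + M)" "q (?E x) \<noteq> 0"
        "\<And>z. z \<in> W \<Longrightarrow> q (?E z) \<noteq> 0 \<Longrightarrow> g z / h z = p (?E z) / q (?E z)"
        by (rule locratE[OF gh xW], rule that)
      have "W \<in> ?B" using W(1,2,5) unfolding W_def by auto
      then have "openin (ztop (product X Z)) W" unfolding zt by (rule topology_generated_by_Basis)
      then have "zopen ?P (N + M) ?E W" unfolding op .
      then obtain r where r: "r \<in> polys (N + M)" "r (?E x) \<noteq> 0" "\<And>z. z \<in> ?P \<Longrightarrow> r (?E z) \<noteq> 0 \<Longrightarrow> z \<in> W"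
        using xW by (rule zopenE) (rule that)
      have OP: "G \<subseteq> ?P" using openin_subset[OF G] pts by simp
      show "\<exists>p\<in>polys (N + M). \<exists>q\<in>polys (N + M). q (?E x) \<noteq> 0 \<and> (\<forall>z\<in>G. q (?E z) \<noteq> 0 \<longrightarrow> f z = p (?E z) / q (?E z))"
      proof (rule bexI[of _ "\<lambda>x. p x * r x"], rule bexI[of _ "\<lambda>x. q x * r x"], intro conjI ballI impI)
        fix z assume z: "z \<in> G" "q (?E z) * r (?E z) \<noteq> 0"
        then have "z \<in> W" using r(3)[of z] OP by auto
        then show "f z = p (?E z) * r (?E z) / (q (?E z) * r (?E z))"
          using z W(7)[of z] pq(4)[of z] by (auto simp: W_def)
      qed (use pq r in \<open>auto intro: polys.mult\<close>)
    qed
  next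
    assume f: "f \<in> locrat (N + M) ?E G"
    have "\<exists>U V g h. openin (ztop X) U \<and> openin (ztop Z) V \<and> x \<in> U \<times> V \<and>
            g \<in> tensors X Z U V \<and> h \<in> tensors X Z U V \<and> h x \<noteq> 0 \<and>
            (\<forall>q'\<in>G \<inter> (U \<times> V). h q' \<noteq> 0 \<longrightarrow> f q' = g q' / h q')" if x: "x \<in> G" for x
    proof -
      obtain p q where pq: "p \<in> polys (N + M)" "q \<in> polys (N + M)" "q (?E x) \<noteq> 0"
      "\<And>z. z \<in> G \<Longrightarrow> q (?E z) \<noteq> 0 \<Longrightarrow> f z = p (?E z) / q (?E z)" by (rule locratE[OF f x], rule that)
      have "x \<in> ?P" using openin_subset[OF G] x pts by auto
      then show ?thesis
        using pq poly_tensor[OF X Z pq(1)] poly_tensor[OF X Z pq(2)]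
        by (intro exI[of _ "points X"] exI[of _ "points Z"] exI[of _ "\<lambda>q. p (?E q)"]
            exI[of _ "\<lambda>z. q (?E z)"]) auto
    qed
    then show "f \<in> sections (product X Z) G" unfolding product_def by simp
  qed
  show "coords (product X Z) (N + M) ?E" unfolding coords_def using op sec pts by auto
qed

lemma ringed_space_cong:
  assumes "ringed_space Y" "openin (ztop Y) U" "f \<in> sections Y U" "\<forall>x\<in>U. g x = f x"
  shows "g \<in> sections Y U"
proof -
  have "\<forall>U f g. openin (ztop Y) U \<and> f \<in> sections Y U \<and> (\<forall>x\<in>U. g x = f x) \<longrightarrow> g \<in> sections Y U"
    using assms(1) unfolding ringed_space_def by (rule conjunct1)
  from this[rule_format, of U f g] show ?thesis using assms(2-4) by blast
qed

text \<open>
  Coordinates can be pulled back along an isomorphism.  That \<open>Y\<close> is a ringed space enters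
  through \<open>ringed_space_cong\<close>: composing a section with an isomorphism and its inverse changes
  it outside its domain.
\<close>
lemma coords_biregular:
  assumes Y: "ringed_space Y" and f: "biregular Y X f" and X: "coords X N e"
  shows "coords Y N (\<lambda>y. e (f y))"
proof -
  from f obtain g where fr: "regular_map Y X f" and g: "regular_map X Y g"
    "\<And>x. x \<in> points Y \<Longrightarrow> g (f x) = x" "\<And>y. y \<in> points X \<Longrightarrow> f (g y) = y"
    unfolding biregular_def by blast
  have fP: "f y \<in> points X" if "y \<in> points Y" for y
    using fr that unfolding regular_map_def continuous_map_def by auto
  have gP: "g y \<in> points Y" if "y \<in> points X" for y
    using g that unfolding regular_map_def continuous_map_def by auto
  have opf: "openin (ztop Y) {y \<in> points Y. f y \<in> V}" if "openin (ztop X) V" for V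
    using fr that unfolding regular_map_def continuous_map_def by auto
  have opg: "openin (ztop X) {y \<in> points X. g y \<in> V}" if "openin (ztop Y) V" for V
    using g that unfolding regular_map_def continuous_map_def by auto
  have fg: "{y \<in> points Y. f y \<in> {x \<in> points X. g x \<in> V}} = V" if "V \<subseteq> points Y" for V
    using that g(2) fP by auto
  have z: "zopen (points Y) N (\<lambda>y. e (f y)) U \<longleftrightarrow> zopen (points X) N e {x \<in> points X. g x \<in> U}"
    if U: "U \<subseteq> points Y" for U
  proof
    assume L: "zopen (points Y) N (\<lambda>y. e (f y)) U"
    show "zopen (points X) N e {x \<in> points X. g x \<in> U}" unfolding zopen_def
    proof (intro conjI ballI)
      fix x assume x: "x \<in> {x \<in> points X. g x \<in> U}"
      then obtain p where "p \<in> polys N" "p (e (f (g x))) \<noteq> 0" "\<forall>z\<in>points Y. p (e (f z)) \<noteq> 0 \<longrightarrow> z \<in> U"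
        using L unfolding zopen_def by blast
      then show "\<exists>p\<in>polys N. p (e x) \<noteq> 0 \<and> (\<forall>z\<in>points X. p (e z) \<noteq> 0 \<longrightarrow> z \<in> {x \<in> points X. g x \<in> U})"
        using x g(3) gP by (intro bexI[of _ p]) auto
    qed auto
  next
    assume R: "zopen (points X) N e {x \<in> points X. g x \<in> U}"
    show "zopen (points Y) N (\<lambda>y. e (f y)) U" unfolding zopen_def
    proof (intro conjI ballI)
      fix y assume y: "y \<in> U"
      then have "f y \<in> {x \<in> points X. g x \<in> U}" using U fP g(2) by auto
      then obtain p where "p \<in> polys N" "p (e (f y)) \<noteq> 0" "\<forall>z\<in>points X. p (e z) \<noteq> 0 \<longrightarrow> z \<in> {x \<in> points X. g x \<in> U}"
        using R unfolding zopen_def by blast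
      then show "\<exists>p\<in>polys N. p (e (f y)) \<noteq> 0 \<and> (\<forall>z\<in>points Y. p (e (f z)) \<noteq> 0 \<longrightarrow> z \<in> U)"
        using g(2) fP by (intro bexI[of _ p]) fastforce+
    qed (use U in auto)
  qed
  have op: "openin (ztop Y) U \<longleftrightarrow> zopen (points Y) N (\<lambda>y. e (f y)) U" for U
  proof
    assume U: "openin (ztop Y) U"
    then show "zopen (points Y) N (\<lambda>y. e (f y)) U"
      using z[OF openin_subset[OF U]] opg[OF U] coordsD(1)[OF X] by blast
  next
    assume U: "zopen (points Y) N (\<lambda>y. e (f y)) U"
    then have U': "U \<subseteq> points Y" by (simp add: zopen_def)
    from z[OF U'] U have "openin (ztop X) {x \<in> points X. g x \<in> U}" using coordsD(1)[OF X] by blast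
    from opf[OF this] show "openin (ztop Y) U" using fg[OF U'] by simp
  qed
  have sec: "h \<in> sections Y V \<longleftrightarrow> h \<in> locrat N (\<lambda>y. e (f y)) V" if V: "openin (ztop Y) V" for V h
  proof
    assume "h \<in> sections Y V"
    then have "h \<circ> g \<in> sections X {x \<in> points X. g x \<in> V}" using g(1) V unfolding regular_map_def by blast
    then have "h \<circ> g \<in> locrat N e {x \<in> points X. g x \<in> V}" using coordsD(2)[OF X opg[OF V]] by blast
    then have "(\<lambda>y. (h \<circ> g) (f y)) \<in> locrat N (\<lambda>y. e (f y)) V"
      by (rule locrat_comp) (use openin_subset[OF V] fP g(2) in \<open>auto intro: locrat_coord\<close>)
    then show "h \<in> locrat N (\<lambda>y. e (f y)) V"
      by (rule locrat_cong) (use openin_subset[OF V] g(2) in auto)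
  next
    assume "h \<in> locrat N (\<lambda>y. e (f y)) V"
    then have "(\<lambda>x. h (g x)) \<in> locrat N e {x \<in> points X. g x \<in> V}"
      by (rule locrat_comp)
         (auto simp: g(3) intro!: locrat_cong[OF locrat_coord[where e=e]])
    then have "h \<circ> g \<in> sections X {x \<in> points X. g x \<in> V}" using coordsD(2)[OF X opg[OF V]] by (simp add: o_def)
    then have "(h \<circ> g) \<circ> f \<in> sections Y {y \<in> points Y. f y \<in> {x \<in> points X. g x \<in> V}}"
      using fr opg[OF V] unfolding regular_map_def by blast
    then have "(h \<circ> g) \<circ> f \<in> sections Y V" using fg[OF openin_subset[OF V]] by simp
    moreover have "\<forall>y\<in>V. h y = ((h \<circ> g) \<circ> f) y" using g(2) openin_subset[OF V] by auto
    ultimately show "h \<in> sections Y V" by (rule ringed_space_cong[OF Y V])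
  qed
  from op sec show ?thesis unfolding coords_def by blast
qed

section \<open>Projective space has global coordinates\<close>

definition nrm2 :: "nat \<Rightarrow> (nat \<Rightarrow> real) \<Rightarrow> real" where
  "nrm2 m x = (\<Sum>i<m. x i * x i)"

text \<open>
  The matrix \<open>x x\<^sup>T / |x|\<^sup>2\<close>, stored row by row, of the orthogonal projection onto the line of \<open>x\<close>;
  it depends on that line only.
\<close>
definition veronese :: "nat \<Rightarrow> (nat \<Rightarrow> real) \<Rightarrow> nat \<Rightarrow> real" where
  "veronese m x = (\<lambda>i. x (i div m) * x (i mod m) / nrm2 m x)"

definition proj_coord :: "nat \<Rightarrow> (nat \<Rightarrow> real) set \<Rightarrow> nat \<Rightarrow> real" where
  "proj_coord m L = veronese m (SOME x. x \<in> L)"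

lemma homogeneous_mult:
  "p \<in> homogeneous n d \<Longrightarrow> q \<in> homogeneous n d' \<Longrightarrow> (\<lambda>x. p x * q x) \<in> homogeneous n (d + d')"
  unfolding homogeneous_def by (auto intro: polys.mult simp: power_add algebra_simps)

lemma homogeneous_add:
  "p \<in> homogeneous n d \<Longrightarrow> q \<in> homogeneous n d \<Longrightarrow> (\<lambda>x. p x + q x) \<in> homogeneous n d"
  unfolding homogeneous_def by (auto intro: polys.add simp: algebra_simps)

lemma homogeneous_const: "(\<lambda>x. c) \<in> homogeneous n 0"
  unfolding homogeneous_def by (auto intro: polys.const)

lemma homogeneous_nrm2: "(\<lambda>x. nrm2 m x ^ k) \<in> homogeneous m (2 * k)"
proof (induction k)
  case 0
  show ?case using homogeneous_const[of 1] by simp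
next
  case (Suc k)
  have "nrm2 m \<in> homogeneous m 2"
    unfolding homogeneous_def nrm2_def
    by (auto intro!: polys_sum polys.intros simp: sum_distrib_left power2_eq_square algebra_simps)
  from homogeneous_mult[OF this Suc] show ?case by simp
qed

lemma nrm2_scale: "nrm2 m (\<lambda>i. c * x i) = c\<^sup>2 * nrm2 m x"
  by (simp add: nrm2_def sum_distrib_left power2_eq_square algebra_simps)

lemma proj_point_rep:
  assumes "L \<in> proj_points n" "x \<in> L"
  shows "nrm2 (Suc n) x > 0" "\<exists>k<Suc n. x k \<noteq> 0" "\<And>y. y \<in> L \<Longrightarrow> \<exists>c. c \<noteq> 0 \<and> y = (\<lambda>i. c * x i)"
proof -
  obtain w where w: "w \<in> Rn (Suc n)" "w \<noteq> (\<lambda>i. 0)" "L = {(\<lambda>i. c * w i) | c. c \<noteq> 0}"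
    using assms(1) unfolding proj_points_def by blast
  obtain c where c: "c \<noteq> 0" "x = (\<lambda>i. c * w i)" using w assms(2) by blast
  obtain k where "w k \<noteq> 0" using w(2) by auto
  then have k: "x k \<noteq> 0" "k < Suc n" using w(1) c by (auto simp: Rn_def) (meson not_less_eq_eq not_less)
  then show "\<exists>k<Suc n. x k \<noteq> 0" by blast
  show "nrm2 (Suc n) x > 0" unfolding nrm2_def
    by (rule sum_pos2[of _ k]) (use k in \<open>auto simp: zero_less_mult_iff\<close>)
  show "\<exists>c. c \<noteq> 0 \<and> y = (\<lambda>i. c * x i)" if y: "y \<in> L" for y
  proof -
    obtain c' where "c' \<noteq> 0" "y = (\<lambda>i. c' * w i)" using w y by blast
    then show ?thesis using c by (intro exI[of _ "c' / c"]) auto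
  qed
qed

lemma proj_point_nonempty: "L \<in> proj_points n \<Longrightarrow> \<exists>x. x \<in> L"
  unfolding proj_points_def by (auto intro!: exI[of _ 1])

lemma proj_coord_eq:
  assumes "L \<in> proj_points n" "x \<in> L"
  shows "proj_coord (Suc n) L = veronese (Suc n) x"
proof -
  have "(SOME x. x \<in> L) \<in> L" by (rule someI[of "\<lambda>x. x \<in> L", OF assms(2)])
  from proj_point_rep(3)[OF assms this] obtain c where c: "c \<noteq> 0" "(SOME x. x \<in> L) = (\<lambda>i. c * x i)" by blast
  then show ?thesis
    unfolding proj_coord_def c(2) by (auto simp: veronese_def nrm2_scale power2_eq_square)
qed

lemma homogeneous_nonzero_iff:
  assumes "L \<in> proj_points n" "x \<in> L" "p \<in> homogeneous m d"
  shows "(\<forall>y\<in>L. p y \<noteq> 0) \<longleftrightarrow> p x \<noteq> 0"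
proof -
  have "p y \<noteq> 0" if "y \<in> L" "p x \<noteq> 0" for y
  proof -
    obtain c where "c \<noteq> 0" "y = (\<lambda>i. c * x i)" using proj_point_rep(3)[OF assms(1,2) \<open>y \<in> L\<close>] by blast
    then show ?thesis using assms(3) that by (simp add: homogeneous_def)
  qed
  then show ?thesis using assms(2) by blast
qed

text \<open>
  The \<open>k\<close>-th column of the matrix \<open>x x\<^sup>T / |x|\<^sup>2\<close> is a multiple of \<open>x\<close>, so a homogeneous polynomial
  of \<open>x\<close> can be read off from it up to a power of \<open>x\<^sub>k / |x|\<^sup>2\<close>.
\<close>

lemma homogeneous_on_column:
  assumes "p \<in> homogeneous m d" "k < m"
  shows "(\<lambda>v. p (\<lambda>j. v (k * m + j))) \<in> polys (m * m)"
    and "p (\<lambda>j. veronese m x (k * m + j)) = (x k / nrm2 m x) ^ d * p x"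
proof -
  have idx: "k * m + j < m * m" if "j < m" for j
  proof -
    have "k * m + j < Suc k * m" using that by simp
    also have "\<dots> \<le> m * m" using assms(2) by (intro mult_le_mono1) simp
    finally show ?thesis .
  qed
  have p: "p \<in> polys m" "\<And>c x. p (\<lambda>i. c * x i) = c ^ d * p x" using assms(1) by (auto simp: homogeneous_def)
  show "(\<lambda>v. p (\<lambda>j. v (k * m + j))) \<in> polys (m * m)"
    by (rule polys_subst[OF p(1)]) (auto intro: polys.coord idx)
  have "p (\<lambda>j. veronese m x (k * m + j)) = p (\<lambda>j. (x k / nrm2 m x) * x j)"
    by (rule polys_cong[OF p(1)]) (auto simp: veronese_def)
  then show "p (\<lambda>j. veronese m x (k * m + j)) = (x k / nrm2 m x) ^ d * p x" unfolding p(2) .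
qed

text \<open>
  Conversely, a polynomial in the entries of \<open>x x\<^sup>T / |x|\<^sup>2\<close> becomes homogeneous in \<open>x\<close> when it is
  multiplied by a power of \<open>|x|\<^sup>2\<close>.  The degree is even, so two such polynomials can be brought
  to the same degree by further powers.
\<close>
lemma poly_of_veronese_homogeneous:
  assumes "P \<in> polys (m * m)"
  shows "\<exists>h. \<exists>p\<in>homogeneous m (2 * h). \<forall>x. nrm2 m x \<noteq> 0 \<longrightarrow> p x = nrm2 m x ^ h * P (veronese m x)"
  using assms
proof (induction rule: polys.induct)
  case (const c)
  show ?case by (intro exI[of _ 0] bexI[of _ "\<lambda>x. c"]) (auto intro: homogeneous_const)
next
  case (coord i)
  then have "m > 0" by (cases m) auto
  with coord have "i div m < m" "i mod m < m" by (auto simp: less_mult_imp_div_less)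
  then have "(\<lambda>x. x (i div m) * x (i mod m)) \<in> homogeneous m (2 * 1)"
    unfolding homogeneous_def by (auto intro!: polys.intros simp: power2_eq_square)
  then show ?case by (intro exI[of _ 1] bexI) (auto simp: veronese_def)
next
  case (add P Q)
  then obtain h p h' q where 1: "p \<in> homogeneous m (2 * h)" "q \<in> homogeneous m (2 * h')"
    "\<forall>x. nrm2 m x \<noteq> 0 \<longrightarrow> p x = nrm2 m x ^ h * P (veronese m x)"
    "\<forall>x. nrm2 m x \<noteq> 0 \<longrightarrow> q x = nrm2 m x ^ h' * Q (veronese m x)" by blast
  have "(\<lambda>x. p x * nrm2 m x ^ h') \<in> homogeneous m (2 * (h + h'))"
    "(\<lambda>x. q x * nrm2 m x ^ h) \<in> homogeneous m (2 * (h + h'))"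
    using homogeneous_mult[OF 1(1) homogeneous_nrm2[of m h']] homogeneous_mult[OF 1(2) homogeneous_nrm2[of m h]]
    by (simp_all add: algebra_simps)
  from homogeneous_add[OF this] show ?case
    by (intro exI[of _ "h + h'"] bexI) (auto simp: 1 power_add algebra_simps)
next
  case (mult P Q)
  then obtain h p h' q where 1: "p \<in> homogeneous m (2 * h)" "q \<in> homogeneous m (2 * h')"
    "\<forall>x. nrm2 m x \<noteq> 0 \<longrightarrow> p x = nrm2 m x ^ h * P (veronese m x)"
    "\<forall>x. nrm2 m x \<noteq> 0 \<longrightarrow> q x = nrm2 m x ^ h' * Q (veronese m x)" by blast
  have "(\<lambda>x. p x * q x) \<in> homogeneous m (2 * (h + h'))"
    using homogeneous_mult[OF 1(1,2)] by (simp add: algebra_simps)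
  then show ?case
    by (intro exI[of _ "h + h'"] bexI) (auto simp: 1 power_add algebra_simps)
qed

lemma proj_coord_column:
  assumes "p \<in> homogeneous (Suc n) d" "k < Suc n" "L \<in> proj_points n" "x \<in> L"
  shows "p (\<lambda>j. proj_coord (Suc n) L (k * Suc n + j)) = (x k / nrm2 (Suc n) x) ^ d * p x"
    and "proj_coord (Suc n) L (k * Suc n + k) \<noteq> 0 \<longleftrightarrow> x k \<noteq> 0"
proof -
  show "p (\<lambda>j. proj_coord (Suc n) L (k * Suc n + j)) = (x k / nrm2 (Suc n) x) ^ d * p x"
    unfolding proj_coord_eq[OF assms(3,4)] by (rule homogeneous_on_column(2)[OF assms(1,2)])
  have "(k * Suc n + k) div Suc n = k" "(k * Suc n + k) mod Suc n = k"
    using assms(2) div_mult_self3[of "Suc n" k k] by (simp_all del: mult_Suc_right mult_Suc)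
  then show "proj_coord (Suc n) L (k * Suc n + k) \<noteq> 0 \<longleftrightarrow> x k \<noteq> 0"
    unfolding proj_coord_eq[OF assms(3,4)] veronese_def using proj_point_rep(1)[OF assms(3,4)] by simp
qed

lemma diagonal_coord_poly: "k < m \<Longrightarrow> (\<lambda>v. v (k * m + k)) \<in> polys (m * m)"
  using homogeneous_on_column(1)[of "\<lambda>x. x k" m 1 k]
  by (simp add: homogeneous_def polys.coord)

text \<open>
  Homogeneous polynomials and polynomials in the matrix entries have the same nonvanishing sets
  and the same quotients.  Near a line with \<open>x\<^sub>k \<noteq> 0\<close> the translation uses the \<open>k\<close>-th column; the
  factor given by the \<open>k\<close>-th diagonal entry restricts to these lines.
\<close>
lemma precoords_projective:
  "precoords (projective_space n) (Suc n * Suc n) (proj_coord (Suc n))"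
proof -
  let ?m = "Suc n" and ?e = "proj_coord (Suc n)" and ?P = "proj_points n"
  let ?B = "{{L \<in> ?P. \<forall>x\<in>L. p x \<noteq> 0} | p d. p \<in> homogeneous ?m d}"
  have top: "\<Union>?B = ?P"
  proof -
    have "?P \<in> ?B" by (intro CollectI exI[of _ "\<lambda>_. 1"] exI[of _ 0]) (auto intro: homogeneous_const)
    then show ?thesis by blast
  qed
  have zt: "ztop (projective_space n) = topology_generated_by ?B" by (simp add: projective_space_def)
  have pts: "points (projective_space n) = ?P" unfolding zt topology_generated_by_topspace by (rule top)
  have op: "openin (ztop (projective_space n)) U \<longleftrightarrow> zopen ?P (?m * ?m) ?e U" for U
    unfolding zt
  proof (rule openin_generated_iff_zopen[OF top])
    fix W assume "W \<in> ?B"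
    then obtain p d where W: "W = {L \<in> ?P. \<forall>x\<in>L. p x \<noteq> 0}" and p: "p \<in> homogeneous ?m d" by auto
    show "zopen ?P (?m * ?m) ?e W" unfolding zopen_def
    proof (intro conjI ballI)
      fix L assume L: "L \<in> W"
      then have LP: "L \<in> ?P" using W by auto
      then obtain x where x: "x \<in> L" using proj_point_nonempty by blast
      obtain k where k: "k < ?m" "x k \<noteq> 0" using proj_point_rep(2)[OF LP x] by blast
      let ?q = "\<lambda>v. p (\<lambda>j. v (k * ?m + j)) * v (k * ?m + k)"
      have "?q \<in> polys (?m * ?m)"
        by (intro polys.mult homogeneous_on_column(1)[OF p k(1)] diagonal_coord_poly k(1))
      moreover have "?q (?e L) \<noteq> 0"
        unfolding mult_eq_0_iff proj_coord_column(1)[OF p k(1) LP x]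
        using proj_coord_column(2)[OF p k(1) LP x] k(2) x L W proj_point_rep(1)[OF LP x] by simp
      moreover have "M \<in> W" if M: "M \<in> ?P" "?q (?e M) \<noteq> 0" for M
      proof -
        obtain y where y: "y \<in> M" using proj_point_nonempty M by blast
        have "p y \<noteq> 0" using M(2) unfolding mult_eq_0_iff proj_coord_column(1)[OF p k(1) M(1) y] by auto
        then show ?thesis using homogeneous_nonzero_iff[OF M(1) y p] M W by blast
      qed
      ultimately show "\<exists>p\<in>polys (?m * ?m). p (?e L) \<noteq> 0 \<and> (\<forall>M\<in>?P. p (?e M) \<noteq> 0 \<longrightarrow> M \<in> W)"
        by (intro bexI[of _ ?q] conjI ballI impI)
    qed (use W in auto)
  next
    fix P assume "P \<in> polys (?m * ?m)"
    from poly_of_veronese_homogeneous[OF this] obtain h p where p: "p \<in> homogeneous ?m (2 * h)"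
      "\<And>x. nrm2 ?m x \<noteq> 0 \<Longrightarrow> p x = nrm2 ?m x ^ h * P (veronese ?m x)" by blast
    have "P (?e L) \<noteq> 0 \<longleftrightarrow> (\<forall>x\<in>L. p x \<noteq> 0)" if L: "L \<in> ?P" for L
    proof -
      obtain x where x: "x \<in> L" using proj_point_nonempty L by blast
      then show ?thesis using homogeneous_nonzero_iff[OF L x p(1)] proj_coord_eq[OF L x] p(2)[of x]
          proj_point_rep(1)[OF L x] by auto
    qed
    then have "{L\<in>?P. P (?e L) \<noteq> 0} = {L \<in> ?P. \<forall>x\<in>L. p x \<noteq> 0}" by auto
    also have "\<dots> \<in> ?B" using p(1) by blast
    finally show "openin (topology_generated_by ?B) {L\<in>?P. P (?e L) \<noteq> 0}"
      by (rule topology_generated_by_Basis)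
  qed
  have sec: "f \<in> locrat (?m * ?m) ?e U" if f: "f \<in> sections (projective_space n) U"
    and U: "openin (ztop (projective_space n)) U" for f U
  proof (rule locratI)
    fix L assume L: "L \<in> U"
    have UP: "U \<subseteq> ?P" using openin_subset[OF U] pts by simp
    then have LP: "L \<in> ?P" using L by auto
    have "\<exists>d. \<exists>p\<in>homogeneous (Suc n) d. \<exists>q\<in>homogeneous (Suc n) d.
            (\<forall>x\<in>L. q x \<noteq> 0) \<and> (\<forall>M\<in>U. \<forall>x\<in>M. q x \<noteq> 0 \<longrightarrow> f M = p x / q x)"
      using f L unfolding projective_space_def by simp
    then obtain d p q where pq: "p \<in> homogeneous ?m d" "q \<in> homogeneous ?m d" "\<forall>x\<in>L. q x \<noteq> 0"
      "\<And>M x. M\<in>U \<Longrightarrow> x\<in>M \<Longrightarrow> q x \<noteq> 0 \<Longrightarrow> f M = p x / q x" by metis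
    obtain x where x: "x \<in> L" using proj_point_nonempty LP by blast
    obtain k where k: "k < ?m" "x k \<noteq> 0" using proj_point_rep(2)[OF LP x] by blast
    let ?q = "\<lambda>v. q (\<lambda>j. v (k * ?m + j)) * v (k * ?m + k)"
    let ?p = "\<lambda>v. p (\<lambda>j. v (k * ?m + j)) * v (k * ?m + k)"
    have "?q \<in> polys (?m * ?m)" "?p \<in> polys (?m * ?m)"
      by (intro polys.mult homogeneous_on_column(1)[OF pq(1) k(1)] homogeneous_on_column(1)[OF pq(2) k(1)]
          diagonal_coord_poly k(1))+
    moreover have "?q (?e L) \<noteq> 0"
      unfolding mult_eq_0_iff proj_coord_column(1)[OF pq(2) k(1) LP x]
      using proj_coord_column(2)[OF pq(2) k(1) LP x] k(2) x L pq(3) proj_point_rep(1)[OF LP x] by simp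
    moreover have "f M = ?p (?e M) / ?q (?e M)" if M: "M \<in> U" "?q (?e M) \<noteq> 0" for M
    proof -
      have MP: "M \<in> ?P" using M UP by auto
      obtain y where y: "y \<in> M" using proj_point_nonempty MP by blast
      have nz: "q y \<noteq> 0" "?e M (k * ?m + k) \<noteq> 0" "y k \<noteq> 0"
        using M(2) proj_coord_column(2)[OF pq(2) k(1) MP y]
        unfolding mult_eq_0_iff proj_coord_column(1)[OF pq(2) k(1) MP y] by auto
      have "(y k / nrm2 ?m y) ^ d \<noteq> 0" using nz(3) proj_point_rep(1)[OF MP y] by simp
      then show ?thesis using pq(4)[OF M(1) y nz(1)] nz(2)
        unfolding proj_coord_column(1)[OF pq(2) k(1) MP y] proj_coord_column(1)[OF pq(1) k(1) MP y]
        by (metis nonzero_mult_divide_mult_cancel_left nonzero_mult_divide_mult_cancel_right)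
    qed
    ultimately show "\<exists>p\<in>polys (?m * ?m). \<exists>q\<in>polys (?m * ?m). q (?e L) \<noteq> 0 \<and>
        (\<forall>M\<in>U. q (?e M) \<noteq> 0 \<longrightarrow> f M = p (?e M) / q (?e M))"
      by (intro bexI[of _ ?p] bexI[of _ ?q] conjI ballI impI)
  qed
  have "(\<lambda>L. P (?e L) / Q (?e L)) \<in> sections (projective_space n) {L \<in> ?P. Q (?e L) \<noteq> 0}"
    if PQ: "P \<in> polys (?m * ?m)" "Q \<in> polys (?m * ?m)" for P Q
  proof -
    from poly_of_veronese_homogeneous[OF PQ(1)] obtain h p where p: "p \<in> homogeneous ?m (2 * h)"
      "\<And>x. nrm2 ?m x \<noteq> 0 \<Longrightarrow> p x = nrm2 ?m x ^ h * P (veronese ?m x)" by blast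
    from poly_of_veronese_homogeneous[OF PQ(2)] obtain h' q where q: "q \<in> homogeneous ?m (2 * h')"
      "\<And>x. nrm2 ?m x \<noteq> 0 \<Longrightarrow> q x = nrm2 ?m x ^ h' * Q (veronese ?m x)" by blast
    let ?p = "\<lambda>x. p x * nrm2 ?m x ^ h'" and ?q = "\<lambda>x. q x * nrm2 ?m x ^ h"
    have hom: "?p \<in> homogeneous ?m (2 * (h + h'))" "?q \<in> homogeneous ?m (2 * (h + h'))"
      using homogeneous_mult[OF p(1) homogeneous_nrm2[of ?m h']]
        homogeneous_mult[OF q(1) homogeneous_nrm2[of ?m h]] by (simp_all add: algebra_simps)
    have eval: "?q x \<noteq> 0 \<longleftrightarrow> Q (?e M) \<noteq> 0" "?q x \<noteq> 0 \<Longrightarrow> P (?e M) / Q (?e M) = ?p x / ?q x"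
      if M: "M \<in> ?P" "x \<in> M" for M x
      using proj_point_rep(1)[OF M] p(2)[of x] q(2)[of x] unfolding proj_coord_eq[OF M] by auto
    have "\<exists>d. \<exists>p\<in>homogeneous (Suc n) d. \<exists>q\<in>homogeneous (Suc n) d.
            (\<forall>x\<in>L. q x \<noteq> 0) \<and> (\<forall>M\<in>{L \<in> ?P. Q (?e L) \<noteq> 0}. \<forall>x\<in>M. q x \<noteq> 0 \<longrightarrow>
              P (?e M) / Q (?e M) = p x / q x)" if L: "L \<in> {L \<in> ?P. Q (?e L) \<noteq> 0}" for L
    proof (rule exI[of _ "2 * (h + h')"], rule bexI[OF _ hom(1)], rule bexI[OF _ hom(2)], intro conjI ballI impI)
      show "?q x \<noteq> 0" if "x \<in> L" for x using eval(1)[of L x] L that by simp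
      show "P (?e M) / Q (?e M) = ?p x / ?q x"
        if "M \<in> {L \<in> ?P. Q (?e L) \<noteq> 0}" "x \<in> M" "?q x \<noteq> 0" for M x
        using that eval(2)[of M x] by simp
    qed
    then show ?thesis unfolding projective_space_def by simp
  qed
  with op sec pts show ?thesis unfolding precoords_def by auto
qed

lemma real_algebraic_variety_coords:
  assumes "real_algebraic_variety Y"
  shows "\<exists>N e. coords Y N e"
proof -
  obtain n S f where "ringed_space Y" "biregular Y (induced (projective_space n) S) f"
    using assms unfolding real_algebraic_variety_def isomorphic_def by blast
  from coords_biregular[OF this coords_induced[OF precoords_projective]] show ?thesis by blast
qed

section \<open>Polynomial functions form a Noetherian ring\<close>

inductive_set ideal :: "nat \<Rightarrow> ((nat \<Rightarrow> real) \<Rightarrow> real) set \<Rightarrow> ((nat \<Rightarrow> real) \<Rightarrow> real) set"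
  for n and F where
  zero: "(\<lambda>x. 0) \<in> ideal n F"
| gen: "f \<in> F \<Longrightarrow> f \<in> ideal n F"
| add: "f \<in> ideal n F \<Longrightarrow> g \<in> ideal n F \<Longrightarrow> (\<lambda>x. f x + g x) \<in> ideal n F"
| mult: "u \<in> polys n \<Longrightarrow> f \<in> ideal n F \<Longrightarrow> (\<lambda>x. u x * f x) \<in> ideal n F"

lemma ideal_hull:
  assumes "f \<in> ideal n F" "F \<subseteq> ideal n G" shows "f \<in> ideal n G"
  using assms by (induction rule: ideal.induct) (auto intro: ideal.intros)

lemma ideal_mono: "F \<subseteq> G \<Longrightarrow> ideal n F \<subseteq> ideal n G"
  using ideal_hull ideal.gen by blast

lemma ideal_subset_polys:
  assumes "f \<in> ideal n F" "F \<subseteq> polys n" shows "f \<in> polys n"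
  using assms by (induction rule: ideal.induct) (auto intro: polys.intros)

lemma ideal_vanishes:
  assumes "f \<in> ideal n F" "\<And>g. g \<in> F \<Longrightarrow> g x = 0" shows "f x = 0"
  using assms by (induction rule: ideal.induct) auto

lemma ideal_diff:
  assumes "f \<in> ideal n F" "g \<in> ideal n F" shows "(\<lambda>x. f x - g x) \<in> ideal n F"
  using ideal.add[OF assms(1) ideal.mult[OF polys.const[of "-1"] assms(2)]] by simp

text \<open>Polynomial functions in \<open>n + 1\<close> coordinates whose degree in the last one is below \<open>d\<close>.\<close>

primrec lowdeg :: "nat \<Rightarrow> nat \<Rightarrow> ((nat \<Rightarrow> real) \<Rightarrow> real) set" where
  "lowdeg n 0 = {\<lambda>x. 0}"
| "lowdeg n (Suc d) = {(\<lambda>x. r x + a x * x n ^ d) | r a. r \<in> lowdeg n d \<and> a \<in> polys n}"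

lemma lowdeg_SucI: "r \<in> lowdeg n d \<Longrightarrow> a \<in> polys n \<Longrightarrow> (\<lambda>x. r x + a x * x n ^ d) \<in> lowdeg n (Suc d)"
  by auto

lemma lowdeg_add: "f \<in> lowdeg n d \<Longrightarrow> g \<in> lowdeg n d \<Longrightarrow> (\<lambda>x. f x + g x) \<in> lowdeg n d"
proof (induction d arbitrary: f g)
  case (Suc d)
  from Suc.prems obtain r a r' a' where 1: "f = (\<lambda>x. r x + a x * x n ^ d)" "r \<in> lowdeg n d" "a \<in> polys n"
    "g = (\<lambda>x. r' x + a' x * x n ^ d)" "r' \<in> lowdeg n d" "a' \<in> polys n" by auto
  have "(\<lambda>x. (r x + r' x) + (a x + a' x) * x n ^ d) \<in> lowdeg n (Suc d)"
    by (intro lowdeg_SucI Suc.IH polys.add 1)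
  then show ?case by (simp add: 1 algebra_simps)
qed simp

lemma lowdeg_cmult: "f \<in> lowdeg n d \<Longrightarrow> u \<in> polys n \<Longrightarrow> (\<lambda>x. u x * f x) \<in> lowdeg n d"
proof (induction d arbitrary: f)
  case (Suc d)
  from Suc.prems obtain r a where 1: "f = (\<lambda>x. r x + a x * x n ^ d)" "r \<in> lowdeg n d" "a \<in> polys n" by auto
  have "(\<lambda>x. u x * r x + (u x * a x) * x n ^ d) \<in> lowdeg n (Suc d)"
    by (intro lowdeg_SucI Suc.IH polys.mult 1 Suc.prems)
  then show ?case by (simp add: 1 algebra_simps)
qed simp

lemma lowdeg_Suc: "f \<in> lowdeg n d \<Longrightarrow> f \<in> lowdeg n (Suc d)"
  using lowdeg_SucI[OF _ polys.const[of 0]] by auto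

lemma lowdeg_add_right: "f \<in> lowdeg n d \<Longrightarrow> f \<in> lowdeg n (d + k)"
  by (induction k) (auto intro: lowdeg_Suc simp del: lowdeg.simps)

lemma lowdeg_times_coord: "f \<in> lowdeg n d \<Longrightarrow> (\<lambda>x. x n * f x) \<in> lowdeg n (Suc d)"
proof (induction d arbitrary: f)
  case 0
  then show ?case using lowdeg_Suc[of f n 0] by simp
next
  case (Suc d)
  from Suc.prems obtain r a where 1: "f = (\<lambda>x. r x + a x * x n ^ d)" "r \<in> lowdeg n d" "a \<in> polys n" by auto
  have "(\<lambda>x. x n * r x + a x * x n ^ Suc d) \<in> lowdeg n (Suc (Suc d))"
    by (rule lowdeg_SucI[OF Suc.IH[OF 1(2)] 1(3)])
  moreover have "(\<lambda>x. x n * f x) = (\<lambda>x. x n * r x + a x * x n ^ Suc d)"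
    by (simp add: 1 algebra_simps)
  ultimately show ?case by (simp only:)
qed

lemma lowdeg_times_power: "f \<in> lowdeg n d \<Longrightarrow> (\<lambda>x. x n ^ k * f x) \<in> lowdeg n (d + k)"
proof (induction k)
  case (Suc k)
  from lowdeg_times_coord[OF Suc.IH[OF Suc.prems]] show ?case
    by (simp add: mult.assoc del: lowdeg.simps)
qed simp

lemma lowdeg_mult: "f \<in> lowdeg n d \<Longrightarrow> g \<in> lowdeg n d' \<Longrightarrow> (\<lambda>x. f x * g x) \<in> lowdeg n (d + d')"
proof (induction d arbitrary: f)
  case 0
  then show ?case using lowdeg_add_right[of "\<lambda>x. 0" n 0 d'] by simp
next
  case (Suc d)
  from Suc.prems obtain r a where 1: "f = (\<lambda>x. r x + a x * x n ^ d)" "r \<in> lowdeg n d" "a \<in> polys n" by auto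
  have "(\<lambda>x. a x * (x n ^ d * g x)) \<in> lowdeg n (d' + d)"
    by (intro lowdeg_cmult lowdeg_times_power 1 Suc.prems)
  from lowdeg_add[OF Suc.IH[OF 1(2) Suc.prems(2)] this[unfolded add.commute[of d' d]]]
  have "(\<lambda>x. f x * g x) \<in> lowdeg n (d + d')" by (simp add: 1 algebra_simps)
  from lowdeg_Suc[OF this] show ?case by (simp del: lowdeg.simps)
qed

lemma polys_in_lowdeg: "p \<in> polys (Suc n) \<Longrightarrow> \<exists>d. p \<in> lowdeg n d"
proof (induction rule: polys.induct)
  case (const c)
  have "(\<lambda>x. 0 + c * x n ^ 0) \<in> lowdeg n (Suc 0)"
    by (rule lowdeg_SucI) (auto intro: polys.const)
  then show ?case by (intro exI[of _ "Suc 0"]) (simp del: lowdeg.simps)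
next
  case (coord i)
  show ?case
  proof (cases "i = n")
    case True
    have "(\<lambda>x. 0 + 1 * x n ^ 1) \<in> lowdeg n (Suc 1)"
      by (rule lowdeg_SucI, rule lowdeg_Suc[of _ _ 0, unfolded One_nat_def[symmetric]])
         (auto intro: polys.const)
    then show ?thesis using True by (intro exI[of _ "Suc 1"]) (simp del: lowdeg.simps)
  next
    case False
    have "(\<lambda>x. 0 + x i * x n ^ 0) \<in> lowdeg n (Suc 0)"
      by (rule lowdeg_SucI) (use coord False in \<open>auto intro: polys.coord\<close>)
    then show ?thesis by (intro exI[of _ "Suc 0"]) (simp del: lowdeg.simps)
  qed
next
  case (add p q)
  then obtain d d' where "p \<in> lowdeg n d" "q \<in> lowdeg n d'" by auto
  then have "p \<in> lowdeg n (d + d')" "q \<in> lowdeg n (d + d')"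
    using lowdeg_add_right[of p n d d'] lowdeg_add_right[of q n d' d] by (auto simp: add.commute)
  then show ?case using lowdeg_add by blast
next
  case (mult p q)
  then show ?case using lowdeg_mult by blast
qed

lemma sequence_by_choice:
  assumes "\<And>F. finite F \<Longrightarrow> F \<subseteq> A \<Longrightarrow> \<exists>x\<in>A. R F x"
  shows "\<exists>h :: nat \<Rightarrow> 'a. \<forall>m. h m \<in> A \<and> R (h ` {..<m}) (h m)"
proof -
  define pick where "pick F = (SOME x. x \<in> A \<and> R F x)" for F
  define H where "H = rec_nat [] (\<lambda>_ l. l @ [pick (set l)])"
  define h where "h m = pick (set (H m))" for m
  have H: "H 0 = []" "H (Suc m) = H m @ [h m]" for m by (auto simp: H_def h_def)
  have set: "set (H m) = h ` {..<m}" for m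
    by (induction m) (auto simp: H lessThan_Suc)
  have pick: "pick F \<in> A \<and> R F (pick F)" if "finite F" "F \<subseteq> A" for F
    unfolding pick_def by (rule someI_ex) (use assms[OF that] in blast)
  have sub: "h ` {..<m} \<subseteq> A" for m
  proof (induction m)
    case (Suc m)
    then show ?case using pick[of "h ` {..<m}"] by (auto simp: h_def[of m] set lessThan_Suc)
  qed simp
  have "h m \<in> A \<and> R (h ` {..<m}) (h m)" for m
    using pick[OF _ sub[of m]] unfolding h_def[of m] set by simp
  then show ?thesis by blast
qed

text \<open>
  Hilbert's basis theorem.  If the ideal \<open>I\<close> of a bad sequence in \<open>n + 1\<close> variables had no finite
  set of generators, choose \<open>h\<^sub>m\<close> in \<open>I\<close> outside the ideal of its predecessors and of least degree
  in the last variable.  By induction some leading coefficient \<open>a\<^sub>m\<close> lies in the ideal of the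
  earlier ones; the corresponding combination of the earlier \<open>h\<^sub>i\<close> cancels the leading term of
  \<open>h\<^sub>m\<close>, against minimality.
\<close>
lemma polys_noetherian:
  assumes "\<And>i. f i \<in> polys n"
  shows "\<exists>m::nat. f m \<in> ideal n (f ` {..<m})"
  using assms
proof (induction n arbitrary: f)
  case 0
  have c: "f i = (\<lambda>x. f i (\<lambda>_. 0))" for i
    by (rule ext, rule polys_cong[OF 0[of i]]) simp
  show ?case
  proof (cases "f 0 (\<lambda>_. 0) = 0")
    case True
    then have "f 0 = (\<lambda>x. 0)" using c[of 0] by simp
    then show ?thesis by (intro exI[of _ 0]) (simp add: ideal.zero)
  next
    case False
    have "(\<lambda>x. (f 1 (\<lambda>_. 0) / f 0 (\<lambda>_. 0)) * f 0 x) \<in> ideal 0 (f ` {..<1})"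
      by (intro ideal.mult polys.const ideal.gen) auto
    moreover have "(\<lambda>x. (f 1 (\<lambda>_. 0) / f 0 (\<lambda>_. 0)) * f 0 x) = f 1"
    proof
      fix x
      have "f 0 x = f 0 (\<lambda>_. 0)" "f 1 x = f 1 (\<lambda>_. 0)" using fun_cong[OF c] by blast+
      then show "(f 1 (\<lambda>_. 0) / f 0 (\<lambda>_. 0)) * f 0 x = f 1 x" using False by simp
    qed
    ultimately show ?thesis by (intro exI[of _ 1]) simp
  qed
next
  case (Suc n)
  show ?case
  proof (rule ccontr)
    assume bad: "\<nexists>m. f m \<in> ideal (Suc n) (f ` {..<m})"
    define J where "J m = ideal (Suc n) (f ` {..<m})" for m
    define I where "I = (\<Union>m. J m)"
    have Jmono: "J k \<subseteq> J m" if "k \<le> m" for k m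
      unfolding J_def by (intro ideal_mono image_mono) (use that in auto)
    have Ifin: "\<exists>M. F \<subseteq> J M" if "finite F" "F \<subseteq> I" for F
      using that
    proof (induction F)
      case (insert x F)
      then obtain M k where Mk: "F \<subseteq> J M" "x \<in> J k" unfolding I_def by auto
      then have "insert x F \<subseteq> J (max M k)" using Jmono[of M "max M k"] Jmono[of k "max M k"] by auto
      then show ?case by blast
    qed simp
    have IP: "g \<in> polys (Suc n)" if "g \<in> I" for g
      using that Suc.prems unfolding I_def J_def by (auto intro: ideal_subset_polys)
    define deg where "deg g = (LEAST d. g \<in> lowdeg n d)" for g
    have deg: "g \<in> lowdeg n (deg g)" if "g \<in> polys (Suc n)" for g
      unfolding deg_def using polys_in_lowdeg[OF that] by (rule LeastI_ex)
    have deg_le: "deg g \<le> d" if "g \<in> lowdeg n d" for g d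
      unfolding deg_def using that by (rule Least_le)
    define R where "R F g \<longleftrightarrow> g \<notin> ideal (Suc n) F \<and> (\<forall>y\<in>I. y \<notin> ideal (Suc n) F \<longrightarrow> deg g \<le> deg y)" for F g
    have ex: "\<exists>g\<in>I. R F g" if F: "finite F" "F \<subseteq> I" for F
    proof -
      obtain M where M: "F \<subseteq> J M" using Ifin[OF F] by blast
      have "f M \<notin> ideal (Suc n) F" using bad M ideal_hull unfolding J_def by blast
      moreover have "f M \<in> I" unfolding I_def J_def
        by (rule UN_I[of "Suc M"]) (auto intro: ideal.gen)
      ultimately have "f M \<in> I \<and> f M \<notin> ideal (Suc n) F" by blast
      from ex_has_least_nat[of "\<lambda>g. g \<in> I \<and> g \<notin> ideal (Suc n) F", OF this, of deg]
      show ?thesis unfolding R_def by blast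
    qed
    have "\<exists>h. \<forall>m::nat. h m \<in> I \<and> R (h ` {..<m}) (h m)"
      by (rule sequence_by_choice) (rule ex)
    then obtain h where hI: "\<And>m::nat. h m \<in> I" and hR: "\<And>m. R (h ` {..<m}) (h m)" by blast
    define Q where "Q m r a \<longleftrightarrow> h m = (\<lambda>x. r x + a x * x n ^ (deg (h m) - 1)) \<and>
      r \<in> lowdeg n (deg (h m) - 1) \<and> a \<in> polys n \<and> deg (h m) > 0" for m r a
    have "\<exists>r a. Q m r a" for m
    proof -
      have "h m \<in> lowdeg n (deg (h m))" by (rule deg[OF IP[OF hI]])
      moreover have "h m \<noteq> (\<lambda>x. 0)" using hR[of m] ideal.zero unfolding R_def by metis
      ultimately show ?thesis unfolding Q_def by (cases "deg (h m)") auto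
    qed
    then obtain r a where "\<And>m. Q m (r m) (a m)" by metis
    then have ra: "\<And>m. h m = (\<lambda>x. r m x + a m x * x n ^ (deg (h m) - 1))"
      "\<And>m. r m \<in> lowdeg n (deg (h m) - 1)" "\<And>m. a m \<in> polys n" "\<And>m. deg (h m) > 0"
      unfolding Q_def by blast+
    obtain m where m: "a m \<in> ideal n (a ` {..<m})" using Suc.IH[of a, OF ra(3)] by (elim exE) (rule that)
    define D where "D = deg (h m) - 1"
    have dle: "deg (h i) - 1 \<le> D" if "i < m" for i
    proof -
      have "h m \<notin> ideal (Suc n) (h ` {..<i})"
        using hR[of m] ideal_mono[OF image_mono[of "{..<i}" "{..<m}" h], of "Suc n"] that
        unfolding R_def by auto
      then show ?thesis using hR[of i] hI[of m] unfolding R_def D_def by (meson diff_le_mono)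
    qed
    have "\<exists>s\<in>lowdeg n D. (\<lambda>x. s x + b x * x n ^ D) \<in> ideal (Suc n) (h ` {..<m})"
      if "b \<in> ideal n (a ` {..<m})" for b
      using that
    proof (induction rule: ideal.induct)
      case zero
      have "(\<lambda>x. 0) \<in> lowdeg n D" using lowdeg_add_right[of "\<lambda>x. 0" n 0 D] by simp
      then show ?case by (intro bexI) (auto intro: ideal.zero)
    next
      case (gen b)
      then obtain i where i: "i < m" "b = a i" by auto
      define k where "k = D - (deg (h i) - 1)"
      have k: "(deg (h i) - 1) + k = D" using dle[OF i(1)] by (simp add: k_def)
      have "(\<lambda>x. x n ^ k * r i x) \<in> lowdeg n D" using lowdeg_times_power[OF ra(2)[of i], of k] unfolding k .
      moreover have "(\<lambda>x. x n ^ k * h i x) \<in> ideal (Suc n) (h ` {..<m})"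
        by (intro ideal.mult polys_power polys.coord ideal.gen) (use i in auto)
      moreover have "x n ^ k * h i x = x n ^ k * r i x + b x * x n ^ D" for x
        by (subst ra(1), subst k[symmetric]) (simp add: i power_add algebra_simps)
      ultimately show ?case by (intro bexI) auto
    next
      case (add b b')
      then obtain s s' where "s \<in> lowdeg n D" "(\<lambda>x. s x + b x * x n ^ D) \<in> ideal (Suc n) (h ` {..<m})"
        "s' \<in> lowdeg n D" "(\<lambda>x. s' x + b' x * x n ^ D) \<in> ideal (Suc n) (h ` {..<m})" by blast
      note s = this
      from ideal.add[OF s(2,4)] lowdeg_add[OF s(1,3)] show ?case
        by (intro bexI[of _ "\<lambda>x. s x + s' x"]) (auto simp: algebra_simps)
    next
      case (mult u b)
      then obtain s where s: "s \<in> lowdeg n D" "(\<lambda>x. s x + b x * x n ^ D) \<in> ideal (Suc n) (h ` {..<m})"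
        by blast
      from ideal.mult[OF polys_mono[OF mult(1), of "Suc n"] s(2)] lowdeg_cmult[OF s(1) mult(1)] show ?case
        by (intro bexI[of _ "\<lambda>x. u x * s x"]) (auto simp: algebra_simps)
    qed
    from this[OF m] obtain s where s: "s \<in> lowdeg n D"
      "(\<lambda>x. s x + a m x * x n ^ D) \<in> ideal (Suc n) (h ` {..<m})" (is "?w \<in> _") by blast
    define y where "y = (\<lambda>x. h m x - ?w x)"
    have "y = (\<lambda>x. r m x + (-1) * s x)"
      unfolding y_def by (subst ra(1)) (simp add: D_def)
    then have "y \<in> lowdeg n D"
      using lowdeg_add[OF ra(2)[of m, folded D_def] lowdeg_cmult[OF s(1) polys.const[of "-1"]]] by (simp only:)
    from deg_le[OF this] have "deg y < deg (h m)" using ra(4)[of m] by (simp add: D_def)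
    moreover have "y \<in> I"
    proof -
      obtain M where "insert (h m) (h ` {..<m}) \<subseteq> J M" using Ifin[of "insert (h m) (h ` {..<m})"] hI by auto
      then have "h m \<in> J M" "?w \<in> J M" using ideal_hull[OF s(2)] unfolding J_def by auto
      then have "y \<in> J M" unfolding y_def J_def by (rule ideal_diff)
      then show ?thesis by (auto simp: I_def)
    qed
    moreover have "y \<notin> ideal (Suc n) (h ` {..<m})"
    proof
      assume "y \<in> ideal (Suc n) (h ` {..<m})"
      from ideal.add[OF this s(2)] have "h m \<in> ideal (Suc n) (h ` {..<m})" by (simp add: y_def)
      then show False using hR[of m] by (simp add: R_def)
    qed
    ultimately show False using hR[of m] by (auto simp: R_def)
  qed
qed

text \<open>
  Quasi-compactness: a polynomial in the ideal of others cannot be nonzero at a point where all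
  of these vanish.
\<close>
lemma finitely_many_nonvanishing:
  assumes "\<And>y. y \<in> P \<Longrightarrow> g y \<in> polys N" "\<And>y. y \<in> P \<Longrightarrow> g y (e y) \<noteq> 0"
  shows "\<exists>F. finite F \<and> F \<subseteq> P \<and> (\<forall>y\<in>P. \<exists>z\<in>F. g z (e y) \<noteq> 0)"
proof (rule ccontr)
  assume no: "\<not> ?thesis"
  have "\<exists>y\<in>P. \<forall>z\<in>F. g z (e y) = 0" if "finite F" "F \<subseteq> P" for F
    using no that by simp
  from sequence_by_choice[of P "\<lambda>F y. \<forall>z\<in>F. g z (e y) = 0", OF this]
  obtain h where h: "\<And>m::nat. h m \<in> P" "\<And>m. \<forall>z\<in>h ` {..<m}. g z (e (h m)) = 0" by blast
  obtain m where "g (h m) \<in> ideal N ((\<lambda>i. g (h i)) ` {..<m})"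
    using polys_noetherian[of "\<lambda>i. g (h i)" N] assms(1) h(1) by blast
  then have "g (h m) (e (h m)) = 0" by (rule ideal_vanishes) (use h(2) in auto)
  then show False using assms(2) h(1) by blast
qed

section \<open>Derivations and curves\<close>

lemma tangent_spaceD:
  assumes "D \<in> tangent_space X x"
  shows "\<not> (openin (ztop X) U \<and> x \<in> U \<and> f \<in> sections X U) \<Longrightarrow> D U f = 0"
    and "openin (ztop X) U \<Longrightarrow> openin (ztop X) V \<Longrightarrow> openin (ztop X) W \<Longrightarrow>
        x \<in> W \<Longrightarrow> W \<subseteq> U \<inter> V \<Longrightarrow> f \<in> sections X U \<Longrightarrow> g \<in> sections X V \<Longrightarrow> (\<And>z. z \<in> W \<Longrightarrow> f z = g z)
        \<Longrightarrow> D U f = D V g"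
    and "openin (ztop X) U \<Longrightarrow> x \<in> U \<Longrightarrow> f \<in> sections X U \<Longrightarrow> g \<in> sections X U \<Longrightarrow>
          D U (\<lambda>z. f z + g z) = D U f + D U g"
    and "openin (ztop X) U \<Longrightarrow> x \<in> U \<Longrightarrow> f \<in> sections X U \<Longrightarrow> D U (\<lambda>z. c * f z) = c * D U f"
    and "openin (ztop X) U \<Longrightarrow> x \<in> U \<Longrightarrow> f \<in> sections X U \<Longrightarrow> g \<in> sections X U \<Longrightarrow>
          D U (\<lambda>z. f z * g z) = f x * D U g + g x * D U f"
proof -
  note D = assms[unfolded tangent_space_def mem_Collect_eq]
  show "\<not> (openin (ztop X) U \<and> x \<in> U \<and> f \<in> sections X U) \<Longrightarrow> D U f = 0"
    using D[THEN conjunct1] by blast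
  show "openin (ztop X) U \<Longrightarrow> openin (ztop X) V \<Longrightarrow> openin (ztop X) W \<Longrightarrow>
        x \<in> W \<Longrightarrow> W \<subseteq> U \<inter> V \<Longrightarrow> f \<in> sections X U \<Longrightarrow> g \<in> sections X V \<Longrightarrow> (\<And>z. z \<in> W \<Longrightarrow> f z = g z)
        \<Longrightarrow> D U f = D V g"
    using D[THEN conjunct2, THEN conjunct1, rule_format, of U V W f g] by blast
  show "openin (ztop X) U \<Longrightarrow> x \<in> U \<Longrightarrow> f \<in> sections X U \<Longrightarrow> g \<in> sections X U \<Longrightarrow>
          D U (\<lambda>z. f z + g z) = D U f + D U g"
    using D[THEN conjunct2, THEN conjunct2, rule_format, of U f g] by blast
  show "openin (ztop X) U \<Longrightarrow> x \<in> U \<Longrightarrow> f \<in> sections X U \<Longrightarrow> D U (\<lambda>z. c * f z) = c * D U f"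
    using D[THEN conjunct2, THEN conjunct2, rule_format, of U f f] by blast
  show "openin (ztop X) U \<Longrightarrow> x \<in> U \<Longrightarrow> f \<in> sections X U \<Longrightarrow> g \<in> sections X U \<Longrightarrow>
          D U (\<lambda>z. f z * g z) = f x * D U g + g x * D U f"
    using D[THEN conjunct2, THEN conjunct2, rule_format, of U f g] by blast
qed

text \<open>
  Both a derivation and differentiation along a curve satisfy the sum and product rules, so it
  suffices that they agree on the functions \<open>u\<^sub>i\<close>.  This takes the place of partial derivatives
  and the chain rule.
\<close>
lemma derivation_poly:
  assumes X: "coords X N e" and D: "D \<in> tangent_space X y" and U: "openin (ztop X) U" "y \<in> U"
    and u: "\<And>i. i < n \<Longrightarrow> (\<lambda>z. u z i) \<in> sections X U"
    and x: "\<And>i. i < n \<Longrightarrow> ((\<lambda>t. x t i) has_real_derivative D U (\<lambda>z. u z i)) (at 0)"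
    and x0: "\<And>i. i < n \<Longrightarrow> x 0 i = u y i"
    and p: "p \<in> polys n"
  shows "(\<lambda>z. p (u z)) \<in> sections X U \<and> ((\<lambda>t. p (x t)) has_real_derivative D U (\<lambda>z. p (u z))) (at 0)"
  using p
proof (induction rule: polys.induct)
  case (const c)
  have s: "(\<lambda>z. c) \<in> sections X U" for c
    using coordsD(2)[OF X U(1)] locrat_const by blast
  have "D U (\<lambda>z. 1 * 1) = 1 * D U (\<lambda>z. 1) + 1 * D U (\<lambda>z. 1)"
    by (rule tangent_spaceD(5)[OF D U s s])
  then have "D U (\<lambda>z. 1) = 0" by simp
  moreover have "D U (\<lambda>z. c * 1) = c * D U (\<lambda>z. 1)" by (rule tangent_spaceD(4)[OF D U s])
  ultimately show ?case using s by simp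
next
  case (coord i)
  then show ?case using u x by blast
next
  case (add p q)
  have "(\<lambda>z. p (u z) + q (u z)) \<in> sections X U"
    using add.IH coordsD(2)[OF X U(1)] locrat_add by blast
  moreover have "((\<lambda>t. p (x t) + q (x t)) has_real_derivative D U (\<lambda>z. p (u z)) + D U (\<lambda>z. q (u z))) (at 0)"
    using add.IH by (intro derivative_intros) auto
  ultimately show ?case using tangent_spaceD(3)[OF D U] add.IH by simp
next
  case (mult p q)
  have "(\<lambda>z. p (u z) * q (u z)) \<in> sections X U"
    using mult.IH coordsD(2)[OF X U(1)] locrat_mult by blast
  moreover have "((\<lambda>t. p (x t) * q (x t)) has_real_derivative
      D U (\<lambda>z. p (u z)) * q (x 0) + D U (\<lambda>z. q (u z)) * p (x 0)) (at 0)"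
    using mult.IH by (intro DERIV_mult) auto
  moreover have "p (x 0) = p (u y)" "q (x 0) = q (u y)"
    by (rule polys_cong[OF mult.hyps(1) x0], assumption, rule polys_cong[OF mult.hyps(2) x0])
  ultimately show ?case using tangent_spaceD(5)[OF D U, of "\<lambda>z. p (u z)" "\<lambda>z. q (u z)"] mult.IH
    by (simp add: algebra_simps)
qed

text \<open>
  Here the Leibniz rule is applied to the product \<open>q f\<close>, which is a polynomial in \<open>u\<close> near \<open>y\<close>.
\<close>
lemma derivation_quotient:
  assumes X: "coords X N e" and D: "D \<in> tangent_space X y" and U: "openin (ztop X) U" "y \<in> U"
    and u: "\<And>i. i < n \<Longrightarrow> (\<lambda>z. u z i) \<in> sections X U"
    and x: "\<And>i. i < n \<Longrightarrow> ((\<lambda>t. x t i) has_real_derivative D U (\<lambda>z. u z i)) (at 0)"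
    and x0: "\<And>i. i < n \<Longrightarrow> x 0 i = u y i"
    and p: "p \<in> polys n" and q: "q \<in> polys n" "q (u y) \<noteq> 0"
    and V: "openin (ztop X) V" "f \<in> sections X V"
    and W: "openin (ztop X) W" "y \<in> W" "W \<subseteq> U \<inter> V" "\<And>z. z \<in> W \<Longrightarrow> q (u z) * f z = p (u z)"
  shows "((\<lambda>t. p (x t) / q (x t)) has_real_derivative D V f) (at 0)"
proof -
  note P = derivation_poly[OF X D U u x x0 p, simplified] and Q = derivation_poly[OF X D U u x x0 q(1), simplified]
  have res: "g \<in> sections X W" if "g \<in> sections X U \<or> g \<in> sections X V" for g
  proof -
    have "g \<in> locrat N e U \<or> g \<in> locrat N e V"
      using that coordsD(2)[OF X U(1), of g] coordsD(2)[OF X V(1), of g] by blast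
    then have "g \<in> locrat N e W"
    proof
      assume "g \<in> locrat N e U" then show ?thesis by (rule locrat_subset) (use W(3) in auto)
    next
      assume "g \<in> locrat N e V" then show ?thesis by (rule locrat_subset) (use W(3) in auto)
    qed
    then show ?thesis using coordsD(2)[OF X W(1), of g] by blast
  qed
  have "D W (\<lambda>z. q (u z) * f z) = q (u y) * D W f + f y * D W (\<lambda>z. q (u z))"
    by (rule tangent_spaceD(5)[OF D W(1,2) res res]) (use Q V in auto)
  moreover have "D W f = D V f"
    by (rule tangent_spaceD(2)[OF D W(1) V(1) W(1,2) _ res V(2)]) (use W V in auto)
  moreover have "D W (\<lambda>z. q (u z)) = D U (\<lambda>z. q (u z))"
    by (rule tangent_spaceD(2)[OF D W(1) U(1) W(1,2) _ res Q[THEN conjunct1]]) (use W Q in auto)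
  moreover have "D W (\<lambda>z. q (u z) * f z) = D U (\<lambda>z. p (u z))"
  proof (rule tangent_spaceD(2)[OF D W(1) U(1) W(1,2) _ _ P[THEN conjunct1]])
    have "(\<lambda>z. q (u z)) \<in> locrat N e W" "f \<in> locrat N e W"
      unfolding coordsD(2)[OF X W(1), symmetric] by (rule res, use Q V in simp)+
    then show "(\<lambda>z. q (u z) * f z) \<in> sections X W" using coordsD(2)[OF X W(1)] locrat_mult by blast
  qed (use W in auto)
  ultimately have eq: "D U (\<lambda>z. p (u z)) = q (u y) * D V f + f y * D U (\<lambda>z. q (u z))" by simp
  have x0': "p (x 0) = q (u y) * f y" "q (x 0) = q (u y)"
    using polys_cong[OF p x0] polys_cong[OF q(1) x0] W by auto
  have "((\<lambda>t. p (x t) / q (x t)) has_real_derivative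
      (D U (\<lambda>z. p (u z)) * q (x 0) - p (x 0) * D U (\<lambda>z. q (u z))) / (q (x 0) * q (x 0))) (at 0)"
    using P Q x0' q by (intro DERIV_divide) auto
  moreover have "(D U (\<lambda>z. p (u z)) * q (x 0) - p (x 0) * D U (\<lambda>z. q (u z))) / (q (x 0) * q (x 0)) = D V f"
    unfolding x0' eq using q(2) by (simp add: divide_simps) (simp add: algebra_simps)
  ultimately show ?thesis by simp
qed

lemma poly_along_curve:
  assumes "p \<in> polys n" "\<And>i. i < n \<Longrightarrow> \<exists>d. ((\<lambda>t. x t i) has_real_derivative d) (at t0)"
  shows "\<exists>d. ((\<lambda>t. p (x t)) has_real_derivative d) (at t0)"
  using assms
proof (induction rule: polys.induct)
  case (const c)
  show ?case by (auto intro: DERIV_const)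
next
  case (add p q)
  then obtain d d' where "((\<lambda>t. p (x t)) has_real_derivative d) (at t0)"
    "((\<lambda>t. q (x t)) has_real_derivative d') (at t0)" by blast
  from DERIV_add[OF this] show ?case by blast
next
  case (mult p q)
  then obtain d d' where "((\<lambda>t. p (x t)) has_real_derivative d) (at t0)"
    "((\<lambda>t. q (x t)) has_real_derivative d') (at t0)" by blast
  from DERIV_mult[OF this] show ?case by blast
qed auto

lemma DERIV_eventually_nonzero:
  assumes "(f has_real_derivative d) (at (0::real))" "f 0 \<noteq> 0"
  shows "eventually (\<lambda>t. f t \<noteq> 0) (nhds 0)"
proof -
  have "isCont f 0" using assms(1) by (rule DERIV_isCont)
  then have "(f \<longlongrightarrow> f 0) (nhds 0)" by (simp add: continuous_at tendsto_at_iff_tendsto_nhds)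
  then show ?thesis using assms(2) by (rule tendsto_imp_eventually_ne)
qed

lemma section_along_curve:
  assumes X: "coords X N e" and U: "openin (ztop X) U" "\<gamma> 0 \<in> U"
    and g: "eventually (\<lambda>t. \<gamma> t \<in> points X) (nhds (0::real))"
    and d: "\<And>j. j < N \<Longrightarrow> \<exists>d. ((\<lambda>t. e (\<gamma> t) j) has_real_derivative d) (at 0)"
  shows "eventually (\<lambda>t. \<gamma> t \<in> U) (nhds 0)"
    and "f \<in> sections X U \<Longrightarrow> \<exists>d. ((\<lambda>t. f (\<gamma> t)) has_real_derivative d) (at 0)"
proof -
  have near: "eventually (\<lambda>t. p (e (\<gamma> t)) \<noteq> 0) (nhds 0)" if p: "p \<in> polys N" "p (e (\<gamma> 0)) \<noteq> 0" for p
    using poly_along_curve[OF p(1), of "\<lambda>t. e (\<gamma> t)", OF d] DERIV_eventually_nonzero p(2) by fast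
  have "zopen (points X) N e U" using U coordsD(1)[OF X] by blast
  then obtain p where p: "p \<in> polys N" "p (e (\<gamma> 0)) \<noteq> 0" "\<And>z. z \<in> points X \<Longrightarrow> p (e z) \<noteq> 0 \<Longrightarrow> z \<in> U"
    using U(2) by (rule zopenE) (rule that)
  show ev: "eventually (\<lambda>t. \<gamma> t \<in> U) (nhds 0)"
    using near[OF p(1,2)] g by eventually_elim (rule p(3))
  assume "f \<in> sections X U"
  then have f: "f \<in> locrat N e U" using U coordsD(2)[OF X] by blast
  obtain P Q where PQ: "P \<in> polys N" "Q \<in> polys N" "Q (e (\<gamma> 0)) \<noteq> 0"
    "\<And>z. z \<in> U \<Longrightarrow> Q (e z) \<noteq> 0 \<Longrightarrow> f z = P (e z) / Q (e z)" by (rule locratE[OF f U(2)]) (rule that)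
  obtain d1 where d1: "((\<lambda>t. P (e (\<gamma> t))) has_real_derivative d1) (at 0)"
    using poly_along_curve[OF PQ(1), of "\<lambda>t. e (\<gamma> t)", OF d] by blast
  obtain d2 where d2: "((\<lambda>t. Q (e (\<gamma> t))) has_real_derivative d2) (at 0)"
    using poly_along_curve[OF PQ(2), of "\<lambda>t. e (\<gamma> t)", OF d] by blast
  have "eventually (\<lambda>t. P (e (\<gamma> t)) / Q (e (\<gamma> t)) = f (\<gamma> t)) (nhds 0)"
    using near[OF PQ(2,3)] ev by eventually_elim (simp add: PQ(4))
  from DERIV_cong_ev[OF refl this refl] DERIV_divide[OF d1 d2 PQ(3)]
  show "\<exists>d. ((\<lambda>t. f (\<gamma> t)) has_real_derivative d) (at 0)" by fast
qed

text \<open>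
  The value \<open>0\<close> on pairs that represent no germ is the normalization in \<open>tangent_space\<close>.
\<close>
definition curve_tangent :: "'a rspace \<Rightarrow> (real \<Rightarrow> 'a) \<Rightarrow> 'a set \<Rightarrow> ('a \<Rightarrow> real) \<Rightarrow> real" where
  "curve_tangent X \<gamma> U f =
     (if openin (ztop X) U \<and> \<gamma> 0 \<in> U \<and> f \<in> sections X U then deriv (\<lambda>t. f (\<gamma> t)) 0 else 0)"

lemma curve_tangent:
  assumes X: "coords X N e"
    and g: "eventually (\<lambda>t. \<gamma> t \<in> points X) (nhds (0::real))"
    and d: "\<And>j. j < N \<Longrightarrow> \<exists>d. ((\<lambda>t. e (\<gamma> t) j) has_real_derivative d) (at 0)"
  shows "openin (ztop X) U \<Longrightarrow> \<gamma> 0 \<in> U \<Longrightarrow> f \<in> sections X U \<Longrightarrow>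
            ((\<lambda>t. f (\<gamma> t)) has_real_derivative curve_tangent X \<gamma> U f) (at 0)"
    and "curve_tangent X \<gamma> \<in> tangent_space X (\<gamma> 0)"
proof -
  show der: "((\<lambda>t. f (\<gamma> t)) has_real_derivative curve_tangent X \<gamma> U f) (at 0)"
    if "openin (ztop X) U" "\<gamma> 0 \<in> U" "f \<in> sections X U" for U f
    using section_along_curve(2)[of X N e U \<gamma> f, OF X that(1,2) g d that(3)] that
    by (auto simp: curve_tangent_def DERIV_imp_deriv)
  have eq: "curve_tangent X \<gamma> U f = d" if "openin (ztop X) U" "\<gamma> 0 \<in> U" "f \<in> sections X U"
    "((\<lambda>t. f (\<gamma> t)) has_real_derivative d) (at 0)" for U f d
    using that by (auto simp: curve_tangent_def DERIV_imp_deriv)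
  have sec: "(\<lambda>z. f z + g z) \<in> sections X U" "(\<lambda>z. f z * g z) \<in> sections X U" "(\<lambda>z. c * f z) \<in> sections X U"
    if "openin (ztop X) U" "f \<in> sections X U" "g \<in> sections X U" for U f g c
  proof -
    have fg: "f \<in> locrat N e U" "g \<in> locrat N e U" using that coordsD(2)[OF X that(1)] by auto
    show "(\<lambda>z. f z + g z) \<in> sections X U" unfolding coordsD(2)[OF X that(1)] by (rule locrat_add[OF fg])
    show "(\<lambda>z. f z * g z) \<in> sections X U" unfolding coordsD(2)[OF X that(1)] by (rule locrat_mult[OF fg])
    show "(\<lambda>z. c * f z) \<in> sections X U" unfolding coordsD(2)[OF X that(1)]
      by (rule locrat_mult[OF locrat_const fg(1)])
  qed
  show "curve_tangent X \<gamma> \<in> tangent_space X (\<gamma> 0)"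
    unfolding tangent_space_def mem_Collect_eq
  proof (intro conjI allI impI, goal_cases)
    case (1 U f)
    then show ?case by (auto simp: curve_tangent_def)
  next
    case (2 U V W f g)
    then have *: "openin (ztop X) U" "openin (ztop X) V" "openin (ztop X) W" "\<gamma> 0 \<in> W" "W \<subseteq> U \<inter> V"
      "f \<in> sections X U" "g \<in> sections X V" "\<And>z. z \<in> W \<Longrightarrow> f z = g z" by auto
    have "eventually (\<lambda>t. \<gamma> t \<in> W) (nhds 0)"
      by (rule section_along_curve(1)[OF X *(3,4) assms(2,3)])
    then have "eventually (\<lambda>t. g (\<gamma> t) = f (\<gamma> t)) (nhds 0)"
      by eventually_elim (simp add: *)
    from DERIV_cong_ev[OF refl this refl] der[of V g] *
    have "((\<lambda>t. f (\<gamma> t)) has_real_derivative curve_tangent X \<gamma> V g) (at 0)" by blast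
    then show ?case using eq[of U f] * by blast
  next
    case (3 U f g c)
    then show ?case using der[of U f] der[of U g] by (intro eq sec DERIV_add) auto
  next
    case (4 U f g c)
    then show ?case using der[of U f] by (intro eq sec(3)[where g=f] DERIV_cmult) auto
  next
    case (5 U f g c)
    then show ?case using DERIV_mult[OF der[of U f] der[of U g]]
      by (intro eq sec) (auto simp: algebra_simps)
  qed
qed

lemma coord_section:
  assumes "coords X N e" "j < N" shows "(\<lambda>z. e z j) \<in> sections X (points X)"
  using precoords_poly_section[OF coords_imp_precoords[OF assms(1)] polys.coord[OF assms(2)]] .

text \<open>
  Since sections are quotients of polynomials in the coordinates, a derivation and a curve that
  agree on the coordinates agree on all germs.  Surjectivity of a differential can therefore be
  checked on coordinates.
\<close>
lemma derivation_along_curve: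
  assumes X: "coords X N e" and D: "D \<in> tangent_space X (\<gamma> 0)" and y: "\<gamma> 0 \<in> points X"
    and g: "eventually (\<lambda>t. \<gamma> t \<in> points X) (nhds (0::real))"
    and d: "\<And>j. j < N \<Longrightarrow> ((\<lambda>t. e (\<gamma> t) j) has_real_derivative D (points X) (\<lambda>z. e z j)) (at 0)"
    and V: "openin (ztop X) V" "\<gamma> 0 \<in> V" "f \<in> sections X V"
  shows "((\<lambda>t. f (\<gamma> t)) has_real_derivative D V f) (at 0)"
proof -
  have f: "f \<in> locrat N e V" using V coordsD(2)[OF X] by blast
  obtain P Q where PQ: "P \<in> polys N" "Q \<in> polys N" "Q (e (\<gamma> 0)) \<noteq> 0"
    "\<And>z. z \<in> V \<Longrightarrow> Q (e z) \<noteq> 0 \<Longrightarrow> f z = P (e z) / Q (e z)" by (rule locratE[OF f V(2)]) (rule that)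
  define W where "W = V \<inter> {z \<in> points X. Q (e z) \<noteq> 0}"
  have "openin (ztop X) {z \<in> points X. Q (e z) \<noteq> 0}"
    using zopen_basic[OF PQ(2)] coordsD(1)[OF X] by blast
  then have W: "openin (ztop X) W" "\<gamma> 0 \<in> W" unfolding W_def using V y PQ by (auto intro: openin_Int)
  have dd: "\<exists>d. ((\<lambda>t. e (\<gamma> t) j) has_real_derivative d) (at 0)" if "j < N" for j
    using d[OF that] by blast
  have "((\<lambda>t. P (e (\<gamma> t)) / Q (e (\<gamma> t))) has_real_derivative D V f) (at 0)"
    by (rule derivation_quotient[OF X D openin_topspace y, where u=e and n=N and W=W])
       (use PQ V W d coord_section[OF X] openin_subset[OF V(1)] in \<open>auto simp: W_def\<close>)
  moreover have "eventually (\<lambda>t. \<gamma> t \<in> W) (nhds 0)"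
    by (rule section_along_curve(1)[OF X W g dd])
  then have "eventually (\<lambda>t. P (e (\<gamma> t)) / Q (e (\<gamma> t)) = f (\<gamma> t)) (nhds 0)"
    by eventually_elim (auto simp: W_def PQ)
  note DERIV_cong_ev[OF refl this refl]
  ultimately show ?thesis by blast
qed

lemma tangent_space_lincomb:
  assumes "\<And>i. i < (d::nat) \<Longrightarrow> B i \<in> tangent_space X y"
  shows "(\<lambda>U f. \<Sum>i<d. c i * B i U f) \<in> tangent_space X y"
  unfolding tangent_space_def mem_Collect_eq
proof (intro conjI allI impI, goal_cases)
  case (1 U f)
  then show ?case using tangent_spaceD(1)[OF assms] by simp
next
  case (2 U V W f g)
  then show ?case
    by (intro sum.cong refl arg_cong2[where f="(*)"] tangent_spaceD(2)[OF assms, of _ U V W f g]) auto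
next
  case (3 U f g k)
  then show ?case by (simp add: tangent_spaceD(3)[OF assms] distrib_left sum.distrib)
next
  case (4 U f g k)
  then show ?case by (simp add: tangent_spaceD(4)[OF assms] sum_distrib_left mult.left_commute)
next
  case (5 U f g k)
  then show ?case by (simp add: tangent_spaceD(5)[OF assms] sum_distrib_left sum.distrib distrib_left
        mult.left_commute)
qed

section \<open>Charts\<close>

text \<open>
  The padding by zeros makes the values points of \<open>Rn n\<close>.
\<close>
definition quot_map :: "nat \<Rightarrow> (nat \<Rightarrow> (nat \<Rightarrow> real) \<Rightarrow> real) \<Rightarrow> ((nat \<Rightarrow> real) \<Rightarrow> real) \<Rightarrow> (nat \<Rightarrow> real) \<Rightarrow> nat \<Rightarrow> real" where
  "quot_map n A b a = (\<lambda>i. if i < n then A i a / b a else 0)"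

text \<open>
  An isomorphism from an open subset of \<open>Y\<close> to the open subset \<open>c \<noteq> 0\<close> of \<open>\<real>\<^sup>n\<close>, in the form
  \<open>A / b\<close> with inverse \<open>psi\<close> of the form \<open>p / c\<close>.
\<close>
locale chart =
  fixes Y :: "'a rspace" and N :: nat and e :: "'a \<Rightarrow> nat \<Rightarrow> real" and n :: nat
    and A :: "nat \<Rightarrow> (nat \<Rightarrow> real) \<Rightarrow> real" and b :: "(nat \<Rightarrow> real) \<Rightarrow> real"
    and c :: "(nat \<Rightarrow> real) \<Rightarrow> real" and p :: "nat \<Rightarrow> (nat \<Rightarrow> real) \<Rightarrow> real"
    and psi :: "(nat \<Rightarrow> real) \<Rightarrow> 'a"
  assumes Y: "coords Y N e"
    and A: "\<And>i. i < n \<Longrightarrow> A i \<in> polys N" and b: "b \<in> polys N" and c: "c \<in> polys n"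
    and p: "\<And>j. j < N \<Longrightarrow> p j \<in> polys n"
    and psi_points: "\<And>x. x \<in> Rn n \<Longrightarrow> c x \<noteq> 0 \<Longrightarrow> psi x \<in> points Y"
    and psi_b: "\<And>x. x \<in> Rn n \<Longrightarrow> c x \<noteq> 0 \<Longrightarrow> b (e (psi x)) \<noteq> 0"
    and psi_coord: "\<And>x j. x \<in> Rn n \<Longrightarrow> c x \<noteq> 0 \<Longrightarrow> j < N \<Longrightarrow> e (psi x) j = p j x / c x"
    and phi_psi: "\<And>x. x \<in> Rn n \<Longrightarrow> c x \<noteq> 0 \<Longrightarrow> quot_map n A b (e (psi x)) = x"
    and psi_phi: "\<And>z. z \<in> points Y \<Longrightarrow> b (e z) \<noteq> 0 \<Longrightarrow> c (quot_map n A b (e z)) \<noteq> 0 \<Longrightarrow>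
          psi (quot_map n A b (e z)) = z"
begin

abbreviation phi :: "'a \<Rightarrow> nat \<Rightarrow> real" where "phi z \<equiv> quot_map n A b (e z)"

definition chart_domain :: "'a set" where
  "chart_domain = {z \<in> points Y. b (e z) \<noteq> 0 \<and> c (phi z) \<noteq> 0}"

lemma phi_Rn: "phi z \<in> Rn n" by (simp add: Rn_def quot_map_def)

end

text \<open>
  Near \<open>y\<close> the isomorphism and its inverse are quotients with common denominators \<open>b\<^sub>0\<close> and \<open>c\<^sub>0\<close>.
  The open sets are shrunk by enlarging these denominators: \<open>b\<close> so that \<open>b \<noteq> 0\<close> implies
  membership in \<open>U\<close>, then \<open>c\<close> so that \<open>c \<noteq> 0\<close> implies membership in \<open>W\<close> and \<open>b \<noteq> 0\<close> at the image
  under the inverse.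
\<close>
lemma chart_exists:
  assumes Y: "coords Y N e" and U: "openin (ztop Y) U" "y \<in> U"
    and W: "openin (ztop (affine_space n)) W"
    and iso: "isomorphic (induced Y U) (induced (affine_space n) W)"
  shows "\<exists>A b c p psi. chart Y N e n A b c p psi \<and> y \<in> chart.chart_domain Y e n A b c"
proof -
  let ?Y = "induced Y U" and ?Z = "induced (affine_space n) W"
  have cY: "coords ?Y N e" by (rule coords_induced[OF coords_imp_precoords[OF Y]])
  have cZ: "coords ?Z n (\<lambda>x. x)" by (rule coords_induced[OF precoords_affine])
  have UY: "U \<subseteq> points Y" by (rule openin_subset[OF U(1)])
  have WR: "W \<subseteq> Rn n" using openin_subset[OF W] by simp
  have pY: "points ?Y = U" and pZ: "points ?Z = W" using UY WR by auto
  obtain f g where f: "regular_map ?Y ?Z f" and g: "regular_map ?Z ?Y g"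
    and gf: "\<And>x. x \<in> U \<Longrightarrow> g (f x) = x" and fg: "\<And>y. y \<in> W \<Longrightarrow> f (g y) = y"
    using iso unfolding isomorphic_def biregular_def pY pZ by blast
  have fW: "f z \<in> W" if "z \<in> U" for z
    using f that unfolding regular_map_def continuous_map_def pY pZ by auto
  have gU: "g x \<in> U" if "x \<in> W" for x
    using g that unfolding regular_map_def continuous_map_def pY pZ by auto
  have f_coord: "(\<lambda>z. f z i) \<in> locrat N e U" if "i < n" for i
  proof -
    have "(\<lambda>x. x i) \<in> sections ?Z W" using coord_section[OF cZ that] unfolding pZ .
    then have "(\<lambda>x. x i) \<circ> f \<in> sections ?Y {z \<in> U. f z \<in> W}"
      using f openin_topspace[of "ztop ?Z"] unfolding regular_map_def pY pZ by blast
    moreover have "{z \<in> U. f z \<in> W} = U" using fW by blast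
    ultimately show ?thesis using coordsD(2)[OF cY] openin_topspace[of "ztop ?Y"] unfolding pY
      by (simp add: o_def)
  qed
  have g_coord: "(\<lambda>x. e (g x) j) \<in> locrat n (\<lambda>x. x) W" if "j < N" for j
  proof -
    have "(\<lambda>x. e x j) \<in> sections ?Y U" using coord_section[OF cY that] unfolding pY .
    then have "(\<lambda>x. e x j) \<circ> g \<in> sections ?Z {z \<in> W. g z \<in> U}"
      using g openin_topspace[of "ztop ?Y"] unfolding regular_map_def pY pZ by blast
    moreover have "{z \<in> W. g z \<in> U} = W" using gU by blast
    ultimately show ?thesis using coordsD(2)[OF cZ] openin_topspace[of "ztop ?Z"] unfolding pZ
      by (simp add: o_def)
  qed
  obtain r where r: "r \<in> polys N" "r (e y) \<noteq> 0" "\<And>z. z \<in> points Y \<Longrightarrow> r (e z) \<noteq> 0 \<Longrightarrow> z \<in> U"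
    by (rule zopenE[of "points Y" N e U y]) (use U coordsD(1)[OF Y] in auto)
  obtain A0 b0 where A0: "\<forall>i<n. A0 i \<in> polys N" "b0 \<in> polys N" "b0 (e y) \<noteq> 0"
    "\<forall>i<n. \<forall>z\<in>U. b0 (e z) \<noteq> 0 \<longrightarrow> f z i = A0 i (e z) / b0 (e z)"
    using locrat_common_denominator[of n "\<lambda>i z. f z i" N e U, OF f_coord U(2)] by blast
  define A where "A i = (\<lambda>x. A0 i x * r x)" for i
  define b where "b = (\<lambda>x. b0 x * r x)"
  have fphi: "f z = quot_map n A b (e z)" if z: "z \<in> points Y" "b (e z) \<noteq> 0" for z
  proof
    fix i
    have "z \<in> U" using r(3) z by (simp add: b_def)
    moreover have "f z \<in> Rn n" using fW[OF \<open>z \<in> U\<close>] WR by blast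
    ultimately show "f z i = quot_map n A b (e z) i"
      using A0(4) z(2) by (auto simp: quot_map_def Rn_def A_def b_def)
  qed
  have bg: "(\<lambda>x. b (e (g x))) \<in> locrat n (\<lambda>x. x) W"
    by (rule locrat_poly_subst[of b N]) (use A0 r in \<open>auto simp: b_def intro: polys.mult g_coord\<close>)
  have x0: "f y \<in> W" by (rule fW[OF U(2)])
  have "b (e (g (f y))) \<noteq> 0" using gf[OF U(2)] A0 r by (simp add: b_def)
  then obtain s where s: "s \<in> polys n" "s (f y) \<noteq> 0" "\<And>x. x \<in> W \<Longrightarrow> s x \<noteq> 0 \<Longrightarrow> b (e (g x)) \<noteq> 0"
    by (rule locrat_nonzero_near[OF bg x0]) (rule that)
  have zW: "zopen (Rn n) n (\<lambda>x. x) W" using precoordsD(1)[OF precoords_affine] W by simp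
  obtain w where w: "w \<in> polys n" "w (f y) \<noteq> 0" "\<And>x. x \<in> Rn n \<Longrightarrow> w x \<noteq> 0 \<Longrightarrow> x \<in> W"
    by (rule zopenE[OF zW x0]) (rule that)
  obtain p0 c0 where p0: "\<forall>j<N. p0 j \<in> polys n" "c0 \<in> polys n" "c0 (f y) \<noteq> 0"
    "\<forall>j<N. \<forall>x\<in>W. c0 x \<noteq> 0 \<longrightarrow> e (g x) j = p0 j x / c0 x"
    using locrat_common_denominator[of N "\<lambda>j x. e (g x) j" n "\<lambda>x. x" W, OF g_coord x0] by blast
  define p where "p j = (\<lambda>x. p0 j x * (s x * w x))" for j
  define c where "c = (\<lambda>x. c0 x * (s x * w x))"
  have b': "b \<in> polys N" "b (e y) \<noteq> 0" using A0 r by (auto simp: b_def intro: polys.mult)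
  have cW: "x \<in> W" if "x \<in> Rn n" "c x \<noteq> 0" for x using w(3) that by (simp add: c_def)
  have ch: "chart Y N e n A b c p g"
  proof
    fix z assume z: "z \<in> points Y" "b (e z) \<noteq> 0"
    then have "z \<in> U" using r(3) by (simp add: b_def)
    then show "g (quot_map n A b (e z)) = z" using fphi[OF z] gf[of z] by simp
  next
    fix x assume x: "x \<in> Rn n" "c x \<noteq> 0"
    note xW = cW[OF x]
    show 1: "g x \<in> points Y" using gU[OF xW] UY by blast
    show 2: "b (e (g x)) \<noteq> 0" using s(3) xW x by (simp add: c_def)
    show "quot_map n A b (e (g x)) = x" using fphi[OF 1 2] fg[OF xW] by simp
    show "e (g x) j = p j x / c x" if "j < N" for j
      using p0(4) that xW x(2) by (auto simp: c_def p_def)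
  qed (use Y A0 r b' s w p0 in \<open>auto simp: A_def c_def p_def intro!: polys.mult\<close>)
  have yY: "y \<in> points Y" using U UY by auto
  have "c (quot_map n A b (e y)) \<noteq> 0"
    using fphi[OF yY b'(2)] p0(3) s(2) w(2) by (simp add: c_def)
  then have "y \<in> chart.chart_domain Y e n A b c"
    unfolding chart.chart_domain_def[OF ch] using yY b' by simp
  with ch show ?thesis by blast
qed

context chart begin

lemma phi_section: "i < n \<Longrightarrow> (\<lambda>z. phi z i) \<in> sections Y {z \<in> points Y. b (e z) \<noteq> 0}"
  using precoordsD(3)[OF coords_imp_precoords[OF Y] A b] by (simp add: quot_map_def)

lemma open_b: "openin (ztop Y) {z \<in> points Y. b (e z) \<noteq> 0}"
  using zopen_basic[OF b] coordsD(1)[OF Y] by blast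

lemma open_domain: "openin (ztop Y) chart_domain"
proof -
  let ?V = "{z \<in> points Y. b (e z) \<noteq> 0}"
  have phi: "(\<lambda>z. phi z i) \<in> locrat N e ?V" if "i < n" for i
    using phi_section[OF that] coordsD(2)[OF Y open_b] by blast
  have cphi: "(\<lambda>z. c (phi z)) \<in> locrat N e ?V" by (rule locrat_poly_subst[OF c phi])
  have "zopen (points Y) N e chart_domain"
    unfolding zopen_def
  proof (intro conjI ballI)
    fix z assume z: "z \<in> chart_domain"
    then have "z \<in> ?V" "c (phi z) \<noteq> 0" by (auto simp: chart_domain_def)
    then obtain q where "q \<in> polys N" "q (e z) \<noteq> 0" "\<And>z. z \<in> ?V \<Longrightarrow> q (e z) \<noteq> 0 \<Longrightarrow> c (phi z) \<noteq> 0"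
      by (rule locrat_nonzero_near[OF cphi]) (rule that)
    then show "\<exists>p\<in>polys N. p (e z) \<noteq> 0 \<and> (\<forall>z\<in>points Y. p (e z) \<noteq> 0 \<longrightarrow> z \<in> chart_domain)"
      using z b by (intro bexI[of _ "\<lambda>x. q x * b x"]) (auto simp: chart_domain_def intro: polys.mult)
  qed (auto simp: chart_domain_def)
  then show ?thesis using coordsD(1)[OF Y] by blast
qed

lemma curve_in_chart:
  assumes x: "\<And>t. x t \<in> Rn n" "c (x 0) \<noteq> 0"
    and d: "\<And>i. i < n \<Longrightarrow> \<exists>d. ((\<lambda>t. x t i) has_real_derivative d) (at 0)"
  shows "eventually (\<lambda>t. c (x t) \<noteq> 0) (nhds 0)"
    and "eventually (\<lambda>t. psi (x t) \<in> points Y) (nhds 0)"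
    and "\<And>j. j < N \<Longrightarrow> ((\<lambda>t. e (psi (x t)) j) has_real_derivative d') (at 0) \<longleftrightarrow>
           ((\<lambda>t. p j (x t) / c (x t)) has_real_derivative d') (at 0)"
    and "\<And>j. j < N \<Longrightarrow> \<exists>d. ((\<lambda>t. e (psi (x t)) j) has_real_derivative d) (at 0)"
proof -
  obtain dc where dc: "((\<lambda>t. c (x t)) has_real_derivative dc) (at 0)"
    using poly_along_curve[OF c, of x] d by blast
  show ev: "eventually (\<lambda>t. c (x t) \<noteq> 0) (nhds 0)"
    by (rule DERIV_eventually_nonzero[OF dc x(2)])
  then show "eventually (\<lambda>t. psi (x t) \<in> points Y) (nhds 0)"
    by eventually_elim (rule psi_points[OF x(1)])
  have iff: "((\<lambda>t. e (psi (x t)) j) has_real_derivative d') (at 0) \<longleftrightarrow>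
           ((\<lambda>t. p j (x t) / c (x t)) has_real_derivative d') (at 0)" if "j < N" for j d'
    using ev by (intro DERIV_cong_ev refl, eventually_elim) (simp add: psi_coord x that)
  then show "\<And>j. j < N \<Longrightarrow> ((\<lambda>t. e (psi (x t)) j) has_real_derivative d') (at 0) \<longleftrightarrow>
           ((\<lambda>t. p j (x t) / c (x t)) has_real_derivative d') (at 0)" .
  show "\<exists>d. ((\<lambda>t. e (psi (x t)) j) has_real_derivative d) (at 0)" if j: "j < N" for j
  proof -
    obtain dp where dp: "((\<lambda>t. p j (x t)) has_real_derivative dp) (at 0)"
      using poly_along_curve[OF p[OF j], of x] d by blast
    from DERIV_divide[OF dp dc x(2)] show ?thesis using iff[OF j] by blast
  qed
qed

text \<open>
  On the chart the coordinates of \<open>Y\<close> are the quotients \<open>p j / c\<close> of the functions \<open>phi\<close>, so a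
  derivation is already determined by its values on \<open>phi\<close>, the velocity of the curve \<open>x\<close>.
\<close>

lemma derivation_in_chart:
  assumes y: "y \<in> chart_domain" and D: "D \<in> tangent_space Y y"
    and x: "\<And>t. x t \<in> Rn n" "x 0 = phi y"
    and d: "\<And>i. i < n \<Longrightarrow> ((\<lambda>t. x t i) has_real_derivative
            D {z \<in> points Y. b (e z) \<noteq> 0} (\<lambda>z. phi z i)) (at 0)"
  shows "j < N \<Longrightarrow> ((\<lambda>t. e (psi (x t)) j) has_real_derivative D (points Y) (\<lambda>z. e z j)) (at 0)"
    and "openin (ztop Y) V \<Longrightarrow> y \<in> V \<Longrightarrow> f \<in> sections Y V \<Longrightarrow>
          ((\<lambda>t. f (psi (x t))) has_real_derivative D V f) (at 0)"
proof -
  let ?V = "{z \<in> points Y. b (e z) \<noteq> 0}"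
  have y': "y \<in> points Y" "b (e y) \<noteq> 0" "c (phi y) \<noteq> 0" "y \<in> ?V" using y by (auto simp: chart_domain_def)
  have psi0: "psi (x 0) = y" using psi_phi y' x by simp
  have dd: "\<exists>d. ((\<lambda>t. x t i) has_real_derivative d) (at 0)" if "i < n" for i using d[OF that] by blast
  have c0: "c (x 0) \<noteq> 0" using x y' by simp
  show ej: "((\<lambda>t. e (psi (x t)) j) has_real_derivative D (points Y) (\<lambda>z. e z j)) (at 0)" if j: "j < N" for j
  proof -
    have "((\<lambda>t. p j (x t) / c (x t)) has_real_derivative D (points Y) (\<lambda>z. e z j)) (at 0)"
    proof (rule derivation_quotient[OF Y D open_b y'(4), where u=phi and n=n and W=chart_domain])
      fix z assume "z \<in> chart_domain"
      then have z: "z \<in> points Y" "b (e z) \<noteq> 0" "c (phi z) \<noteq> 0" by (auto simp: chart_domain_def)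
      then show "c (phi z) * e z j = p j (phi z)"
        using psi_coord[OF phi_Rn z(3) j] psi_phi[OF z] by simp
    qed (use phi_section d x c p[OF j] y y' open_domain coord_section[OF Y j] in \<open>auto simp: chart_domain_def\<close>)
    then show ?thesis using curve_in_chart(3)[OF x(1) c0 dd j] by blast
  qed
  assume V: "openin (ztop Y) V" "y \<in> V" "f \<in> sections Y V"
  show "((\<lambda>t. f (psi (x t))) has_real_derivative D V f) (at 0)"
    by (rule derivation_along_curve[OF Y, where \<gamma>="\<lambda>t. psi (x t)"])
       (use D psi0 y' V ej curve_in_chart(2)[OF x(1) c0 dd] in auto)
qed

text \<open>
  Both derivations are differentiation along the image of the same straight line.
\<close>
lemma derivation_determined:
  assumes y: "y \<in> chart_domain" and D: "D \<in> tangent_space Y y" "D' \<in> tangent_space Y y"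
    and eq: "\<And>i. i < n \<Longrightarrow> D {z \<in> points Y. b (e z) \<noteq> 0} (\<lambda>z. phi z i) =
                              D' {z \<in> points Y. b (e z) \<noteq> 0} (\<lambda>z. phi z i)"
  shows "D = D'"
proof (intro ext)
  fix V f
  let ?d = "\<lambda>i. if i < n then D {z \<in> points Y. b (e z) \<noteq> 0} (\<lambda>z. phi z i) else 0"
  define x where "x t = (\<lambda>i. phi y i + t * ?d i)" for t
  have x: "x t \<in> Rn n" "x 0 = phi y" for t using phi_Rn[of y] by (auto simp: x_def Rn_def)
  have d: "((\<lambda>t. x t i) has_real_derivative ?d i) (at 0)" for i
    unfolding x_def by (auto intro!: derivative_eq_intros)
  have d1: "((\<lambda>t. x t i) has_real_derivative D {z \<in> points Y. b (e z) \<noteq> 0} (\<lambda>z. phi z i)) (at 0)" if "i < n" for i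
    using d[of i] that by simp
  show "D V f = D' V f"
  proof (cases "openin (ztop Y) V \<and> y \<in> V \<and> f \<in> sections Y V")
    case True
    then have V: "openin (ztop Y) V" "y \<in> V" "f \<in> sections Y V" by auto
    from derivation_in_chart(2)[where x=x, OF y D(1) x d1 V]
    have "((\<lambda>t. f (psi (x t))) has_real_derivative D V f) (at 0)" by simp
    moreover have "((\<lambda>t. f (psi (x t))) has_real_derivative D' V f) (at 0)"
      by (rule derivation_in_chart(2)[where x=x, OF y D(2) x _ V]) (use d1 eq in auto)
    ultimately show ?thesis by (rule DERIV_unique)
  next
    case False
    then show ?thesis using tangent_spaceD(1)[OF D(1)] tangent_spaceD(1)[OF D(2)] by simp
  qed
qed

text \<open>
  The basis consists of the tangent vectors of the coordinate lines through \<open>phi y\<close>; it is dual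
  to the functions \<open>phi z i\<close>, by which every derivation is determined.
\<close>
lemma tangent_dim:
  assumes y: "y \<in> chart_domain"
  shows "tangent_dim_eq Y y n"
proof -
  let ?V = "{z \<in> points Y. b (e z) \<noteq> 0}"
  have y': "y \<in> points Y" "b (e y) \<noteq> 0" "c (phi y) \<noteq> 0" "y \<in> ?V" using y by (auto simp: chart_domain_def)
  define x where "x i t = (\<lambda>k. phi y k + (if k = i then t else 0))" for i and t :: real
  define B where "B i = curve_tangent Y (\<lambda>t. psi (x i t))" for i
  have x: "x i t \<in> Rn n" if "i < n" for i t using that phi_Rn[of y] by (auto simp: x_def Rn_def)
  have x0: "x i 0 = phi y" for i by (auto simp: x_def)
  have dx: "((\<lambda>t. x i t k) has_real_derivative (if k = i then 1 else 0)) (at 0)" for i k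
    unfolding x_def by (auto intro!: derivative_eq_intros)
  have cur: "c (x i 0) \<noteq> 0" "\<exists>d. ((\<lambda>t. x i t k) has_real_derivative d) (at 0)" for i k
    using y'(3) x0 dx[of i k] by (simp, blast)
  have psi0: "psi (x i 0) = y" for i using psi_phi y' x0 by simp
  note ct = curve_tangent[OF Y curve_in_chart(2)[OF x cur] curve_in_chart(4)[OF x cur], folded B_def, unfolded psi0]
  have B: "B i \<in> tangent_space Y y" if "i < n" for i
    using ct(2)[of i] that by blast
  have Bphi: "B i ?V (\<lambda>z. phi z k) = (if k = i then 1 else 0)" if ik: "i < n" "k < n" for i k
  proof -
    have "((\<lambda>t. phi (psi (x i t)) k) has_real_derivative B i ?V (\<lambda>z. phi z k)) (at 0)"
      using ct(1)[of i ?V "\<lambda>z. phi z k"] ik open_b y' phi_section by blast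
    moreover have "((\<lambda>t. phi (psi (x i t)) k) has_real_derivative (if k = i then 1 else 0)) (at 0)
        \<longleftrightarrow> ((\<lambda>t. x i t k) has_real_derivative (if k = i then 1 else 0)) (at 0)"
      using curve_in_chart(1)[OF x[OF ik(1)] cur]
      by (intro DERIV_cong_ev refl, eventually_elim) (simp add: phi_psi x[OF ik(1)])
    ultimately show ?thesis using dx DERIV_unique by blast
  qed
  have val: "(\<Sum>i<n. co i * B i ?V (\<lambda>z. phi z k)) = co k" if "k < n" for co k
  proof -
    have "(\<Sum>i<n. co i * B i ?V (\<lambda>z. phi z k)) = (\<Sum>i<n. if i = k then co i else 0)"
      by (intro sum.cong refl) (use Bphi that in auto)
    then show ?thesis using that by simp
  qed
  have "\<exists>!co. co \<in> Rn n \<and> D = (\<lambda>U f. \<Sum>i<n. co i * B i U f)" if D: "D \<in> tangent_space Y y" for D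
  proof
    let ?c = "\<lambda>i. if i < n then D ?V (\<lambda>z. phi z i) else 0"
    have "D = (\<lambda>U f. \<Sum>i<n. ?c i * B i U f)"
      by (rule derivation_determined[OF y D tangent_space_lincomb[OF B]]) (simp_all add: val)
    then show "?c \<in> Rn n \<and> D = (\<lambda>U f. \<Sum>i<n. ?c i * B i U f)" by (auto simp: Rn_def)
    show "co = ?c" if "co \<in> Rn n \<and> D = (\<lambda>U f. \<Sum>i<n. co i * B i U f)" for co
    proof
      fix k
      from that have "D ?V (\<lambda>z. phi z k) = (\<Sum>i<n. co i * B i ?V (\<lambda>z. phi z k))" by blast
      then show "co k = ?c k" using val[of k co] that by (auto simp: Rn_def)
    qed
  qed
  with B show ?thesis unfolding tangent_dim_eq_def by blast
qed

end

section \<open>Dimension\<close>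

lemma poly_on_line:
  assumes "Q \<in> polys n"
  shows "\<exists>q :: real poly. \<forall>t. Q (\<lambda>i. x i + t * v i) = poly q t"
  using assms
proof (induction rule: polys.induct)
  case (const c)
  show ?case by (rule exI[of _ "[:c:]"]) simp
next
  case (coord i)
  show ?case by (rule exI[of _ "[:x i, v i:]"]) simp
next
  case (add p q)
  then obtain p' q' where "\<forall>t. p (\<lambda>i. x i + t * v i) = poly p' t" "\<forall>t. q (\<lambda>i. x i + t * v i) = poly q' t"
    by blast
  then show ?case by (intro exI[of _ "p' + q'"]) simp
next
  case (mult p q)
  then obtain p' q' where "\<forall>t. p (\<lambda>i. x i + t * v i) = poly p' t" "\<forall>t. q (\<lambda>i. x i + t * v i) = poly q' t"
    by blast
  then show ?case by (intro exI[of _ "p' * q'"]) simp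
qed

text \<open>
  Restricted to a line both functions are polynomials in one variable, which have finitely many
  zeros.  Applied to the line through two points this gives irreducibility of affine subspaces; that \<open>t\<close>
  is nonzero gives a point of the line other than \<open>x\<close>.
\<close>
lemma polys_nonzero_on_line:
  assumes Q: "Q \<in> polys n" "Q' \<in> polys n"
    and s: "Q (\<lambda>i. x i + s * v i) \<noteq> 0" and s': "Q' (\<lambda>i. x i + s' * v i) \<noteq> 0"
  shows "\<exists>t. t \<noteq> 0 \<and> Q (\<lambda>i. x i + t * v i) \<noteq> 0 \<and> Q' (\<lambda>i. x i + t * v i) \<noteq> 0"
proof -
  obtain q where q: "\<And>t. Q (\<lambda>i. x i + t * v i) = poly q t" using poly_on_line[OF Q(1)] by blast
  obtain q' where q': "\<And>t. Q' (\<lambda>i. x i + t * v i) = poly q' t" using poly_on_line[OF Q(2)] by blast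
  have "q \<noteq> 0" "q' \<noteq> 0" using s s' q q' by auto
  then have "[:0, 1:] * (q * q') \<noteq> 0" by simp
  then have "finite {t. poly ([:0, 1:] * (q * q')) t = 0}" by (rule poly_roots_finite)
  then obtain t where "poly ([:0, 1:] * (q * q')) t \<noteq> 0"
    using infinite_UNIV_char_0[where 'a=real] by (metis (mono_tags, lifting) UNIV_eq_I mem_Collect_eq)
  then show ?thesis by (intro exI[of _ t]) (simp add: q q')
qed

lemma polys_nonzero_on_affine_subspace:
  assumes S: "\<And>x y t. x \<in> S \<Longrightarrow> y \<in> S \<Longrightarrow> (\<lambda>i. x i + t * (y i - x i)) \<in> S"
    and Q: "Q \<in> polys n" "Q' \<in> polys n" and x: "x \<in> S" "Q x \<noteq> 0" and y: "y \<in> S" "Q' y \<noteq> 0"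
  shows "\<exists>z\<in>S. Q z \<noteq> 0 \<and> Q' z \<noteq> 0"
proof -
  obtain t where "Q (\<lambda>i. x i + t * (y i - x i)) \<noteq> 0" "Q' (\<lambda>i. x i + t * (y i - x i)) \<noteq> 0"
    using polys_nonzero_on_line[OF Q, of x 0 "\<lambda>i. y i - x i" 1] x y by auto
  then show ?thesis using S[OF x(1) y(1)] by blast
qed

context chart begin

text \<open>
  On the chart, regular functions become polynomials up to a power of \<open>c\<close>, so their zeros can be
  studied on lines.
\<close>
lemma pullback_clear_denominator:
  assumes "P \<in> polys N"
  shows "\<exists>k. \<exists>Q\<in>polys n. \<forall>x\<in>Rn n. c x \<noteq> 0 \<longrightarrow> Q x = c x ^ k * P (e (psi x))"
  using assms
proof (induction rule: polys.induct)
  case (const a)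
  show ?case by (intro exI[of _ 0] bexI[of _ "\<lambda>x. a"]) (auto intro: polys.const)
next
  case (coord j)
  show ?case by (intro exI[of _ 1] bexI[of _ "p j"]) (use coord psi_coord p in auto)
next
  case (add P P')
  then obtain k Q k' Q' where 1: "Q \<in> polys n" "\<forall>x\<in>Rn n. c x \<noteq> 0 \<longrightarrow> Q x = c x ^ k * P (e (psi x))"
    "Q' \<in> polys n" "\<forall>x\<in>Rn n. c x \<noteq> 0 \<longrightarrow> Q' x = c x ^ k' * P' (e (psi x))" by blast
  show ?case
    by (rule exI[of _ "k + k'"], rule bexI[of _ "\<lambda>x. Q x * c x ^ k' + Q' x * c x ^ k"])
       (use 1 c in \<open>auto intro!: polys.intros polys_power simp: power_add algebra_simps\<close>)
next
  case (mult P P')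
  then obtain k Q k' Q' where 1: "Q \<in> polys n" "\<forall>x\<in>Rn n. c x \<noteq> 0 \<longrightarrow> Q x = c x ^ k * P (e (psi x))"
    "Q' \<in> polys n" "\<forall>x\<in>Rn n. c x \<noteq> 0 \<longrightarrow> Q' x = c x ^ k' * P' (e (psi x))" by blast
  show ?case
    by (rule exI[of _ "k + k'"], rule bexI[of _ "\<lambda>x. Q x * Q' x"])
       (use 1 c in \<open>auto intro!: polys.intros simp: power_add algebra_simps\<close>)
qed

text \<open>
  The chain consists of the closures in \<open>U\<close> of the parts of \<open>psi (S i)\<close> in \<open>U\<close>, where \<open>S i\<close> is the affine subspace of
  the points that agree with \<open>phi y\<close> in the entries from \<open>i\<close> on.  Such a closure is irreducible
  because two polynomials that are both nonzero somewhere on \<open>S i\<close> are nonzero at a common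
  point.  The inclusions are strict because \<open>A i - phi y i * b\<close> vanishes on the image of \<open>S i\<close>
  but not on that of \<open>S (Suc i)\<close>.
\<close>
lemma krull_dim_ge:
  assumes y: "y \<in> chart_domain" and U: "openin (ztop Y) U" "y \<in> U"
  shows "enat n \<le> krull_dim (subtopology (ztop Y) U)"
proof -
  have y': "y \<in> points Y" "b (e y) \<noteq> 0" "c (phi y) \<noteq> 0" using y by (auto simp: chart_domain_def)
  have UP: "U \<subseteq> points Y" by (rule openin_subset[OF U(1)])
  have zU: "zopen (points Y) N e U" using U coordsD(1)[OF Y] by blast
  obtain r where r: "r \<in> polys N" "r (e y) \<noteq> 0" "\<And>z. z \<in> points Y \<Longrightarrow> r (e z) \<noteq> 0 \<Longrightarrow> z \<in> U"
    by (rule zopenE[OF zU U(2)]) (rule that)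
  obtain k R where R: "R \<in> polys n" "\<And>x. x \<in> Rn n \<Longrightarrow> c x \<noteq> 0 \<Longrightarrow> R x = c x ^ k * r (e (psi x))"
    using pullback_clear_denominator[OF r(1)] by blast
  define cR where "cR = (\<lambda>x. c x * R x)"
  have cR: "cR \<in> polys n" unfolding cR_def by (intro polys.mult c R)
  have cRD: "c x \<noteq> 0" "psi x \<in> U" if "x \<in> Rn n" "cR x \<noteq> 0" for x
  proof -
    show "c x \<noteq> 0" using that by (simp add: cR_def)
    then show "psi x \<in> U" using that R(2)[of x] psi_points[of x] r(3)[of "psi x"] by (auto simp: cR_def)
  qed
  have cRy: "cR (phi y) \<noteq> 0" using y' R(2)[OF phi_Rn, of y] r(2) psi_phi by (simp add: cR_def)
  \<comment> \<open>the Zariski closure in \<open>U\<close> of the image of \<open>S\<close>\<close>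
  define C where "C S = {z \<in> U. \<forall>P\<in>polys N. (\<forall>x\<in>S. cR x \<noteq> 0 \<longrightarrow> P (e (psi x)) = 0) \<longrightarrow> P (e z) = 0}" for S
  have psiC: "psi x \<in> C S" if "x \<in> S" "S \<subseteq> Rn n" "cR x \<noteq> 0" for x S
    unfolding C_def using that cRD(2) by blast
  have top: "topspace (subtopology (ztop Y) U) = U" using UP by auto
  have opU: "openin (subtopology (ztop Y) U) V \<longleftrightarrow> zopen (points Y) N e V \<and> V \<subseteq> U" for V
    using openin_open_subtopology[OF U(1)] coordsD(1)[OF Y] by blast
  have closed: "closedin (subtopology (ztop Y) U) (C S)" for S
    unfolding closedin_def top opU
  proof (intro conjI)
    show "zopen (points Y) N e (U - C S)"
      unfolding zopen_def
    proof (intro conjI ballI)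
      fix z assume z: "z \<in> U - C S"
      then obtain P where P: "P \<in> polys N" "\<And>x. x \<in> S \<Longrightarrow> cR x \<noteq> 0 \<Longrightarrow> P (e (psi x)) = 0" "P (e z) \<noteq> 0"
        unfolding C_def by blast
      have "z \<in> U" using z by simp
      then obtain q where q: "q \<in> polys N" "q (e z) \<noteq> 0" "\<And>z. z \<in> points Y \<Longrightarrow> q (e z) \<noteq> 0 \<Longrightarrow> z \<in> U"
        by (rule zopenE[OF zU]) (rule that)
      have "w \<in> U - C S" if "w \<in> points Y" "P (e w) * q (e w) \<noteq> 0" for w
      proof -
        have "w \<in> U" using q(3) that by auto
        moreover have "w \<notin> C S" using P(1,2) that(2) unfolding C_def by auto
        ultimately show ?thesis by simp
      qed
      then show "\<exists>p\<in>polys N. p (e z) \<noteq> 0 \<and> (\<forall>w\<in>points Y. p (e w) \<noteq> 0 \<longrightarrow> w \<in> U - C S)"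
        using P(1,3) q(1,2) by (intro bexI[of _ "\<lambda>x. P x * q x"]) (auto intro: polys.mult)
    qed (use UP in auto)
  qed (auto simp: C_def)
  have irr: "irreducible_set (subtopology (ztop Y) U) (C S)"
    if SR: "S \<subseteq> Rn n" and Sy: "phi y \<in> S"
      and aff: "\<And>x y t. x \<in> S \<Longrightarrow> y \<in> S \<Longrightarrow> (\<lambda>i. x i + t * (y i - x i)) \<in> S" for S
    unfolding irreducible_set_def top
  proof (intro conjI allI impI)
    show "C S \<subseteq> U" by (auto simp: C_def)
    show "C S \<noteq> {}" using psiC[OF Sy SR cRy] by auto
    fix F G
    assume FG: "closedin (subtopology (ztop Y) U) F \<and> closedin (subtopology (ztop Y) U) G \<and> C S \<subseteq> F \<union> G"
    have near: "\<exists>P\<in>polys N. (\<forall>w\<in>points Y. P (e w) \<noteq> 0 \<longrightarrow> w \<in> U - F) \<and> (\<exists>x\<in>S. cR x \<noteq> 0 \<and> P (e (psi x)) \<noteq> 0)"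
      if F: "closedin (subtopology (ztop Y) U) F" and z: "z \<in> C S" "z \<notin> F" for z F
    proof -
      have "zopen (points Y) N e (U - F)" using F unfolding closedin_def top opU by blast
      moreover have "z \<in> U - F" using z by (simp add: C_def)
      ultimately obtain P where P: "P \<in> polys N" "P (e z) \<noteq> 0" "\<And>w. w \<in> points Y \<Longrightarrow> P (e w) \<noteq> 0 \<Longrightarrow> w \<in> U - F"
        by (rule zopenE) (rule that)
      then show ?thesis using z(1) unfolding C_def by blast
    qed
    show "C S \<subseteq> F \<or> C S \<subseteq> G"
    proof (rule ccontr)
      assume "\<not> (C S \<subseteq> F \<or> C S \<subseteq> G)"
      then obtain z z' where z: "z \<in> C S" "z \<notin> F" "z' \<in> C S" "z' \<notin> G" by blast
      have "closedin (subtopology (ztop Y) U) F" "closedin (subtopology (ztop Y) U) G" using FG by auto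
      note nF = near[OF this(1) z(1,2)] and nG = near[OF this(2) z(3,4)]
      obtain P x where P: "P \<in> polys N" "\<And>w. w \<in> points Y \<Longrightarrow> P (e w) \<noteq> 0 \<Longrightarrow> w \<in> U - F"
        "x \<in> S" "cR x \<noteq> 0" "P (e (psi x)) \<noteq> 0"
        using nF by (elim bexE conjE) (rule that, assumption, drule (1) bspec, erule (1) mp, assumption+)
      obtain P' x' where P': "P' \<in> polys N" "\<And>w. w \<in> points Y \<Longrightarrow> P' (e w) \<noteq> 0 \<Longrightarrow> w \<in> U - G"
        "x' \<in> S" "cR x' \<noteq> 0" "P' (e (psi x')) \<noteq> 0"
        using nG by (elim bexE conjE) (rule that, assumption, drule (1) bspec, erule (1) mp, assumption+)
      obtain k Q where Q: "Q \<in> polys n" "\<And>x. x \<in> Rn n \<Longrightarrow> c x \<noteq> 0 \<Longrightarrow> Q x = c x ^ k * P (e (psi x))"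
        using pullback_clear_denominator[OF P(1)] by blast
      obtain k' Q' where Q': "Q' \<in> polys n" "\<And>x. x \<in> Rn n \<Longrightarrow> c x \<noteq> 0 \<Longrightarrow> Q' x = c x ^ k' * P' (e (psi x))"
        using pullback_clear_denominator[OF P'(1)] by blast
      have "Q x * cR x \<noteq> 0" using P Q(2)[of x] SR cRD(1)[of x] by auto
      moreover have "Q' x' * cR x' \<noteq> 0" using P' Q'(2)[of x'] SR cRD(1)[of x'] by auto
      ultimately obtain w where w: "w \<in> S" "Q w * cR w \<noteq> 0" "Q' w * cR w \<noteq> 0"
        using polys_nonzero_on_affine_subspace[OF aff polys.mult[OF Q(1) cR] polys.mult[OF Q'(1) cR], of x x']
          P(3) P'(3) by blast
      have wR: "w \<in> Rn n" "cR w \<noteq> 0" "c w \<noteq> 0" using w SR cRD(1)[of w] by auto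
      have "psi w \<in> U - F" using P(2)[OF psi_points[OF wR(1,3)]] w(2) Q(2)[OF wR(1,3)] by auto
      moreover have "psi w \<in> U - G" using P'(2)[OF psi_points[OF wR(1,3)]] w(3) Q'(2)[OF wR(1,3)] by auto
      moreover have "psi w \<in> F \<union> G" using psiC[OF w(1) SR wR(2)] FG by blast
      ultimately show False by blast
    qed
  qed
  define S where "S i = {x \<in> Rn n. \<forall>k\<ge>i. x k = phi y k}" for i
  have SR: "S i \<subseteq> Rn n" for i by (auto simp: S_def)
  have Sy: "phi y \<in> S i" for i using phi_Rn by (simp add: S_def)
  have Saff: "(\<lambda>j. x j + t * (x' j - x j)) \<in> S i" if "x \<in> S i" "x' \<in> S i" for i x x' t
    using that by (auto simp: S_def Rn_def)
  have "C (S i) \<subset> C (S (Suc i))" if i: "i < n" for i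
  proof
    have "S i \<subseteq> S (Suc i)" by (auto simp: S_def)
    then show "C (S i) \<subseteq> C (S (Suc i))" unfolding C_def by blast
    let ?u = "\<lambda>j. if j = i then 1 else (0::real)"
    have "cR (\<lambda>j. phi y j + 0 * ?u j) \<noteq> 0" using cRy by simp
    from polys_nonzero_on_line[OF cR cR this this] obtain t where
      t: "t \<noteq> 0" "cR (\<lambda>j. phi y j + t * ?u j) \<noteq> 0" by blast
    define x where "x = (\<lambda>j. phi y j + t * ?u j)"
    have xS: "x \<in> S (Suc i)" using phi_Rn[of y] i by (auto simp: x_def S_def Rn_def)
    have xR: "x \<in> Rn n" "c x \<noteq> 0" "cR x \<noteq> 0" using xS t cRD(1)[of x] by (auto simp: S_def x_def)
    define P where "P = (\<lambda>a. A i a - phi y i * b a)"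
    have P: "P \<in> polys N" unfolding P_def by (intro polys_diff polys_cmult A b i)
    have Pe: "P (e (psi w)) = b (e (psi w)) * (w i - phi y i)" if w: "w \<in> Rn n" "c w \<noteq> 0" for w
    proof -
      have "A i (e (psi w)) / b (e (psi w)) = w i"
        using fun_cong[OF phi_psi[OF w], of i] i by (simp add: quot_map_def)
      then show ?thesis using psi_b[OF w] by (simp add: P_def field_simps)
    qed
    have "P (e (psi w)) = 0" if "w \<in> S i" "cR w \<noteq> 0" for w
      using Pe[of w] that cRD(1)[of w] by (auto simp: S_def)
    moreover have "P (e (psi x)) \<noteq> 0" using Pe[OF xR(1,2)] psi_b[OF xR(1,2)] t(1) by (simp add: x_def)
    ultimately have "psi x \<notin> C (S i)" using P unfolding C_def by blast
    moreover have "psi x \<in> C (S (Suc i))" by (rule psiC[OF xS SR xR(3)])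
    ultimately show "C (S i) \<noteq> C (S (Suc i))" by blast
  qed
  then have "(\<forall>i\<le>n. closedin (subtopology (ztop Y) U) (C (S i)) \<and> irreducible_set (subtopology (ztop Y) U) (C (S i))) \<and>
      (\<forall>i<n. C (S i) \<subset> C (S (Suc i)))"
    using closed irr[OF SR Sy Saff] by blast
  then show ?thesis unfolding krull_dim_def
    by (intro Sup_upper CollectI exI[of _ n] conjI[OF refl] exI[of _ "\<lambda>i. C (S i)"])
qed

text \<open>
  The upper bound comes from the neighborhood \<open>Y\<close> itself.
\<close>
lemma local_dim_eq:
  assumes "y \<in> chart_domain" "krull_dim (ztop Y) = enat n"
  shows "local_dim (ztop Y) y = enat n"
proof (rule antisym)
  have "y \<in> points Y" using assms(1) by (simp add: chart_domain_def)
  then show "local_dim (ztop Y) y \<le> enat n"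
    unfolding local_dim_def assms(2)[symmetric]
    by (intro Inf_lower CollectI exI[of _ "points Y"]) simp
  show "enat n \<le> local_dim (ztop Y) y"
    unfolding local_dim_def by (rule Inf_greatest) (use krull_dim_ge[OF assms(1)] in blast)
qed

end

section \<open>Extending the spray of a chart by the identity\<close>

text \<open>
  Expansion of \<open>g (A / b + h v)\<close> to first order in \<open>h\<close> with the denominators cleared.  The
  remainder \<open>T\<close> is a polynomial in \<open>a\<close>, \<open>v\<close> and \<open>h\<close>, so a polynomial step length can be inserted
  for \<open>h\<close>.
\<close>
lemma poly_expand_at_quotient:
  assumes A: "\<And>i. i < n \<Longrightarrow> A i \<in> polys N" and b: "b \<in> polys N" and g: "g \<in> polys n"
  shows "\<exists>d. \<exists>Q\<in>polys N. \<exists>T\<in>polys (N + (n + 1)). \<forall>a v h. b a \<noteq> 0 \<longrightarrow>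
    b a ^ d * g (\<lambda>i. quot_map n A b a i + h * v i) = Q a + h * T (catv N a (catv n v (\<lambda>_. h)))"
  using g
proof (induction rule: polys.induct)
  case (const r)
  show ?case by (rule exI[of _ 0], rule bexI[of _ "\<lambda>x. r"], rule bexI[of _ "\<lambda>x. 0"])
      (auto intro: polys.const)
next
  case (coord i)
  show ?case
    by (rule exI[of _ 1], rule bexI[of _ "A i"], rule bexI[of _ "\<lambda>x. b x * x (N + i)"])
       (use coord A b in \<open>auto simp: quot_map_def polys_catv_left field_simps
          intro!: polys.mult polys.coord intro: polys_mono\<close>)
next
  case (add g g')
  then obtain d Q T d' Q' T' where 1: "Q \<in> polys N" "T \<in> polys (N + (n + 1))"
    "Q' \<in> polys N" "T' \<in> polys (N + (n + 1))"
    "\<And>a v h. b a \<noteq> 0 \<Longrightarrow> b a ^ d * g (\<lambda>i. quot_map n A b a i + h * v i) = Q a + h * T (catv N a (catv n v (\<lambda>_. h)))"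
    "\<And>a v h. b a \<noteq> 0 \<Longrightarrow> b a ^ d' * g' (\<lambda>i. quot_map n A b a i + h * v i) = Q' a + h * T' (catv N a (catv n v (\<lambda>_. h)))"
    by (elim exE bexE) blast
  have bN: "b \<in> polys (N + (n + 1))" using b by (rule polys_mono) simp
  show ?case
  proof (rule exI[of _ "d + d'"], rule bexI[of _ "\<lambda>x. b x ^ d' * Q x + b x ^ d * Q' x"],
      rule bexI[of _ "\<lambda>x. b x ^ d' * T x + b x ^ d * T' x"], intro allI impI)
    fix a v h assume ba: "b a \<noteq> 0"
    let ?x = "\<lambda>i. quot_map n A b a i + h * v i" and ?z = "catv N a (catv n v (\<lambda>_. h))"
    have "b a ^ (d + d') * (g ?x + g' ?x)
      = b a ^ d' * (b a ^ d * g ?x) +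
        b a ^ d * (b a ^ d' * g' ?x)"
      by (simp add: power_add algebra_simps)
    then show "b a ^ (d + d') * (g ?x + g' ?x) =
      (b a ^ d' * Q a + b a ^ d * Q' a) + h * (b ?z ^ d' * T ?z +
        b ?z ^ d * T' ?z)"
      unfolding 1(5)[OF ba] 1(6)[OF ba] polys_catv_left[OF b] by (simp add: algebra_simps)
  qed (use 1 b bN in \<open>auto intro!: polys.intros polys_power\<close>)
next
  case (mult g g')
  then obtain d Q T d' Q' T' where 1: "Q \<in> polys N" "T \<in> polys (N + (n + 1))"
    "Q' \<in> polys N" "T' \<in> polys (N + (n + 1))"
    "\<And>a v h. b a \<noteq> 0 \<Longrightarrow> b a ^ d * g (\<lambda>i. quot_map n A b a i + h * v i) = Q a + h * T (catv N a (catv n v (\<lambda>_. h)))"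
    "\<And>a v h. b a \<noteq> 0 \<Longrightarrow> b a ^ d' * g' (\<lambda>i. quot_map n A b a i + h * v i) = Q' a + h * T' (catv N a (catv n v (\<lambda>_. h)))"
    by (elim exE bexE) blast
  have QN: "Q \<in> polys (N + (n + 1))" "Q' \<in> polys (N + (n + 1))" using 1 by (auto intro: polys_mono)
  have hN: "(\<lambda>x. x (N + n)) \<in> polys (N + (n + 1))" by (rule polys.coord) simp
  show ?case
  proof (rule exI[of _ "d + d'"], rule bexI[of _ "\<lambda>x. Q x * Q' x"],
      rule bexI[of _ "\<lambda>x. Q x * T' x + Q' x * T x + x (N + n) * (T x * T' x)"], intro allI impI)
    fix a v h assume ba: "b a \<noteq> 0"
    let ?x = "\<lambda>i. quot_map n A b a i + h * v i" and ?z = "catv N a (catv n v (\<lambda>_. h))"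
    have h: "?z (N + n) = h" by (simp add: catv_def)
    have "b a ^ (d + d') * (g ?x * g' ?x)
      = (b a ^ d * g ?x) * (b a ^ d' * g' ?x)"
      by (simp add: power_add algebra_simps)
    then show "b a ^ (d + d') * (g ?x * g' ?x) =
      Q a * Q' a + h * (Q ?z * T' ?z +
        Q' ?z * T ?z +
        ?z (N + n) * (T ?z * T' ?z))"
      unfolding 1(5)[OF ba] 1(6)[OF ba] polys_catv_left[OF 1(1)] polys_catv_left[OF 1(3)] h
      by (simp add: algebra_simps)
  qed (use 1 QN hN in \<open>auto intro!: polys.add polys.mult\<close>)
qed

text \<open>
  The denominator \<open>c\<close> and the numerators \<open>p j\<close> of a chart must be expanded with the same power
  of \<open>b\<close>, for it has to cancel in the quotients.
\<close>
lemma poly_expand_at_quotient_common: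
  assumes A: "\<And>i. i < n \<Longrightarrow> A i \<in> polys N" and b: "b \<in> polys N" and g: "\<And>j. j < (m::nat) \<Longrightarrow> g j \<in> polys n"
  shows "\<exists>d Q T. \<forall>j<m. Q j \<in> polys N \<and> T j \<in> polys (N + (n + 1)) \<and> (\<forall>a v h. b a \<noteq> 0 \<longrightarrow>
    b a ^ d * g j (\<lambda>i. quot_map n A b a i + h * v i) = Q j a + h * T j (catv N a (catv n v (\<lambda>_. h))))"
proof -
  define ex where "ex j d Q T \<longleftrightarrow> Q \<in> polys N \<and> T \<in> polys (N + (n + 1)) \<and> (\<forall>a v h. b a \<noteq> 0 \<longrightarrow>
    b a ^ d * g j (\<lambda>i. quot_map n A b a i + h * v i) = Q a + h * T (catv N a (catv n v (\<lambda>_. h))))" for j d Q T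
  have "\<exists>d Q T. ex j d Q T" if "j < m" for j
    using poly_expand_at_quotient[of n A N b "g j", OF A b g[OF that]] unfolding ex_def by blast
  then obtain d Q T where 1: "\<And>j. j < m \<Longrightarrow> ex j (d j) (Q j) (T j)" by metis
  define D where "D = (\<Sum>j<m. d j)"
  have "ex j D (\<lambda>x. b x ^ (D - d j) * Q j x) (\<lambda>x. b x ^ (D - d j) * T j x)" if j: "j < m" for j
  proof -
    have "d j \<le> D" unfolding D_def by (rule member_le_sum) (use j in auto)
    then have D: "b a ^ D = b a ^ (D - d j) * b a ^ d j" for a by (simp flip: power_add)
    show ?thesis unfolding ex_def
    proof (intro conjI allI impI)
      show "(\<lambda>x. b x ^ (D - d j) * Q j x) \<in> polys N" "(\<lambda>x. b x ^ (D - d j) * T j x) \<in> polys (N + (n + 1))"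
        using 1[OF j] b polys_mono[OF b, of "N + (n + 1)"] unfolding ex_def by (auto intro!: polys.mult polys_power)
      fix a v h assume ba: "b a \<noteq> 0"
      let ?x = "\<lambda>i. quot_map n A b a i + h * v i" and ?z = "catv N a (catv n v (\<lambda>_. h))"
      from ba have "b a ^ d j * g j ?x = Q j a + h * T j ?z"
        using 1[OF j] unfolding ex_def by blast
      then show "b a ^ D * g j ?x =
         b a ^ (D - d j) * Q j a + h * (b ?z ^ (D - d j) * T j ?z)"
        unfolding polys_catv_left[OF b] D by (simp add: mult.assoc) (simp add: algebra_simps)
    qed
  qed
  then show ?thesis unfolding ex_def
    by (intro exI[of _ D] exI[of _ "\<lambda>j x. b x ^ (D - d j) * Q j x"]
        exI[of _ "\<lambda>j x. b x ^ (D - d j) * T j x"]) simp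
qed

text \<open>
  A real coordinate satisfies \<open>|a| \<le> 1 + a\<^sup>2\<close>, and bounds can be added and multiplied.  The
  reciprocal of \<open>1 + H\<close> will be the damping factor of the spray.
\<close>
lemma polys_bound_last:
  assumes "G \<in> polys (M + 1)"
  shows "\<exists>H\<in>polys M. \<forall>z \<mu>. \<bar>\<mu>\<bar> \<le> 1 \<longrightarrow> \<bar>G (catv M z (\<lambda>_. \<mu>))\<bar> \<le> H z"
  using assms
proof (induction rule: polys.induct)
  case (const r)
  show ?case by (rule bexI[of _ "\<lambda>x. \<bar>r\<bar>"]) (auto intro: polys.const)
next
  case (coord i)
  show ?case
  proof (cases "i < M")
    case True
    have "\<bar>a\<bar> \<le> 1 + a * a" for a :: real
    proof -
      have "0 \<le> (\<bar>a\<bar> - 1)\<^sup>2 + \<bar>a\<bar>" by simp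
      then show ?thesis by (simp add: power2_eq_square algebra_simps)
    qed
    then show ?thesis using True
      by (intro bexI[of _ "\<lambda>x. 1 + x i * x i"]) (auto intro!: polys.intros)
  next
    case False
    then show ?thesis by (intro bexI[of _ "\<lambda>x. 1"]) (auto intro: polys.const simp: catv_def)
  qed
next
  case (add p q)
  then obtain H H' where 1: "H \<in> polys M" "H' \<in> polys M"
    "\<And>z \<mu>. \<bar>\<mu>\<bar> \<le> 1 \<Longrightarrow> \<bar>p (catv M z (\<lambda>_. \<mu>))\<bar> \<le> H z" "\<And>z \<mu>. \<bar>\<mu>\<bar> \<le> 1 \<Longrightarrow> \<bar>q (catv M z (\<lambda>_. \<mu>))\<bar> \<le> H' z" by blast
  show ?case
    by (rule bexI[of _ "\<lambda>x. H x + H' x"])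
       (use 1 in \<open>auto intro!: polys.add order.trans[OF abs_triangle_ineq] add_mono\<close>)
next
  case (mult p q)
  then obtain H H' where 1: "H \<in> polys M" "H' \<in> polys M"
    "\<And>z \<mu>. \<bar>\<mu>\<bar> \<le> 1 \<Longrightarrow> \<bar>p (catv M z (\<lambda>_. \<mu>))\<bar> \<le> H z" "\<And>z \<mu>. \<bar>\<mu>\<bar> \<le> 1 \<Longrightarrow> \<bar>q (catv M z (\<lambda>_. \<mu>))\<bar> \<le> H' z" by blast
  show ?case
  proof (rule bexI[of _ "\<lambda>x. H x * H' x"], intro allI impI)
    fix z and \<mu> :: real assume m: "\<bar>\<mu>\<bar> \<le> 1"
    show "\<bar>p (catv M z (\<lambda>_. \<mu>)) * q (catv M z (\<lambda>_. \<mu>))\<bar> \<le> H z * H' z"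
      unfolding abs_mult using 1(3)[OF m, of z] 1(4)[OF m, of z] by (intro mult_mono) auto
  qed (use 1 in \<open>auto intro: polys.mult\<close>)
qed

text \<open>
  A spray on \<open>Y \<times> \<real>\<^sup>k\<close> that is submersive over \<open>G\<close>, all expressed in coordinates: every derivation
  at a point of \<open>G\<close> is the velocity of the image of a line in the fiber.
\<close>
definition trivial_spray :: "'a rspace \<Rightarrow> nat \<Rightarrow> ('a \<Rightarrow> nat \<Rightarrow> real) \<Rightarrow> nat \<Rightarrow>
    ('a \<times> (nat \<Rightarrow> real) \<Rightarrow> 'a) \<Rightarrow> 'a set \<Rightarrow> bool" where
  "trivial_spray Y N e k s G \<longleftrightarrow>
     (\<forall>y\<in>points Y. \<forall>v\<in>Rn k. s (y, v) \<in> points Y) \<and>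
     (\<forall>y\<in>points Y. s (y, \<lambda>i. 0) = y) \<and>
     (\<forall>j<N. (\<lambda>q. e (s q) j) \<in> locrat (N + k) (prodc N e (\<lambda>v. v)) (points Y \<times> Rn k)) \<and>
     (\<forall>y\<in>G. \<forall>D\<in>tangent_space Y y. \<exists>v\<in>Rn k. \<forall>j<N.
        ((\<lambda>t. e (s (y, \<lambda>i. t * v i)) j) has_real_derivative D (points Y) (\<lambda>z. e z j)) (at 0))"

text \<open>
  Along \<open>t \<mapsto> t v\<close> the point of the chart moves by \<open>\<lambda>(y, t v) t v\<close>, with velocity \<open>\<lambda>(y, 0) v\<close> at
  \<open>0\<close>.  Since \<open>\<lambda>(y, 0) \<noteq> 0\<close> on the chart, every velocity is attained.
\<close>
lemma (in chart) chart_spray: "\<exists>s. trivial_spray Y N e n s chart_domain"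
proof -
  let ?E = "prodc N e (\<lambda>v. v)"
  \<comment> \<open>The denominator \<open>c\<close> is put behind the \<open>N\<close> numerators, at index \<open>N\<close>.\<close>
  define g where "g j = (if j = N then c else p j)" for j
  have g: "g j \<in> polys n" if "j < Suc N" for j using that c p by (auto simp: g_def less_Suc_eq)
  obtain d Q T where "\<forall>j<Suc N. Q j \<in> polys N \<and> T j \<in> polys (N + (n + 1)) \<and> (\<forall>a v h. b a \<noteq> 0 \<longrightarrow>
    b a ^ d * g j (\<lambda>i. quot_map n A b a i + h * v i) = Q j a + h * T j (catv N a (catv n v (\<lambda>_. h))))"
    using poly_expand_at_quotient_common[of n A N b "Suc N" g, OF A b g] by blast
  then have QT: "\<And>j. j < Suc N \<Longrightarrow> Q j \<in> polys N" "\<And>j. j < Suc N \<Longrightarrow> T j \<in> polys (N + (n + 1))"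
    "\<And>j a v h. j < Suc N \<Longrightarrow> b a \<noteq> 0 \<Longrightarrow>
       b a ^ d * g j (\<lambda>i. quot_map n A b a i + h * v i) = Q j a + h * T j (catv N a (catv n v (\<lambda>_. h)))"
    by blast+
  define Q0 where "Q0 = Q N"
  have Q0: "Q0 \<in> polys N" using QT(1) by (simp add: Q0_def)
  \<comment> \<open>\<open>TT j\<close> is \<open>b Q0 T j\<close> at step length \<open>h = Q0\<^sup>2 b \<mu>\<close>, as a polynomial in point, vector and \<open>\<mu>\<close>.\<close>
  define arg where "arg w = catv N w (catv n (\<lambda>i. w (N + i)) (\<lambda>_. Q0 w * Q0 w * b w * w (N + n)))" for w :: "nat \<Rightarrow> real"
  define TT where "TT j = (\<lambda>w. b w * Q0 w * T j (arg w))" for j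
  have up: "f \<in> polys ((N + n) + 1)" if "f \<in> polys N" for f using that by (rule polys_mono) simp
  have TT: "TT j \<in> polys ((N + n) + 1)" if "j < Suc N" for j
    unfolding TT_def
  proof (rule polys.mult[OF polys.mult[OF up[OF b] up[OF Q0]]], rule polys_subst[OF QT(2)[OF that]])
    fix i assume i: "i < N + (n + 1)"
    consider "i < N + n" "\<And>w. arg w i = w i" | "i = N + n" "\<And>w. arg w i = Q0 w * Q0 w * b w * w (N + n)"
    proof (cases "i < N + n")
      case True
      then show ?thesis by (intro that(1)) (auto simp: arg_def catv_def)
    next
      case False
      then show ?thesis using i by (intro that(2)) (auto simp: arg_def catv_def)
    qed
    then show "(\<lambda>w. arg w i) \<in> polys ((N + n) + 1)"
      by cases (auto intro!: polys.mult polys.coord up[OF Q0, simplified] up[OF b, simplified])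
  qed
  obtain H where H: "H \<in> polys (N + n)" "\<And>z \<mu>. \<bar>\<mu>\<bar> \<le> 1 \<Longrightarrow> \<bar>TT N (catv (N + n) z (\<lambda>_. \<mu>))\<bar> \<le> H z"
    using polys_bound_last[OF TT[of N]] by auto
  have H0: "0 \<le> H z" for z using H(2)[of 0 z] by simp
  define mu where "mu q = 1 / (1 + H (?E q))" for q
  have mu: "0 < mu q" "mu q \<le> 1" "mu q * H (?E q) < 1" for q
    using H0[of "?E q"] by (auto simp: mu_def field_simps)
  \<comment> \<open>the point at which the polynomials \<open>TT j\<close> are evaluated\<close>
  define w where "w q = catv (N + n) (?E q) (\<lambda>_. mu q)" for q
  \<comment> \<open>One factor \<open>Q0\<close> of the step length cancels against the constant term of \<open>c (x q)\<close>.
      The second one and \<open>b\<close> make the displacement vanish off the chart.\<close>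
  define lam where "lam q = Q0 (e (fst q)) * Q0 (e (fst q)) * b (e (fst q)) * mu q" for q
  define x where "x q = (\<lambda>i. phi (fst q) i + lam q * snd q i)" for q
  define s where "s q = (if fst q \<in> chart_domain then psi (x q) else fst q)" for q
  have wN: "f (w q) = f (e (fst q))" if "f \<in> polys N" for f q
    by (rule polys_cong[OF that]) (simp add: w_def prodc_def catv_def)
  have argw: "T j (arg (w q)) = T j (catv N (e (fst q)) (catv n (snd q) (\<lambda>_. lam q)))" if "j < Suc N" for j q
    by (rule polys_cong[OF QT(2)[OF that]])
       (auto simp: arg_def lam_def wN[OF Q0] wN[OF b], auto simp: w_def prodc_def catv_def)
  have one: "1 + mu q * TT N (w q) > 0" for q
  proof -
    have "\<bar>TT N (w q)\<bar> \<le> H (?E q)" unfolding w_def by (rule H(2)) (use mu(1,2)[of q] in auto)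
    then have "\<bar>mu q * TT N (w q)\<bar> \<le> mu q * H (?E q)"
      using mu(1)[of q] by (simp add: abs_mult)
    then show ?thesis using mu(3)[of q] by linarith
  qed
  have Q0c: "b (e y) ^ d * c (phi y) = Q0 (e y)" if "b (e y) \<noteq> 0" for y
    using QT(3)[of N "e y" 0 "\<lambda>_. 0", OF _ that] by (simp add: g_def Q0_def)
  have dom: "y \<in> chart_domain \<longleftrightarrow> b (e y) \<noteq> 0 \<and> Q0 (e y) \<noteq> 0" if "y \<in> points Y" for y
    using that Q0c[of y] by (auto simp: chart_domain_def)
  have xR: "x q \<in> Rn n" if "snd q \<in> Rn n" for q
    using that phi_Rn[of "fst q"] by (auto simp: x_def Rn_def)
  have key: "b (e (fst q)) ^ d * g j (x q) = Q j (e (fst q)) + lam q * T j (arg (w q))"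
    if "b (e (fst q)) \<noteq> 0" "j < Suc N" for q j
    unfolding x_def using QT(3)[OF that(2,1)] argw[OF that(2), of q] by simp
  have cx: "b (e (fst q)) ^ d * c (x q) = Q0 (e (fst q)) * (1 + mu q * TT N (w q))" if "b (e (fst q)) \<noteq> 0" for q
    using key[of q N] that by (simp add: g_def Q0_def[symmetric] lam_def TT_def wN[OF Q0] wN[OF b] algebra_simps)
  have cx0: "c (x q) \<noteq> 0" if "fst q \<in> chart_domain" for q
  proof -
    have "b (e (fst q)) \<noteq> 0" "Q0 (e (fst q)) \<noteq> 0" using that dom by (auto simp: chart_domain_def)
    then have "b (e (fst q)) ^ d * c (x q) \<noteq> 0" using cx[of q] one[of q] by simp
    then show ?thesis by simp
  qed
  have s_points: "s q \<in> points Y" if "fst q \<in> points Y" "snd q \<in> Rn n" for q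
    using that psi_points[OF xR cx0] by (simp add: s_def)
  \<comment> \<open>On the chart \<open>Q j = Q0 e\<^sub>j\<close> since \<open>psi\<close> inverts \<open>phi\<close>, and \<open>Q0\<close> cancels; off the chart
      \<open>b Q0 = 0\<close> and both sides are \<open>e\<^sub>j\<close>.  The right-hand side is regular on all of \<open>Y \<times> \<real>\<^sup>n\<close>.\<close>
  have s_coord: "e (s q) j = (e (fst q) j + mu q * TT j (w q)) / (1 + mu q * TT N (w q))"
    if q: "fst q \<in> points Y" "snd q \<in> Rn n" and j: "j < N" for q j
  proof (cases "fst q \<in> chart_domain")
    case True
    then have bQ: "b (e (fst q)) \<noteq> 0" "Q0 (e (fst q)) \<noteq> 0" "c (phi (fst q)) \<noteq> 0"
      using dom by (auto simp: chart_domain_def)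
    have "e (fst q) j = p j (phi (fst q)) / c (phi (fst q))"
      using psi_coord[OF phi_Rn bQ(3) j] psi_phi[OF q(1) bQ(1,3)] by simp
    then have "p j (phi (fst q)) = e (fst q) j * c (phi (fst q))" using bQ(3) by simp
    moreover have "Q j (e (fst q)) = b (e (fst q)) ^ d * p j (phi (fst q))"
      using QT(3)[of j "e (fst q)" 0 "\<lambda>_. 0"] bQ(1) j by (simp add: g_def)
    ultimately have Qj: "Q j (e (fst q)) = Q0 (e (fst q)) * e (fst q) j"
      using Q0c[OF bQ(1)] by simp
    have "b (e (fst q)) ^ d * p j (x q) = Q0 (e (fst q)) * (e (fst q) j + mu q * TT j (w q))"
      using key[of q j] bQ(1) j
      by (simp add: g_def Qj lam_def TT_def wN[OF Q0] wN[OF b] algebra_simps)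
    then have "(b (e (fst q)) ^ d * p j (x q)) / (b (e (fst q)) ^ d * c (x q)) =
        (e (fst q) j + mu q * TT j (w q)) / (1 + mu q * TT N (w q))"
      unfolding cx[OF bQ(1)] using bQ(2) by simp
    then have "p j (x q) / c (x q) = (e (fst q) j + mu q * TT j (w q)) / (1 + mu q * TT N (w q))"
      using bQ(1) by simp
    then show ?thesis using True psi_coord[OF xR[OF q(2)] cx0[OF True] j] by (simp add: s_def)
  next
    case False
    then have "b (e (fst q)) * Q0 (e (fst q)) = 0" using dom[OF q(1)] by simp
    then have "TT j' (w q) = 0" for j' unfolding TT_def wN[OF Q0] wN[OF b] by simp
    then show ?thesis using False by (simp add: s_def)
  qed
  have lmu: "mu \<in> locrat (N + n) ?E W" for W
    unfolding mu_def
    by (intro locrat_divide locrat_const locrat_add locrat_poly H)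
       (metis H0 add_nonneg_eq_0_iff zero_le_one zero_neq_one)
  have lTT: "(\<lambda>q. TT j (w q)) \<in> locrat (N + n) ?E W" if "j < Suc N" for j W
  proof (rule locrat_poly_subst[OF TT[OF that]])
    fix i assume "i < N + n + 1"
    then show "(\<lambda>q. w q i) \<in> locrat (N + n) ?E W"
    proof (cases "i < N + n")
      case True
      then show ?thesis using locrat_coord[OF True] by (simp add: w_def)
    next
      case False
      then show ?thesis using lmu by (simp add: w_def catv_def)
    qed
  qed
  have le: "(\<lambda>q. e (fst q) j) \<in> locrat (N + n) ?E W" if "j < N" for j W
    by (rule locrat_prodc_fst[OF locrat_coord[OF that] order_refl])
  have reg: "(\<lambda>q. e (s q) j) \<in> locrat (N + n) ?E (points Y \<times> Rn n)" if j: "j < N" for j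
  proof (rule locrat_cong)
    show "(\<lambda>q. (e (fst q) j + mu q * TT j (w q)) / (1 + mu q * TT N (w q)))
        \<in> locrat (N + n) ?E (points Y \<times> Rn n)"
      by (intro locrat_divide locrat_add locrat_mult locrat_const lmu lTT le)
         (use j one in \<open>auto simp: less_imp_neq[symmetric]\<close>)
  qed (use s_coord[OF _ _ j] in auto)
  have zero: "s (y, \<lambda>i. 0) = y" if "y \<in> points Y" for y
    using that psi_phi[of y] by (auto simp: s_def x_def chart_domain_def)
  have sub: "\<exists>v\<in>Rn n. \<forall>j<N.
        ((\<lambda>t. e (s (y, \<lambda>i. t * v i)) j) has_real_derivative D (points Y) (\<lambda>z. e z j)) (at 0)"
    if y: "y \<in> chart_domain" and D: "D \<in> tangent_space Y y" for y D
  proof -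
    let ?V = "{z \<in> points Y. b (e z) \<noteq> 0}"
    define l0 where "l0 = lam (y, \<lambda>i. 0)"
    have "y \<in> points Y" using y by (simp add: chart_domain_def)
    then have l0: "l0 \<noteq> 0" using dom[of y] y mu(1)[of "(y, \<lambda>i. 0)"] by (simp add: l0_def lam_def)
    \<comment> \<open>The curve in the chart has velocity \<open>l0 v\<close>, which is to be the vector \<open>D phi\<close>.\<close>
    define v where "v = (\<lambda>i. if i < n then D ?V (\<lambda>z. phi z i) / l0 else 0)"
    have v: "v \<in> Rn n" by (simp add: v_def Rn_def)
    have tv: "(\<lambda>i. t * v i) \<in> Rn n" for t using v by (simp add: Rn_def)
    define X where "X t = x (y, \<lambda>i. t * v i)" for t
    have "\<exists>d. ((\<lambda>t. H (?E (y, \<lambda>i. t * v i))) has_real_derivative d) (at 0)"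
    proof (rule poly_along_curve[OF H(1)])
      fix i assume "i < N + n"
      show "\<exists>d. ((\<lambda>t. ?E (y, \<lambda>i. t * v i) i) has_real_derivative d) (at 0)"
      proof (cases "i < N")
        case False
        then show ?thesis
          by (intro exI[of _ "v (i - N)"]) (auto simp: prodc_def catv_def intro!: derivative_eq_intros)
      qed (auto simp: prodc_def intro: DERIV_const)
    qed
    then obtain dH where dH: "((\<lambda>t. H (?E (y, \<lambda>i. t * v i))) has_real_derivative dH) (at 0)" by blast
    have "\<exists>d. ((\<lambda>t. lam (y, \<lambda>i. t * v i)) has_real_derivative d) (at 0)"
    proof -
      have "1 + H (?E (y, \<lambda>i. 0 * v i)) \<noteq> 0"
        using H0 by (metis add_nonneg_eq_0_iff zero_le_one zero_neq_one)
      from DERIV_cmult[OF DERIV_divide[OF DERIV_const DERIV_add[OF DERIV_const dH] this]]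
      show ?thesis unfolding lam_def mu_def fst_conv by blast
    qed
    then obtain dl where dl: "((\<lambda>t. lam (y, \<lambda>i. t * v i)) has_real_derivative dl) (at 0)" by blast
    have dX: "((\<lambda>t. X t i) has_real_derivative D ?V (\<lambda>z. phi z i)) (at 0)" if i: "i < n" for i
    proof -
      have "((\<lambda>t. t * v i) has_real_derivative v i) (at 0)" by (auto intro!: derivative_eq_intros)
      from DERIV_add[OF DERIV_const[of "phi y i"] DERIV_mult[OF dl this]]
      have "((\<lambda>t. X t i) has_real_derivative l0 * v i) (at 0)"
        by (simp add: X_def x_def l0_def mult.commute)
      then show ?thesis using l0 i by (simp add: v_def)
    qed
    have XR: "X t \<in> Rn n" "X 0 = phi y" for t using xR[of "(y, \<lambda>i. t * v i)"] tv by (auto simp: X_def x_def)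
    have "((\<lambda>t. e (psi (X t)) j) has_real_derivative D (points Y) (\<lambda>z. e z j)) (at 0)" if "j < N" for j
      by (rule derivation_in_chart(1)[where x=X, OF y D XR dX that])
    moreover have "s (y, \<lambda>i. t * v i) = psi (X t)" for t using y by (simp add: s_def X_def)
    ultimately show ?thesis using v by (intro bexI[of _ v]) auto
  qed
  have "trivial_spray Y N e n s chart_domain"
    unfolding trivial_spray_def using s_points zero reg sub by auto
  then show ?thesis by blast
qed

text \<open>
  With \<open>w = 0\<close> the composite \<open>s\<^sub>2(s\<^sub>1(y, v), w)\<close> is \<open>s\<^sub>1(y, v)\<close>, and with \<open>v = 0\<close> it is \<open>s\<^sub>2(y, w)\<close>;
  so it attains all velocities that one of the two attains.
\<close>
lemma trivial_spray_compose:
  assumes s1: "trivial_spray Y N e k s1 G1" and s2: "trivial_spray Y N e m s2 G2"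
    and G: "G1 \<subseteq> points Y" "G2 \<subseteq> points Y"
  shows "trivial_spray Y N e (k + m)
    (\<lambda>q. s2 (s1 (fst q, \<lambda>i. if i < k then snd q i else 0), \<lambda>i. snd q (k + i))) (G1 \<union> G2)"
proof -
  let ?l = "\<lambda>v i. if i < k then v i else (0::real)" and ?r = "\<lambda>v i. v (k + i) :: real"
  let ?s = "\<lambda>q. s2 (s1 (fst q, ?l (snd q)), ?r (snd q))"
  note s1 = s1[unfolded trivial_spray_def] and s2 = s2[unfolded trivial_spray_def]
  have s1p: "s1 (y, v) \<in> points Y" "s1 (y, \<lambda>i. 0) = y" if "y \<in> points Y" "v \<in> Rn k" for y v
    using s1 that by blast+
  have s2p: "s2 (y, v) \<in> points Y" "s2 (y, \<lambda>i. 0) = y" if "y \<in> points Y" "v \<in> Rn m" for y v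
    using s2 that by blast+
  have s1r: "(\<lambda>q. e (s1 q) j) \<in> locrat (N + k) (prodc N e (\<lambda>v. v)) (points Y \<times> Rn k)" if "j < N" for j
    using s1 that by blast
  have s2r: "(\<lambda>q. e (s2 q) j) \<in> locrat (N + m) (prodc N e (\<lambda>v. v)) (points Y \<times> Rn m)" if "j < N" for j
    using s2 that by blast
  have s1d: "\<exists>v\<in>Rn k. \<forall>j<N. ((\<lambda>t. e (s1 (y, \<lambda>i. t * v i)) j) has_real_derivative D (points Y) (\<lambda>z. e z j)) (at 0)"
    if "y \<in> G1" "D \<in> tangent_space Y y" for y D using s1 that by blast
  have s2d: "\<exists>v\<in>Rn m. \<forall>j<N. ((\<lambda>t. e (s2 (y, \<lambda>i. t * v i)) j) has_real_derivative D (points Y) (\<lambda>z. e z j)) (at 0)"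
    if "y \<in> G2" "D \<in> tangent_space Y y" for y D using s2 that by blast
  have l: "?l v \<in> Rn k" for v by (simp add: Rn_def)
  have r: "?r v \<in> Rn m" if "v \<in> Rn (k + m)" for v using that by (simp add: Rn_def)
  have z: "(\<lambda>i. 0) \<in> Rn j" for j by (simp add: Rn_def)
  let ?P = "points Y \<times> Rn (k + m)" and ?E = "prodc N e (\<lambda>v. v)"
  have c1: "(\<lambda>q. e (s1 (fst q, ?l (snd q))) j) \<in> locrat (N + (k + m)) ?E ?P" if "j < N" for j
  proof (rule locrat_comp[OF s1r[OF that], where f="\<lambda>q. (fst q, ?l (snd q))"])
    fix i assume i: "i < N + k"
    then have "?E (fst q, ?l (snd q)) i = ?E q i" for q by (auto simp: prodc_def catv_def)
    then show "(\<lambda>q. ?E (fst q, ?l (snd q)) i) \<in> locrat (N + (k + m)) ?E ?P"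
      using locrat_coord[of i "N + (k + m)" ?E ?P] i by simp
  qed (use l in auto)
  have reg: "(\<lambda>q. e (?s q) j) \<in> locrat (N + (k + m)) ?E ?P" if "j < N" for j
  proof (rule locrat_comp[OF s2r[OF that], where f="\<lambda>q. (s1 (fst q, ?l (snd q)), ?r (snd q))"])
    fix i assume i: "i < N + m"
    show "(\<lambda>q. ?E (s1 (fst q, ?l (snd q)), ?r (snd q)) i) \<in> locrat (N + (k + m)) ?E ?P"
    proof (cases "i < N")
      case True
      then show ?thesis using c1[OF True] by (simp add: prodc_def)
    next
      case False
      then have "?E (s1 (fst q, ?l (snd q)), ?r (snd q)) i = ?E q (i + k)" for q
        by (simp add: prodc_def catv_def add.commute)
      then show ?thesis
        using locrat_coord[of "i + k" "N + (k + m)" ?E ?P] i by simp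
    qed
  qed (use s1p(1) l r in auto)
  have sub: "\<exists>v\<in>Rn (k + m). \<forall>j<N. ((\<lambda>t. e (?s (y, \<lambda>i. t * v i)) j) has_real_derivative
       D (points Y) (\<lambda>z. e z j)) (at 0)" if y: "y \<in> G1 \<union> G2" and D: "D \<in> tangent_space Y y" for y D
    using y
  proof
    assume y: "y \<in> G1"
    then have yP: "y \<in> points Y" using G by blast
    obtain v where v: "v \<in> Rn k" "\<forall>j<N. ((\<lambda>t. e (s1 (y, \<lambda>i. t * v i)) j) has_real_derivative
        D (points Y) (\<lambda>z. e z j)) (at 0)" using s1d[OF y D] by blast
    have "?s (y, \<lambda>i. t * v i) = s1 (y, \<lambda>i. t * v i)" for t
    proof -
      have "?l (\<lambda>i. t * v i) = (\<lambda>i. t * v i)" "?r (\<lambda>i. t * v i) = (\<lambda>i. 0)"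
        using v(1) by (auto simp: Rn_def)
      moreover have "(\<lambda>i. t * v i) \<in> Rn k" using v(1) by (simp add: Rn_def)
      ultimately show ?thesis using s2p(2)[OF s1p(1)[OF yP, of "\<lambda>i. t * v i"] z] by (simp only: fst_conv snd_conv)
    qed
    moreover have "v \<in> Rn (k + m)" using v(1) by (simp add: Rn_def)
    ultimately show ?thesis using v(2) by (intro bexI[of _ v]) auto
  next
    assume y: "y \<in> G2"
    then have yP: "y \<in> points Y" using G by blast
    obtain v where v: "v \<in> Rn m" "\<forall>j<N. ((\<lambda>t. e (s2 (y, \<lambda>i. t * v i)) j) has_real_derivative
        D (points Y) (\<lambda>z. e z j)) (at 0)" using s2d[OF y D] by blast
    define v' where "v' = (\<lambda>i. if i < k then 0 else v (i - k))"
    have "?s (y, \<lambda>i. t * v' i) = s2 (y, \<lambda>i. t * v i)" for t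
    proof -
      have "?l (\<lambda>i. t * v' i) = (\<lambda>i. 0)" "?r (\<lambda>i. t * v' i) = (\<lambda>i. t * v i)"
        by (auto simp: v'_def)
      then show ?thesis using s1p(2)[OF yP z] by (simp only: fst_conv snd_conv)
    qed
    moreover have "v' \<in> Rn (k + m)" using v(1) by (auto simp: Rn_def v'_def)
    ultimately show ?thesis using v(2) by (intro bexI[of _ v']) auto
  qed
  have zero: "?s (y, \<lambda>i. 0) = y" if "y \<in> points Y" for y
  proof -
    have "?l (\<lambda>i. 0) = (\<lambda>i. 0)" by auto
    then show ?thesis using s1p(2)[OF that z] s2p(2)[OF that z] by (simp only: fst_conv snd_conv)
  qed
  have pts: "?s (y, v) \<in> points Y" if "y \<in> points Y" "v \<in> Rn (k + m)" for y v
    using s2p(1)[OF s1p(1)[OF that(1) l] r[OF that(2)]] by simp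
  show ?thesis unfolding trivial_spray_def
    using reg sub zero pts by blast
qed

lemma trivial_spray_finite_union:
  assumes "finite F" "\<And>z. z \<in> F \<Longrightarrow> \<exists>k s. trivial_spray Y N e k s (U z)" "\<And>z. z \<in> F \<Longrightarrow> U z \<subseteq> points Y"
  shows "\<exists>k s. trivial_spray Y N e k s (\<Union>z\<in>F. U z)"
  using assms
proof (induction F)
  case empty
  have "(\<lambda>q. e (fst q) j) \<in> locrat (N + 0) (prodc N e (\<lambda>v. v)) (points Y \<times> Rn 0)" if "j < N" for j
    by (rule locrat_prodc_fst[OF locrat_coord[OF that] order_refl])
  then have "trivial_spray Y N e 0 fst {}" unfolding trivial_spray_def by auto
  then show ?case by (simp only: UN_empty) blast
next
  case (insert z F)
  then obtain k s where 1: "trivial_spray Y N e k s (\<Union>z\<in>F. U z)" by blast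
  obtain k' s' where 2: "trivial_spray Y N e k' s' (U z)" using insert.prems(1)[of z] by blast
  have "(\<Union>z\<in>F. U z) \<subseteq> points Y" "U z \<subseteq> points Y" using insert.prems(2) by blast+
  from trivial_spray_compose[OF 2 1 this(2,1)] show ?case by (simp only: UN_insert) blast
qed

section \<open>Uniformly rational varieties are malleable\<close>

definition trivial_bundle :: "'a rspace \<Rightarrow> nat \<Rightarrow> ('a \<times> (nat \<Rightarrow> real), 'a) vbundle" where
  "trivial_bundle Y k = \<lparr> total = product Y (affine_space k), proj = fst, fzero = (\<lambda>y. (y, \<lambda>i. 0)),
     fadd = (\<lambda>e e'. (fst e, lincomb 1 (snd e) 1 (snd e'))),
     fscale = (\<lambda>c e. (fst e, lincomb c (snd e) 0 (snd e))) \<rparr>"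

lemma lincomb_Rn: "v \<in> Rn k \<Longrightarrow> w \<in> Rn k \<Longrightarrow> lincomb a v b w \<in> Rn k"
  by (simp add: Rn_def lincomb_def)

text \<open>
  All the bijections required are identity maps between spaces with the same coordinates.
\<close>
lemma algebraic_vector_bundle_trivial:
  assumes Y: "coords Y N e"
  shows "algebraic_vector_bundle Y (trivial_bundle Y k)"
proof -
  let ?T = "product Y (affine_space k)" and ?F = "points Y \<times> Rn k" and ?E = "prodc N e (\<lambda>v. v)"
  note pY = coords_imp_precoords[OF Y]
  have T: "points ?T = ?F" "coords ?T (N + k) ?E"
    using coords_product[OF pY precoords_affine] by auto
  have cF: "coords (induced ?T ?F) (N + k) ?E" by (rule coords_induced[OF coords_imp_precoords[OF T(2)]])
  have bi: "biregular ?T (induced ?T ?F) (\<lambda>x. x)"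
    by (rule biregular_same_coords[OF T(2) cF]) (simp add: T)
  have loc: "biregular (product (induced Y (points Y)) (affine_space k)) (induced ?T (?F \<inter> (points Y \<times> UNIV))) (\<lambda>x. x)"
  proof (rule biregular_same_coords)
    have cU: "precoords (induced Y (points Y)) N e"
      by (rule coords_imp_precoords[OF coords_induced[OF pY]])
    show "coords (product (induced Y (points Y)) (affine_space k)) (N + k) ?E"
      by (rule coords_product(2)[OF cU precoords_affine])
    show "coords (induced ?T (?F \<inter> (points Y \<times> UNIV))) (N + k) ?E"
      by (rule coords_induced[OF coords_imp_precoords[OF T(2)]])
    show "points (product (induced Y (points Y)) (affine_space k)) = points (induced ?T (?F \<inter> (points Y \<times> UNIV)))"
      using coords_product(1)[OF cU precoords_affine] T(1) by auto
  qed
  have sub: "algebraic_subbundle Y k ?F"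
    unfolding algebraic_subbundle_def
  proof (intro conjI ballI allI impI)
    fix y assume "y \<in> points Y"
    then show "\<exists>U r h. openin (ztop Y) U \<and> y \<in> U \<and>
        biregular (product (induced Y U) (affine_space r))
          (induced (product Y (affine_space k)) (?F \<inter> (U \<times> UNIV))) h \<and>
        (\<forall>x\<in>U. \<forall>v\<in>Rn r. fst (h (x, v)) = x) \<and>
        (\<forall>x\<in>U. \<forall>v\<in>Rn r. \<forall>w\<in>Rn r. \<forall>a b.
           snd (h (x, lincomb a v b w)) = lincomb a (snd (h (x, v))) b (snd (h (x, w))))"
      using loc by (intro exI[of _ "points Y"] exI[of _ k] exI[of _ "\<lambda>x. x"]) auto
  qed (auto simp: Rn_def lincomb_def)
  have "regular_map ?T Y fst"
    by (rule regular_map_by_coords[OF T(2) pY])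
       (auto simp: T(1) intro: locrat_prodc_fst[OF locrat_coord order_refl])
  moreover have "ringed_space ?T" by (rule coords_ringed_space[OF T(2)])
  ultimately show ?thesis
    unfolding algebraic_vector_bundle_def
    by (intro conjI exI[of _ k] exI[of _ ?F] exI[of _ "\<lambda>x. x"])
       (use sub bi T(1) in \<open>auto simp: trivial_bundle_def fiber_def lincomb_Rn, auto simp: Rn_def\<close>)
qed

lemma trivial_spray_is_spray:
  assumes Y: "coords Y N e" and s: "trivial_spray Y N e k s G"
  shows "spray Y (trivial_bundle Y k) s"
proof -
  note T = coords_product[OF coords_imp_precoords[OF Y] precoords_affine[of k]]
  have "regular_map (product Y (affine_space k)) Y s"
    by (rule regular_map_by_coords[OF T(2) coords_imp_precoords[OF Y]])
       (use s in \<open>auto simp: trivial_spray_def T(1)\<close>)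
  then show ?thesis
    using s algebraic_vector_bundle_trivial[OF Y, of k]
    by (auto simp: spray_def trivial_bundle_def trivial_spray_def)
qed

text \<open>
  A derivation \<open>D\<close> at \<open>y\<close> is the velocity of \<open>t \<mapsto> s (y, t v)\<close>, hence the image of the tangent
  vector of \<open>t \<mapsto> (y, t v)\<close> in the fiber.
\<close>
lemma trivial_spray_dominating:
  assumes Y: "coords Y N e" and s: "trivial_spray Y N e k s (points Y)"
  shows "dominating Y (trivial_bundle Y k) s"
  unfolding dominating_def
proof
  fix y assume y: "y \<in> points Y"
  let ?T = "product Y (affine_space k)" and ?E = "prodc N e (\<lambda>v. v)"
  note T = coords_product[OF coords_imp_precoords[OF Y] precoords_affine[of k]]
  define X where "X = induced ?T (fiber (trivial_bundle Y k) y)"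
  have cX: "coords X (N + k) ?E" unfolding X_def by (rule coords_induced[OF coords_imp_precoords[OF T(2)]])
  have pX: "points X = {y} \<times> Rn k"
    using y by (auto simp: X_def fiber_def trivial_bundle_def T(1))
  have z: "(\<lambda>i. 0) \<in> Rn k" by (simp add: Rn_def)
  have s0: "s (y, \<lambda>i. 0) = y" using s y by (simp add: trivial_spray_def)
  have sp: "s (y, v) \<in> points Y" if "v \<in> Rn k" for v using s y that by (simp add: trivial_spray_def)
  have reg: "regular_map X Y s"
  proof (rule regular_map_by_coords[OF cX coords_imp_precoords[OF Y]])
    fix j assume "j < N"
    then have "(\<lambda>q. e (s q) j) \<in> locrat (N + k) ?E (points Y \<times> Rn k)" using s by (simp add: trivial_spray_def)
    then show "(\<lambda>q. e (s q) j) \<in> locrat (N + k) ?E (points X)"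
      by (rule locrat_subset) (use y pX in auto)
  qed (use sp pX in auto)
  have "submersion_at X Y s (y, \<lambda>i. 0)"
    unfolding submersion_at_def s0
  proof
    fix D assume D: "D \<in> tangent_space Y y"
    obtain v where v: "v \<in> Rn k" and dv: "\<And>j. j < N \<Longrightarrow>
        ((\<lambda>t. e (s (y, \<lambda>i. t * v i)) j) has_real_derivative D (points Y) (\<lambda>z. e z j)) (at 0)"
      using s y D unfolding trivial_spray_def by blast
    have tv: "(\<lambda>i. t * v i) \<in> Rn k" for t using v by (simp add: Rn_def)
    define \<gamma> where "\<gamma> t = (y, \<lambda>i. t * v i)" for t :: real
    have \<gamma>0: "\<gamma> 0 = (y, \<lambda>i. 0)" by (simp add: \<gamma>_def)
    have \<gamma>X: "\<gamma> t \<in> points X" for t by (simp add: \<gamma>_def pX tv)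
    have d: "\<exists>d. ((\<lambda>t. ?E (\<gamma> t) j) has_real_derivative d) (at 0)" for j
    proof (cases "j < N")
      case True
      then show ?thesis by (auto simp: \<gamma>_def prodc_def intro: DERIV_const)
    next
      case False
      then show ?thesis
        by (intro exI[of _ "v (j - N)"]) (auto simp: \<gamma>_def prodc_def catv_def intro!: derivative_eq_intros)
    qed
    note ct = curve_tangent[OF cX always_eventually[OF allI[OF \<gamma>X]] d]
    show "\<exists>D'\<in>tangent_space X (y, \<lambda>i. 0). \<forall>V g. openin (ztop Y) V \<and> y \<in> V \<and> g \<in> sections Y V \<longrightarrow>
            D V g = D' {z \<in> points X. s z \<in> V} (g \<circ> s)"
    proof (rule bexI[of _ "curve_tangent X \<gamma>"], intro allI impI)
      show "curve_tangent X \<gamma> \<in> tangent_space X (y, \<lambda>i. 0)" using ct(2) \<gamma>0 by simp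
      fix V g assume "openin (ztop Y) V \<and> y \<in> V \<and> g \<in> sections Y V"
      then have V: "openin (ztop Y) V" "y \<in> V" "g \<in> sections Y V" by auto
      have op: "openin (ztop X) {z \<in> points X. s z \<in> V}"
        using reg V(1) unfolding regular_map_def continuous_map_def by blast
      have sec: "g \<circ> s \<in> sections X {z \<in> points X. s z \<in> V}"
        using reg V unfolding regular_map_def by blast
      have "\<gamma> 0 \<in> {z \<in> points X. s z \<in> V}" using \<gamma>X[of 0] \<gamma>0 s0 V(2) by simp
      from ct(1)[OF op this sec]
      have "((\<lambda>t. g (s (\<gamma> t))) has_real_derivative curve_tangent X \<gamma> {z \<in> points X. s z \<in> V} (g \<circ> s)) (at 0)"
        by simp
      moreover have "((\<lambda>t. g (s (\<gamma> t))) has_real_derivative D V g) (at 0)"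
        by (rule derivation_along_curve[OF Y, where \<gamma>="\<lambda>t. s (\<gamma> t)"])
           (use D V y s0 \<gamma>0 dv sp tv in \<open>auto simp: \<gamma>_def\<close>)
      ultimately show "D V g = curve_tangent X \<gamma> {z \<in> points X. s z \<in> V} (g \<circ> s)"
        using DERIV_unique by blast
    qed
  qed
  then show "submersion_at (induced (total (trivial_bundle Y k)) (fiber (trivial_bundle Y k) y)) Y s
      (fzero (trivial_bundle Y k) y)"
    by (simp add: trivial_bundle_def X_def)
qed

theorem corollary1p10:
  fixes Y :: "'a rspace"
  assumes "real_algebraic_variety Y"
    and "uniformly_rational Y"
  shows "malleable Y"
proof -
  obtain N e where Y: "coords Y N e" using real_algebraic_variety_coords[OF assms(1)] by blast
  obtain n where n: "krull_dim (ztop Y) = enat n"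
    and rat: "\<And>y. y \<in> points Y \<Longrightarrow> \<exists>U W. openin (ztop Y) U \<and> y \<in> U \<and> openin (ztop (affine_space n)) W \<and>
           isomorphic (induced Y U) (induced (affine_space n) W)"
    using assms(2) unfolding uniformly_rational_def by blast
  have "\<exists>A b c p psi. chart Y N e n A b c p psi \<and> y \<in> chart.chart_domain Y e n A b c"
    if "y \<in> points Y" for y
    using rat[OF that] chart_exists[OF Y] by blast
  note charts = this
  have nonsing: "nonsingular Y"
    unfolding nonsingular_def
  proof
    fix y assume "y \<in> points Y"
    then obtain A b c p psi where "chart Y N e n A b c p psi" and y: "y \<in> chart.chart_domain Y e n A b c"
      using charts by blast
    then interpret chart Y N e n A b c p psi by simp
    show "\<exists>d. tangent_dim_eq Y y d \<and> local_dim (ztop Y) y = enat d"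
      using tangent_dim[OF y] local_dim_eq[OF y n] by blast
  qed
  define good where "good y U g \<longleftrightarrow> U \<subseteq> points Y \<and> (\<exists>k s. trivial_spray Y N e k s U) \<and>
      g \<in> polys N \<and> g (e y) \<noteq> 0 \<and> (\<forall>z\<in>points Y. g (e z) \<noteq> 0 \<longrightarrow> z \<in> U)" for y U g
  have "\<exists>U g. good y U g" if yP: "y \<in> points Y" for y
  proof -
    obtain A b c p psi where "chart Y N e n A b c p psi" and y: "y \<in> chart.chart_domain Y e n A b c"
      using charts[OF yP] by blast
    then interpret chart Y N e n A b c p psi by simp
    have "zopen (points Y) N e chart_domain" using open_domain coordsD(1)[OF Y] by blast
    then obtain g where "g \<in> polys N" "g (e y) \<noteq> 0" "\<And>z. z \<in> points Y \<Longrightarrow> g (e z) \<noteq> 0 \<Longrightarrow> z \<in> chart_domain"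
      using y by (rule zopenE) (rule that)
    moreover have "chart_domain \<subseteq> points Y" by (auto simp: chart_domain_def)
    ultimately show ?thesis using chart_spray unfolding good_def by blast
  qed
  then obtain U g where "\<And>y. y \<in> points Y \<Longrightarrow> good y (U y) (g y)" by metis
  then have U: "\<And>y. y \<in> points Y \<Longrightarrow> U y \<subseteq> points Y"
    "\<And>y. y \<in> points Y \<Longrightarrow> \<exists>k s. trivial_spray Y N e k s (U y)"
    and g: "\<And>y. y \<in> points Y \<Longrightarrow> g y \<in> polys N" "\<And>y. y \<in> points Y \<Longrightarrow> g y (e y) \<noteq> 0"
      "\<And>y z. y \<in> points Y \<Longrightarrow> z \<in> points Y \<Longrightarrow> g y (e z) \<noteq> 0 \<Longrightarrow> z \<in> U y"
    unfolding good_def by blast+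
  obtain F where F: "finite F" "F \<subseteq> points Y" "\<And>y. y \<in> points Y \<Longrightarrow> \<exists>z\<in>F. g z (e y) \<noteq> 0"
    using finitely_many_nonvanishing[of "points Y" g N e, OF g(1,2)] by blast
  have "(\<Union>z\<in>F. U z) = points Y"
  proof
    show "(\<Union>z\<in>F. U z) \<subseteq> points Y" using U(1) F(2) by blast
    show "points Y \<subseteq> (\<Union>z\<in>F. U z)"
    proof
      fix y assume y: "y \<in> points Y"
      then obtain z where "z \<in> F" "g z (e y) \<noteq> 0" using F(3) by blast
      then show "y \<in> (\<Union>z\<in>F. U z)" using g(3)[of z y] F(2) y by blast
    qed
  qed
  moreover have "\<exists>k s. trivial_spray Y N e k s (\<Union>z\<in>F. U z)"
    by (rule trivial_spray_finite_union[OF F(1)]) (use U F(2) in blast)+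
  ultimately obtain k s where s: "trivial_spray Y N e k s (points Y)" by auto
  show ?thesis
    unfolding malleable_def
    using nonsing trivial_spray_is_spray[OF Y s] trivial_spray_dominating[OF Y s] by blast
qed

end
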